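(* Let $0<p<1$ and $0<k<1$. For every $f\in\Sigma_k(p)$ with the expansion $$f(z)=\frac{1}{z-p}+\sum_{n=0}^{\infty}a_n z^n,\qquad |z|<1,$$ the following inequality holds: $$|a_1|<\frac{k}{1-p^2}.$$
   Context: $\widehat{\mathbb C}=\mathbb C\cup\{\infty\}$ is the extended complex plane and $\mathbb D=\{z\in\mathbb C:|z|<1\}$. For $p\in[0,1)$, $\Sigma(p)$ is the class of meromorphic univalent (injective) functions $f$ in $\mathbb D$ with a simple pole at $z=p$ of residue $1$; since $f(z)-1/(z-p)$ is analytic in $\mathbb D$, each such $f$ has an expansion $f(z)=\frac1{z-p}+\sum_{n=0}^\infty a_nz^n$, $|z|<1$ (the power series converging in $\mathbb D$). For $0\le k<1$, a mapping $F:\widehat{\mathbb C}\to\widehat{\mathbb C}$ is called $k$-quasiconformal if $F$ is a homeomorphism and has locally $L^2$ distributional derivatives on $\mathbb C\setminus\{F^{-1}(\infty)\}$ satisfying $|\bar\partial F|\le k|\partial F|$ a.e., where $\partial F=\partial F/\partial z$ and $\bar\partial F=\partial F/\partial\bar z$. $\Sigma_k(p)$ is the class of those $f\in\Sigma(p)$ which admit a $k$-quasiconformal extension to $\widehat{\mathbb C}$, i.e. for which there is a $k$-quasiconformal $F:\widehat{\mathbb C}\to\widehat{\mathbb C}$ with $F|_{\mathbb D}=f$. *)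

theory Defs
  imports "HOL-Analysis.Analysis" "HOL-Complex_Analysis.Complex_Analysis"
begin

text \<open>
  The extended complex plane is the one-point compactification of \<open>\<complex>\<close>, carried by
  the type \<^typ>\<open>complex option\<close>, with \<^term>\<open>None\<close> as the point at infinity.
\<close>

definition riemann_sphere :: "complex option topology" where
  "riemann_sphere = Alexandroff_compactification (euclidean :: complex topology)"

text \<open>
  A meromorphic function is represented in the convention of \<^const>\<open>nicely_meromorphic_on\<close>:
  it has no removable singularities and takes the dummy value 0 at its poles.
  Its values in the extended plane are given by \<open>sphere_lift\<close>.
\<close>

definition sphere_lift :: "(complex \<Rightarrow> complex) \<Rightarrow> complex \<Rightarrow> complex option" where
  "sphere_lift f z = (if is_pole f z then None else Some (f z))"

definition Sigma_class :: "real \<Rightarrow> (complex \<Rightarrow> complex) set" where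
  "Sigma_class p = {f. f nicely_meromorphic_on ball 0 1 \<and>
     inj_on (sphere_lift f) (ball 0 1) \<and>
     is_pole f (of_real p) \<and> zorder f (of_real p) = - 1 \<and> residue f (of_real p) = 1}"

definition partial_x :: "(complex \<Rightarrow> complex) \<Rightarrow> complex \<Rightarrow> complex" where
  "partial_x f z = frechet_derivative f (at z) 1"

definition partial_y :: "(complex \<Rightarrow> complex) \<Rightarrow> complex \<Rightarrow> complex" where
  "partial_y f z = frechet_derivative f (at z) \<i>"

definition partial_z :: "(complex \<Rightarrow> complex) \<Rightarrow> complex \<Rightarrow> complex" where
  "partial_z f z = (partial_x f z - \<i> * partial_y f z) / 2"

definition partial_zbar :: "(complex \<Rightarrow> complex) \<Rightarrow> complex \<Rightarrow> complex" where
  "partial_zbar f z = (partial_x f z + \<i> * partial_y f z) / 2"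

text \<open>Smoothness is in the real sense, on the plane.\<close>

fun Ck :: "nat \<Rightarrow> (complex \<Rightarrow> complex) \<Rightarrow> bool" where
  "Ck 0 f \<longleftrightarrow> continuous_on UNIV f"
| "Ck (Suc n) f \<longleftrightarrow> (\<forall>z. f differentiable (at z)) \<and> Ck n (partial_x f) \<and> Ck n (partial_y f)"

definition test_function_on :: "complex set \<Rightarrow> (complex \<Rightarrow> complex) \<Rightarrow> bool" where
  "test_function_on U \<phi> \<longleftrightarrow> (\<forall>n. Ck n \<phi>) \<and>
     compact (closure {z. \<phi> z \<noteq> 0}) \<and> closure {z. \<phi> z \<noteq> 0} \<subseteq> U"

definition locally_L2_on :: "complex set \<Rightarrow> (complex \<Rightarrow> complex) \<Rightarrow> bool" where
  "locally_L2_on U g \<longleftrightarrow> g \<in> borel_measurable (lebesgue_on U) \<and>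
     (\<forall>K. compact K \<and> K \<subseteq> U \<longrightarrow> integrable (lebesgue_on K) (\<lambda>z. (norm (g z))\<^sup>2))"

definition distrib_partial_z_on ::
    "complex set \<Rightarrow> (complex \<Rightarrow> complex) \<Rightarrow> (complex \<Rightarrow> complex) \<Rightarrow> bool" where
  "distrib_partial_z_on U f g \<longleftrightarrow> (\<forall>\<phi>. test_function_on U \<phi> \<longrightarrow>
     (\<integral>z. f z * partial_z \<phi> z \<partial>lebesgue_on U) = - (\<integral>z. g z * \<phi> z \<partial>lebesgue_on U))"

definition distrib_partial_zbar_on ::
    "complex set \<Rightarrow> (complex \<Rightarrow> complex) \<Rightarrow> (complex \<Rightarrow> complex) \<Rightarrow> bool" where
  "distrib_partial_zbar_on U f g \<longleftrightarrow> (\<forall>\<phi>. test_function_on U \<phi> \<longrightarrow>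
     (\<integral>z. f z * partial_zbar \<phi> z \<partial>lebesgue_on U) = - (\<integral>z. g z * \<phi> z \<partial>lebesgue_on U))"

text \<open>
  Below, \<open>U\<close> is the complex plane without the preimage of infinity, and \<open>the (F (Some z))\<close> is
  the complex value of \<open>F\<close> at a point \<open>z\<close> of \<open>U\<close>.
\<close>

definition quasiconformal :: "real \<Rightarrow> (complex option \<Rightarrow> complex option) \<Rightarrow> bool" where
  "quasiconformal k F \<longleftrightarrow> 0 \<le> k \<and> k < 1 \<and>
     homeomorphic_map riemann_sphere riemann_sphere F \<and>
     (let U = {z. F (Some z) \<noteq> None} in
       \<exists>g h. locally_L2_on U g \<and> locally_L2_on U h \<and>
         distrib_partial_z_on U (\<lambda>z. the (F (Some z))) g \<and>
         distrib_partial_zbar_on U (\<lambda>z. the (F (Some z))) h \<and>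
         (AE z in lebesgue_on U. norm (h z) \<le> k * norm (g z)))"

definition Sigma_qc :: "real \<Rightarrow> real \<Rightarrow> (complex \<Rightarrow> complex) set" where
  "Sigma_qc k p = {f \<in> Sigma_class p.
     \<exists>F. quasiconformal k F \<and> (\<forall>z\<in>ball 0 1. F (Some z) = sphere_lift f z)}"

end

theory Submission
  imports Defs
begin

text \<open>
  Subtract from the quasiconformal extension \<open>F\<close> its singular part \<open>s z = 1 / (z - p)\<close>. The difference
  \<open>G\<close> is a bounded continuous function on the plane which equals \<open>r z = a 0 + a 1 * z + ...\<close> on the unit
  disc \<open>D\<close>. Let \<open>g\<close> and \<open>h\<close> be its distributional derivatives with respect to \<open>z\<close> and to the
  conjugate variable. Then \<open>g = r'\<close> and \<open>h = 0\<close> on \<open>D\<close>, while \<open>\<bar>h\<bar> \<le> k \<bar>g + s'\<bar>\<close> on the exterior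
  \<open>E\<close> of the disc (lemmas \<open>weak_deriv_regular_part\<close> and \<open>weak_deriv_on_disc\<close>).

  Everything else follows from one fact, the vanishing of the integral of \<open>du \<and> dv\<close> over the plane for
  functions of finite energy (lemma \<open>bilinear_identity\<close>), where \<open>u = G\<close> and \<open>v\<close> is
  \<^item> the conjugate of \<open>G\<close>: then \<open>g\<close> and \<open>h\<close> have the same \<open>L2\<close> norm;
  \<^item> the function \<open>sewn p\<close>, equal to \<open>cnj s\<close> on \<open>E\<close> and continued analytically into \<open>D\<close>: then \<open>g\<close> is
    orthogonal to \<open>s'\<close> on \<open>E\<close>;
  \<^item> the conjugate of \<open>sewn 0\<close>: then \<open>\<pi> * a 1\<close>, which is the integral of \<open>r'\<close> over \<open>D\<close>, is minus the integral of
    \<open>h z / z\<^sup>2\<close> over \<open>E\<close>.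

  Integrating the square of the dilatation bound gives \<open>H \<le> k\<^sup>2 (H - \<delta> + P)\<close>, where \<open>H\<close> is the energy of \<open>h\<close>, \<open>\<delta>\<close> the
  energy of \<open>g\<close> on \<open>D\<close>, and \<open>P = \<pi> / (1 - p\<^sup>2)\<^sup>2\<close> the energy of \<open>s\<close> on \<open>E\<close>. By the Cauchy-Schwarz inequality both \<open>H\<close>
  and \<open>\<delta>\<close> are at least \<open>\<pi> \<bar>a 1\<bar>\<^sup>2\<close>. Hence \<open>\<pi> \<bar>a 1\<bar>\<^sup>2 \<le> k\<^sup>2 P\<close>, which is the bound with \<open>\<le>\<close>, and equality would
  determine \<open>g\<close> and \<open>h\<close> on \<open>E\<close> in a way that contradicts the dilatation bound (theorem \<open>area_estimate\<close>).

  Two analytic points remain. The energies are finite: this is a Caccioppoli estimate, which rests on the boundedness of \<open>G\<close>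
  and on \<open>k < 1\<close> (lemma \<open>finite_energy\<close>). The bilinear identity for merely weakly differentiable
  functions is reduced to the symmetry of second derivatives by mollification (lemma \<open>mollify_L2\<close>).
  The values of the explicit integrals over discs come from a Green formula for Lipschitz functions vanishing on the
  boundary circle (lemma \<open>disc_green\<close>), which rests on the translation invariance of the integral alone.
\<close>

section \<open>Calculus of smooth functions\<close>

text \<open>
  The directional derivative; \<open>partial_x\<close> and \<open>partial_y\<close> are the directions \<open>1\<close> and \<open>\<i>\<close>, so
  that the calculus rules need to be proved only once.
\<close>

definition pd :: "complex \<Rightarrow> (complex \<Rightarrow> complex) \<Rightarrow> complex \<Rightarrow> complex" where
  "pd v f z = frechet_derivative f (at z) v"

lemma partial_x_eq_pd: "partial_x f = pd 1 f"
  by (simp add: fun_eq_iff partial_x_def pd_def)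

lemma partial_y_eq_pd: "partial_y f = pd \<i> f"
  by (simp add: fun_eq_iff partial_y_def pd_def)

lemma pd_eq: "(f has_derivative D) (at z) \<Longrightarrow> pd v f z = D v"
  unfolding pd_def using frechet_derivative_at by metis

lemma pd_works: "f differentiable (at z) \<Longrightarrow> (f has_derivative (\<lambda>v. pd v f z)) (at z)"
  unfolding pd_def by (simp add: frechet_derivative_works)

lemma pd_const [simp]: "pd v (\<lambda>z. c) z = 0"
  by (rule pd_eq) (rule has_derivative_const)

lemma pd_ident [simp]: "pd v (\<lambda>z. z) z = v"
  by (rule pd_eq) (rule has_derivative_ident)

lemma pd_add:
  "f differentiable (at z) \<Longrightarrow> g differentiable (at z) \<Longrightarrow>
   pd v (\<lambda>z. f z + g z) z = pd v f z + pd v g z"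
  by (rule pd_eq) (intro has_derivative_add pd_works)

lemma pd_mult:
  "f differentiable (at z) \<Longrightarrow> g differentiable (at z) \<Longrightarrow>
   pd v (\<lambda>z. f z * g z) z = f z * pd v g z + pd v f z * g z"
  by (rule pd_eq) (intro has_derivative_mult pd_works)

lemma pd_cnj:
  "f differentiable (at z) \<Longrightarrow> pd v (\<lambda>z. cnj (f z)) z = cnj (pd v f z)"
  by (rule pd_eq) (intro has_derivative_cnj pd_works)

lemma pd_inverse:
  "f differentiable (at z) \<Longrightarrow> f z \<noteq> 0 \<Longrightarrow>
   pd v (\<lambda>z. inverse (f z)) z = - (pd v f z * (inverse (f z) * inverse (f z)))"
  by (rule trans[OF pd_eq[OF Deriv.has_derivative_inverse[OF _ pd_works]]]) (auto simp: mult_ac)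

lemma differentiable_cnj:
  "f differentiable (at z) \<Longrightarrow> (\<lambda>z. cnj (f z)) differentiable (at z)"
  unfolding differentiable_def using has_derivative_cnj by blast

lemma affine_has_derivative:
  assumes "f differentiable (at (a + of_real r * z))"
  shows "((\<lambda>z. f (a + of_real r * z)) has_derivative
           (\<lambda>v. of_real r * pd v f (a + of_real r * z))) (at z)"
proof -
  have 1: "(f has_derivative (\<lambda>v. pd v f (a + of_real r * z))) (at (a + of_real r * z))"
    using assms by (rule pd_works)
  have 2: "((\<lambda>z. a + of_real r * z) has_derivative (\<lambda>v. of_real r * v)) (at z)"
    by (auto intro!: derivative_eq_intros)
  have L: "linear (\<lambda>v. pd v f (a + of_real r * z))"
    using 1 by (simp add: has_derivative_linear)
  have "pd (of_real r * v) f (a + of_real r * z) = of_real r * pd v f (a + of_real r * z)" for v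
    using linear_scale[OF L, of r v] by (simp add: scaleR_conv_of_real)
  then show ?thesis
    using has_derivative_compose[OF 2 1] by simp
qed

lemma pd_affine:
  "f differentiable (at (a + of_real r * z)) \<Longrightarrow>
   pd v (\<lambda>z. f (a + of_real r * z)) z = of_real r * pd v f (a + of_real r * z)"
  by (rule pd_eq, erule affine_has_derivative)

lemma Ck_Suc: "Ck (Suc n) f \<longleftrightarrow> (\<forall>z. f differentiable (at z)) \<and> Ck n (pd 1 f) \<and> Ck n (pd \<i> f)"
  by (simp add: partial_x_eq_pd partial_y_eq_pd)

declare Ck.simps(2) [simp del]

lemma Ck_SucD: "Ck (Suc n) f \<Longrightarrow> Ck n f"
proof (induction n arbitrary: f)
  case 0
  then show ?case
    by (auto simp: Ck_Suc continuous_on_eq_continuous_at intro: differentiable_imp_continuous_within)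
next
  case (Suc n)
  then show ?case using Ck_Suc by metis
qed

lemma Ck_const: "Ck n (\<lambda>z. c)"
proof (induction n arbitrary: c)
  case (Suc n)
  have "pd v (\<lambda>z. c) = (\<lambda>z. 0)" for v by auto
  then show ?case using Suc by (simp add: Ck_Suc)
qed simp

lemma Ck_ident: "Ck n (\<lambda>z. z)"
proof (cases n)
  case (Suc m)
  have "pd v (\<lambda>z. z) = (\<lambda>z. v)" for v by auto
  then show ?thesis using Suc by (simp add: Ck_Suc Ck_const)
qed simp

lemma Ck_add: "Ck n f \<Longrightarrow> Ck n g \<Longrightarrow> Ck n (\<lambda>z. f z + g z)"
proof (induction n arbitrary: f g)
  case (Suc n)
  have "pd v (\<lambda>z. f z + g z) = (\<lambda>z. pd v f z + pd v g z)" for v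
    using Suc.prems by (auto simp: pd_add Ck_Suc)
  then show ?case using Suc by (simp add: Ck_Suc)
qed (auto intro: continuous_intros)

lemma Ck_mult: "Ck n f \<Longrightarrow> Ck n g \<Longrightarrow> Ck n (\<lambda>z. f z * g z)"
proof (induction n arbitrary: f g)
  case (Suc n)
  have eq: "pd v (\<lambda>z. f z * g z) = (\<lambda>z. f z * pd v g z + pd v f z * g z)" for v
    using Suc.prems by (auto simp: pd_mult Ck_Suc)
  have "Ck n f" "Ck n g" using Suc.prems Ck_SucD by auto
  then show ?case using Suc unfolding Ck_Suc eq by (auto intro!: Ck_add)
qed (auto intro: continuous_intros)

lemma Ck_uminus: "Ck n f \<Longrightarrow> Ck n (\<lambda>z. - f z)"
  using Ck_mult[OF Ck_const[of n "- 1"], of f] by simp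

lemma Ck_diff: "Ck n f \<Longrightarrow> Ck n g \<Longrightarrow> Ck n (\<lambda>z. f z - g z)"
  using Ck_add[OF _ Ck_uminus, of n f g] by simp

lemma Ck_cnj: "Ck n f \<Longrightarrow> Ck n (\<lambda>z. cnj (f z))"
proof (induction n arbitrary: f)
  case (Suc n)
  have eq: "pd v (\<lambda>z. cnj (f z)) = (\<lambda>z. cnj (pd v f z))" for v
    using Suc.prems by (auto simp: pd_cnj Ck_Suc)
  show ?case using Suc unfolding Ck_Suc eq by (auto intro: differentiable_cnj)
qed (auto intro: continuous_intros)

lemma Ck_affine: "Ck n f \<Longrightarrow> Ck n (\<lambda>z. f (a + of_real r * z))"
proof (induction n arbitrary: f)
  case 0
  then show ?case by (auto intro!: continuous_intros continuous_on_compose2[of UNIV f])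
next
  case (Suc n)
  have d: "f differentiable (at z)" for z using Suc.prems by (simp add: Ck_Suc)
  have eq: "pd v (\<lambda>z. f (a + of_real r * z)) = (\<lambda>z. of_real r * pd v f (a + of_real r * z))" for v
    using d by (auto simp: pd_affine)
  have "(\<lambda>z. f (a + of_real r * z)) differentiable (at z)" for z
    using affine_has_derivative[OF d] unfolding differentiable_def by blast
  then show ?case using Suc unfolding Ck_Suc eq by (auto intro!: Ck_mult Ck_const)
qed

lemma Ck_inverse: "Ck n f \<Longrightarrow> (\<And>z. f z \<noteq> 0) \<Longrightarrow> Ck n (\<lambda>z. inverse (f z))"
proof (induction n arbitrary: f)
  case (Suc n)
  have eq: "pd v (\<lambda>z. inverse (f z)) =
      (\<lambda>z. - (pd v f z * (inverse (f z) * inverse (f z))))" for v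
    using Suc.prems by (auto simp: pd_inverse Ck_Suc)
  have "Ck n (\<lambda>z. inverse (f z))" using Suc.prems Suc.IH Ck_SucD by blast
  then show ?case using Suc.prems unfolding Ck_Suc eq
    by (auto intro!: Ck_mult Ck_uminus differentiable_inverse)
qed (auto intro: continuous_intros)

section \<open>A smooth bump function\<close>

text \<open>
  The smoothness of \<open>exp (- 1 / x)\<close> at the origin is obtained for the whole family \<open>exp (- 1 / x) / x ^ n\<close>
  at once, because the derivative of a member is a linear combination of two others.
\<close>

definition flat :: "nat \<Rightarrow> real \<Rightarrow> real" where
  "flat n x = (if x \<le> 0 then 0 else exp (- (1 / x)) / x ^ n)"

lemma flat_nonneg: "0 \<le> flat n x"
  by (simp add: flat_def)

lemma flat_pos: "0 < x \<Longrightarrow> 0 < flat n x"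
  by (simp add: flat_def)

lemma power_le_fact_exp:
  fixes y :: real assumes "0 \<le> y" shows "y ^ m \<le> fact m * exp y"
proof -
  have "(\<Sum>n\<in>{m}. y ^ n /\<^sub>R fact n) \<le> (\<Sum>n. y ^ n /\<^sub>R fact n)"
    using assms by (intro sum_le_suminf summable_exp_generic) auto
  then show ?thesis by (simp add: exp_def field_simps)
qed

text \<open>
  The quadratic bound makes every \<open>flat n\<close> differentiable at the origin with derivative zero.
\<close>

lemma flat_le: "\<bar>flat n x\<bar> \<le> fact (n + 2) * x\<^sup>2"
proof (cases "x \<le> 0")
  case False
  then have x: "x > 0" by simp
  have "(1 / x) ^ (n + 2) \<le> fact (n + 2) * exp (1 / x)"
    by (rule power_le_fact_exp) (use x in simp)
  then have "1 \<le> fact (n + 2) * exp (1 / x) * x ^ (n + 2)"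
    using x by (simp add: power_one_over divide_simps del: fact_Suc)
  then have "exp (- (1 / x)) \<le> fact (n + 2) * x ^ (n + 2)"
    using x by (simp add: exp_minus divide_simps mult_ac del: fact_Suc)
  then have "exp (- (1 / x)) / x ^ n \<le> fact (n + 2) * x\<^sup>2"
    using x by (simp add: divide_simps power_add mult_ac power2_eq_square del: fact_Suc)
  then show ?thesis using x by (simp add: flat_def del: fact_Suc)
qed (simp add: flat_def)

lemma flat_deriv: "(flat n has_real_derivative (flat (n + 2) x - real n * flat (n + 1) x)) (at x)"
proof -
  consider "x > 0" | "x < 0" | "x = 0" by linarith
  then show ?thesis
  proof cases
    case 1
    have pw: "real n * x ^ (n - Suc 0) = real n * x ^ n / x"
      using 1 by (cases n) auto
    have "((\<lambda>x. exp (- (1 / x)) / x ^ n) has_real_derivative (flat (n + 2) x - real n * flat (n + 1) x)) (at x)"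
      using 1 by (auto intro!: derivative_eq_intros simp: pw flat_def divide_simps power2_eq_square) (simp add: algebra_simps)
    then show ?thesis
      by (rule DERIV_cong_ev[OF refl _ refl, THEN iffD1, rotated])
         (use 1 in \<open>auto simp: flat_def eventually_at_topological intro!: eventually_nhds[THEN iffD2] exI[of _ "{0<..}"]\<close>)
  next
    case 2
    have "((\<lambda>x. 0) has_real_derivative (flat (n + 2) x - real n * flat (n + 1) x)) (at x)"
      using 2 by (auto simp: flat_def)
    then show ?thesis
      by (rule DERIV_cong_ev[OF refl _ refl, THEN iffD1, rotated])
         (use 2 in \<open>auto simp: flat_def intro!: eventually_nhds[THEN iffD2] exI[of _ "{..<0}"]\<close>)
  next
    case 3
    have "(\<lambda>h. flat n h / h) \<midarrow>0\<rightarrow> 0"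
    proof (rule Lim_null_comparison[OF always_eventually])
      show "\<forall>h. norm (flat n h / h) \<le> fact (n + 2) * \<bar>h\<bar>"
      proof
        fix h :: real
        show "norm (flat n h / h) \<le> fact (n + 2) * \<bar>h\<bar>"
        proof (cases "h = 0")
          case False
          have "\<bar>flat n h\<bar> \<le> fact (n + 2) * \<bar>h\<bar> * \<bar>h\<bar>"
            using flat_le[of n h] by (simp add: power2_eq_square mult_ac del: fact_Suc)
          then show ?thesis using False by (simp add: divide_simps del: fact_Suc)
        qed simp
      qed
      show "((\<lambda>h::real. fact (n + 2) * \<bar>h\<bar>) \<longlongrightarrow> 0) (at 0)"
        by (auto intro!: tendsto_eq_intros)
    qed
    then show ?thesis using 3 by (simp add: DERIV_def flat_def)
  qed
qed

lemma Re_conv_cnj: "of_real (Re w) = (1 / 2) * (w + cnj w)"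
  by (simp add: complex_add_cnj)

lemma pd_flat:
  assumes "f differentiable (at z)"
  shows "((\<lambda>z. complex_of_real (flat n (Re (f z)))) has_derivative
    (\<lambda>v. (of_real (flat (n + 2) (Re (f z))) - of_nat n * of_real (flat (n + 1) (Re (f z)))) *
          ((1 / 2) * (pd v f z + cnj (pd v f z))))) (at z)"
proof -
  have "((\<lambda>z. Re (f z)) has_derivative (\<lambda>v. Re (pd v f z))) (at z)"
    using pd_works[OF assms] by (rule has_derivative_Re)
  then have "((\<lambda>z. flat n (Re (f z))) has_derivative
      (\<lambda>v. (flat (n + 2) (Re (f z)) - real n * flat (n + 1) (Re (f z))) * Re (pd v f z))) (at z)"
    by (rule has_derivative_compose) (use flat_deriv in \<open>auto simp: has_field_derivative_def\<close>)
  from has_derivative_of_real[OF this] show ?thesis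
    unfolding Re_conv_cnj[symmetric] by simp
qed

text \<open>
  All orders are treated simultaneously: differentiating \<open>flat n\<close> leads to \<open>flat (n + 1)\<close> and \<open>flat (n + 2)\<close>.
\<close>

lemma Ck_flat: "Ck m f \<Longrightarrow> Ck m (\<lambda>z. of_real (flat n (Re (f z))))"
proof (induction m arbitrary: n)
  case 0
  have "continuous_on UNIV (flat n)"
    using flat_deriv DERIV_isCont continuous_at_imp_continuous_on by blast
  then show ?case using 0 by (auto intro!: continuous_intros continuous_on_compose2[of UNIV "flat n"])
next
  case (Suc m)
  have d: "f differentiable (at z)" for z using Suc.prems by (simp add: Ck_Suc)
  have "pd v (\<lambda>z. of_real (flat n (Re (f z)))) =
     (\<lambda>z. (of_real (flat (n + 2) (Re (f z))) - of_nat n * of_real (flat (n + 1) (Re (f z)))) *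
          ((1 / 2) * (pd v f z + cnj (pd v f z))))" for v
    by (rule ext, subst pd_eq[OF pd_flat[OF d]]) simp
  moreover have "(\<lambda>z. complex_of_real (flat n (Re (f z)))) differentiable (at z)" for z
    using pd_flat[OF d] unfolding differentiable_def by blast
  ultimately show ?case
    using Suc Ck_SucD[OF Suc.prems] unfolding Ck_Suc by (auto intro!: Ck_mult Ck_add Ck_diff Ck_const Ck_cnj simp del: times_divide_eq_left)
qed

text \<open>
  With \<open>A\<close> positive exactly for \<open>\<bar>z\<bar> < 2\<close> and \<open>B\<close> positive exactly for \<open>\<bar>z\<bar> > 1\<close>, the quotient
  \<open>A / (A + B)\<close> never has a vanishing denominator and is the required plateau.
\<close>

lemma smooth_bump_exists:
  obtains bump :: "complex \<Rightarrow> real" where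
    "\<And>n. Ck n (\<lambda>z. of_real (bump z))" "\<And>z. 0 \<le> bump z" "\<And>z. bump z \<le> 1"
    "\<And>z. norm z \<le> 1 \<Longrightarrow> bump z = 1" "\<And>z. norm z \<ge> 2 \<Longrightarrow> bump z = 0"
proof -
  define A where "A z = flat 0 (4 - (norm z)\<^sup>2)" for z :: complex
  define B where "B z = flat 0 ((norm z)\<^sup>2 - 1)" for z :: complex
  have pos: "A z + B z > 0" for z
  proof (cases "norm z < 2")
    case True
    then have "A z > 0" unfolding A_def
      by (intro flat_pos) (use power_strict_mono[of "norm z" 2 2] in auto)
    then show ?thesis by (simp add: B_def flat_nonneg add_pos_nonneg)
  next
    case False
    then have "B z > 0" unfolding B_def
      by (intro flat_pos) (use power_mono[of 2 "norm z" 2] in auto)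
    then show ?thesis by (simp add: A_def flat_nonneg add_nonneg_pos)
  qed
  have CA: "Ck n (\<lambda>z. of_real (A z))" for n
  proof -
    have "Ck n (\<lambda>z. of_real (flat 0 (Re (4 - z * cnj z))))"
      by (intro Ck_flat Ck_diff Ck_mult Ck_const Ck_ident Ck_cnj)
    then show ?thesis by (simp add: A_def complex_mult_cnj cmod_power2)
  qed
  have CB: "Ck n (\<lambda>z. of_real (B z))" for n
  proof -
    have "Ck n (\<lambda>z. of_real (flat 0 (Re (z * cnj z - 1))))"
      by (intro Ck_flat Ck_diff Ck_mult Ck_const Ck_ident Ck_cnj)
    then show ?thesis by (simp add: B_def complex_mult_cnj cmod_power2)
  qed
  have ne: "complex_of_real (A z) + of_real (B z) \<noteq> 0" for z
    using pos[of z] by (metis less_irrefl of_real_add of_real_eq_0_iff)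
  show ?thesis
  proof (rule that[of "\<lambda>z. A z / (A z + B z)"])
    fix n
    have "Ck n (\<lambda>z. of_real (A z) * inverse (of_real (A z) + of_real (B z)))"
      by (intro Ck_mult Ck_inverse Ck_add CA CB ne)
    then show "Ck n (\<lambda>z. of_real (A z / (A z + B z)))"
      by (simp add: divide_inverse)
  next
    fix z
    show "0 \<le> A z / (A z + B z)" "A z / (A z + B z) \<le> 1"
      using pos[of z] flat_nonneg[of 0] by (auto simp: A_def B_def divide_simps)
    show "A z / (A z + B z) = 1" if "norm z \<le> 1"
    proof -
      have "(norm z)\<^sup>2 \<le> 1" using that by (simp add: power_le_one)
      then have "B z = 0" by (simp add: B_def flat_def)
      then show ?thesis using pos[of z] by simp
    qed
    show "A z / (A z + B z) = 0" if "norm z \<ge> 2"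
    proof -
      have "(norm z)\<^sup>2 \<ge> 4" using power_mono[OF that, of 2] by simp
      then have "A z = 0" by (simp add: A_def flat_def)
      then show ?thesis by simp
    qed
  qed
qed

section \<open>Symmetry of mixed derivatives\<close>

definition smooth :: "(complex \<Rightarrow> complex) \<Rightarrow> bool" where
  "smooth f \<longleftrightarrow> (\<forall>n. Ck n f)"

lemma smooth_differentiable: "smooth f \<Longrightarrow> f differentiable (at z)"
  unfolding smooth_def using Ck_Suc by blast

lemma smooth_pd: "smooth f \<Longrightarrow> v = 1 \<or> v = \<i> \<Longrightarrow> smooth (pd v f)"
  unfolding smooth_def using Ck_Suc by blast

lemma smooth_continuous: "smooth f \<Longrightarrow> continuous_on UNIV f"
  unfolding smooth_def using Ck.simps(1) by blast

lemma smooth_line_derivative: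
  assumes "smooth f"
  shows "((\<lambda>t. f (z + of_real t * v)) has_vector_derivative pd v f (z + of_real t * v)) (at t within S)"
proof -
  let ?w = "z + of_real t * v"
  have 1: "(f has_derivative (\<lambda>v. pd v f ?w)) (at ?w)"
    using assms by (intro pd_works smooth_differentiable)
  have 2: "((\<lambda>t::real. z + of_real t * v) has_derivative (\<lambda>h. of_real h * v)) (at t within S)"
    by (auto intro!: derivative_eq_intros)
  have L: "linear (\<lambda>v. pd v f ?w)" using 1 by (simp add: has_derivative_linear)
  have "pd (of_real h * v) f ?w = h *\<^sub>R pd v f ?w" for h
    using linear_scale[OF L, of h v] by (simp add: scaleR_conv_of_real)
  then show ?thesis
    using has_derivative_compose[OF 2 1] by (simp add: has_vector_derivative_def)
qed

text \<open>
  Integrating the derivative in direction \<open>1\<close> over a segment and differentiating under the integral in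
  direction \<open>\<i>\<close> expresses an increment of \<open>pd \<i> f\<close> as the integral of \<open>pd \<i> (pd 1 f)\<close>; differentiating
  this once more at the end point of the segment exchanges the order.
\<close>

lemma smooth_mixed_partials:
  assumes f: "smooth f"
  shows "pd \<i> (pd 1 f) z = pd 1 (pd \<i> f) z"
proof -
  have f1: "smooth (pd 1 f)" and fi: "smooth (pd \<i> f)" and f1i: "smooth (pd \<i> (pd 1 f))"
    using f smooth_pd by auto
  have key: "integral {0..s} (\<lambda>\<sigma>. pd \<i> (pd 1 f) (z + of_real \<sigma>)) =
      pd \<i> f (z + of_real s) - pd \<i> f z" if s: "s \<ge> 0" for s
  proof -
    have FTC: "integral {0..s} (\<lambda>\<sigma>. pd 1 f (z + of_real t * \<i> + of_real \<sigma>)) =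
        f (z + of_real s + of_real t * \<i>) - f (z + of_real t * \<i>)" for t
      using integral_unique[OF fundamental_theorem_of_calculus[OF s
          smooth_line_derivative[OF f, of "z + of_real t * \<i>" 1]]]
      by (simp add: add_ac)
    have "((\<lambda>t. integral (cbox 0 s) (\<lambda>\<sigma>. pd 1 f (z + of_real t * \<i> + of_real \<sigma>))) has_vector_derivative
       integral (cbox 0 s) (\<lambda>\<sigma>. pd \<i> (pd 1 f) (z + of_real 0 * \<i> + of_real \<sigma>))) (at 0 within UNIV)"
    proof (rule leibniz_rule_vector_derivative[where U = UNIV])
      fix t \<sigma> :: real
      show "((\<lambda>t. pd 1 f (z + of_real t * \<i> + of_real \<sigma>)) has_vector_derivative
          pd \<i> (pd 1 f) (z + of_real t * \<i> + of_real \<sigma>)) (at t within UNIV)"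
        using smooth_line_derivative[OF f1, of "z + of_real \<sigma>" \<i> t UNIV] by (simp add: add_ac)
      show "(\<lambda>\<sigma>. pd 1 f (z + of_real t * \<i> + of_real \<sigma>)) integrable_on cbox 0 s"
        by (intro integrable_continuous continuous_intros continuous_on_compose2[OF smooth_continuous[OF f1]]) auto
    next
      show "continuous_on (UNIV \<times> cbox 0 s) (\<lambda>(t, \<sigma>). pd \<i> (pd 1 f) (z + of_real t * \<i> + of_real \<sigma>))"
        by (auto simp: split_beta intro!: continuous_intros continuous_on_compose2[OF smooth_continuous[OF f1i]])
    qed auto
    then have 1: "((\<lambda>t. f (z + of_real s + of_real t * \<i>) - f (z + of_real t * \<i>)) has_vector_derivative
       integral {0..s} (\<lambda>\<sigma>. pd \<i> (pd 1 f) (z + of_real \<sigma>))) (at 0)"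
      by (simp add: FTC)
    have 2: "((\<lambda>t. f (z + of_real s + of_real t * \<i>) - f (z + of_real t * \<i>)) has_vector_derivative
        pd \<i> f (z + of_real s) - pd \<i> f z) (at 0)"
      using has_vector_derivative_diff[OF smooth_line_derivative[OF f, of "z + of_real s" \<i> 0 UNIV]
          smooth_line_derivative[OF f, of z \<i> 0 UNIV]] by simp
    show ?thesis using vector_derivative_unique_at[OF 1 2] .
  qed
  have "continuous_on {0..1} (\<lambda>\<sigma>. pd \<i> (pd 1 f) (z + of_real \<sigma>))"
    by (intro continuous_intros continuous_on_compose2[OF smooth_continuous[OF f1i]]) auto
  from integral_has_vector_derivative[OF this, of 0]
  have "((\<lambda>s. integral {0..s} (\<lambda>\<sigma>. pd \<i> (pd 1 f) (z + of_real \<sigma>))) has_vector_derivative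
      pd \<i> (pd 1 f) z) (at 0 within {0..1})"
    by simp
  then have 1: "((\<lambda>s. pd \<i> f (z + of_real s) - pd \<i> f z) has_vector_derivative
      pd \<i> (pd 1 f) z) (at 0 within {0..1})"
    by (rule has_vector_derivative_transform[rotated 2]) (auto simp: key)
  have 2: "((\<lambda>s. pd \<i> f (z + of_real s) - pd \<i> f z) has_vector_derivative
      pd 1 (pd \<i> f) z) (at 0 within {0..1})"
    using has_vector_derivative_diff[OF smooth_line_derivative[OF fi, of z 1 0 "{0..1}"]
       has_vector_derivative_const[of "pd \<i> f z"]] by simp
  show ?thesis
    using vector_derivative_unique_within_closed_interval[of 0 1 "0::real"] 1 2 by (auto simp: cbox_interval)
qed

section \<open>Integrals over the plane\<close>

lemma integrable_bounded_support:
  fixes f :: "complex \<Rightarrow> 'b :: {banach, second_countable_topology}"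
  assumes "f \<in> borel_measurable borel" and "\<And>z. norm (f z) \<le> B" and "\<And>z. norm z > R \<Longrightarrow> f z = 0"
  shows "integrable lborel f"
proof (rule Bochner_Integration.integrable_bound)
  show "integrable lborel (\<lambda>z::complex. B * indicator (cball 0 R) z :: real)"
    by (intro integrable_mult_right integrable_real_indicator) (auto intro!: emeasure_bounded_finite[OF bounded_cball, simplified])
  show "AE z in lborel. norm (f z) \<le> norm (B * indicator (cball 0 R) z :: real)"
  proof (rule AE_I2)
    fix z
    show "norm (f z) \<le> norm (B * indicator (cball 0 R) z :: real)"
      using assms(2)[of z] assms(3)[of z] by (cases "norm z \<le> R") (auto simp: indicator_def)
  qed
qed (use assms in auto)

lemma lborel_integral_translate:
  fixes f :: "complex \<Rightarrow> 'b :: {banach, second_countable_topology}"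
  assumes "f \<in> borel_measurable borel"
  shows "(\<integral>z. f (c + z) \<partial>lborel) = (\<integral>z. f z \<partial>lborel)"
proof -
  have "(\<integral>z. f z \<partial>lborel) = (\<integral>z. f z \<partial>distr lborel borel ((+) c))"
    by (simp add: lborel_distr_plus)
  also have "\<dots> = (\<integral>z. f (c + z) \<partial>lborel)"
    by (subst integral_distr) (use assms in auto)
  finally show ?thesis by simp
qed

lemma lborel_distr_reflect: "distr lborel borel ((-) c) = (lborel :: complex measure)"
proof -
  show ?thesis using lborel_affine[of "- 1" c] by (simp add: density_1)
qed

lemma lborel_integral_reflect:
  fixes f :: "complex \<Rightarrow> 'b :: {banach, second_countable_topology}"
  assumes "f \<in> borel_measurable borel"
  shows "(\<integral>z. f (c - z) \<partial>lborel) = (\<integral>z. f z \<partial>lborel)"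
proof -
  have "(\<integral>z. f z \<partial>lborel) = (\<integral>z. f z \<partial>distr lborel borel ((-) c))"
    by (simp add: lborel_distr_reflect)
  also have "\<dots> = (\<integral>z. f (c - z) \<partial>lborel)"
    by (subst integral_distr) (use assms in auto)
  finally show ?thesis by simp
qed

lemma lborel_integrable_reflect:
  fixes f :: "complex \<Rightarrow> 'b :: {banach, second_countable_topology}"
  assumes "integrable lborel f"
  shows "integrable lborel (\<lambda>z. f (c - z))"
proof -
  have "integrable (distr lborel borel ((-) c)) f" using assms by (simp add: lborel_distr_reflect)
  then show ?thesis using assms by (subst (asm) integrable_distr_eq) auto
qed

lemma nn_integral_translate:
  fixes f :: "complex \<Rightarrow> ennreal"
  assumes "f \<in> borel_measurable borel"
  shows "(\<integral>\<^sup>+z. f (c + z) \<partial>lborel) = (\<integral>\<^sup>+z. f z \<partial>lborel)"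
proof -
  have "(\<integral>\<^sup>+z. f z \<partial>lborel) = (\<integral>\<^sup>+z. f z \<partial>distr lborel borel ((+) c))"
    by (simp add: lborel_distr_plus)
  also have "\<dots> = (\<integral>\<^sup>+z. f (c + z) \<partial>lborel)"
    by (subst nn_integral_distr) (use assms in auto)
  finally show ?thesis by simp
qed

text \<open>
  The integral of \<open>\<psi>\<close> is invariant under translation, so the integrals of its difference quotients vanish.
  The Lipschitz bound dominates these quotients, and they converge to the derivative almost everywhere.
  Every integration by parts over the plane is an instance; Lipschitz functions may have kinks along a circle.
\<close>

lemma integral_derivative_eq_0:
  fixes \<psi> :: "complex \<Rightarrow> complex"
  assumes lip: "L-lipschitz_on UNIV \<psi>"
    and supp: "\<And>z. norm z > R \<Longrightarrow> \<psi> z = 0"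
    and N: "N \<in> null_sets lborel"
    and D: "\<And>z. z \<notin> N \<Longrightarrow> (\<psi> has_derivative D z) (at z)"
    and D_meas: "(\<lambda>z. D z v) \<in> borel_measurable borel"
  shows "integrable lborel (\<lambda>z. D z v)" "(\<integral>z. D z v \<partial>lborel) = 0"
proof -
  define h where "h n = of_real (inverse (real (Suc n))) * v" for n
  define s where "s n z = of_nat (Suc n) * (\<psi> (h n + z) - \<psi> z)" for n z
  have L0: "L \<ge> 0" using lip lipschitz_on_nonneg by blast
  have cont: "continuous_on UNIV \<psi>" using lip lipschitz_on_continuous_on by blast
  have meas[measurable]: "\<psi> \<in> borel_measurable borel"
    using cont by (rule borel_measurable_continuous_onI)
  have bdd: "norm (\<psi> z) \<le> norm (\<psi> 0) + L * \<bar>R\<bar>" for z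
  proof (cases "norm z > R")
    case True then show ?thesis using supp[of z] L0 by simp
  next
    case False
    have "norm (\<psi> z - \<psi> 0) \<le> L * norm (z - 0)"
      using lipschitz_on_normD[OF lip, of z 0] by simp
    also have "\<dots> \<le> L * \<bar>R\<bar>" using False L0 by (intro mult_left_mono) auto
    finally show ?thesis using norm_triangle_sub[of "\<psi> z" "\<psi> 0"] by linarith
  qed
  have psi_int: "integrable lborel \<psi>"
    using meas bdd supp by (rule integrable_bounded_support)
  have psi_int': "integrable lborel (\<lambda>z. \<psi> (h n + z))" for n
  proof -
    have "integrable (distr lborel borel ((+) (h n))) \<psi>" using psi_int by (simp add: lborel_distr_plus)
    then show ?thesis by (subst (asm) integrable_distr_eq) auto
  qed
  have s0: "(\<integral>z. s n z \<partial>lborel) = 0" for n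
    unfolding s_def using psi_int psi_int' by (simp add: lborel_integral_translate)
  have hn: "norm (h n) = norm v / Suc n" for n
    unfolding h_def norm_mult norm_of_real by (simp add: divide_inverse mult.commute)
  have s_bound: "norm (s n z) \<le> L * norm v" for n z
  proof -
    have "norm (\<psi> (h n + z) - \<psi> z) \<le> L * norm (h n)"
      using lipschitz_on_normD[OF lip, of "h n + z" z] by simp
    also have "\<dots> = L * norm v / Suc n" by (simp add: hn)
    finally have "real (Suc n) * norm (\<psi> (h n + z) - \<psi> z) \<le> L * norm v"
      by (simp add: field_simps)
    then show ?thesis by (simp only: s_def norm_mult norm_of_nat)
  qed
  have s_supp: "s n z = 0" if "norm z > \<bar>R\<bar> + norm v" for n z
  proof -
    have "norm (h n) \<le> norm v" by (simp add: hn divide_le_eq mult_le_cancel_left1)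
    moreover have "norm z \<le> norm (h n + z) + norm (h n)"
      using norm_triangle_ineq4[of "h n + z" "h n"] by simp
    ultimately have "norm z > R" "norm (h n + z) > R" using that norm_ge_zero[of v] by linarith+
    then show ?thesis by (simp add: s_def supp)
  qed
  have conv: "(\<lambda>n. s n z) \<longlonglongrightarrow> D z v" if "z \<notin> N" for z
  proof -
    have hd: "(\<psi> has_derivative D z) (at z)" using D that by auto
    then have lin: "linear (D z)" by (rule has_derivative_linear)
    have q: "(\<lambda>h. norm (\<psi> (z + h) - \<psi> z - D z h) / norm h) \<midarrow>0\<rightarrow> 0"
      using hd by (simp add: has_derivative_at)
    have fl: "filterlim h (at 0) sequentially" if v: "v \<noteq> 0"
    proof -
      have "(\<lambda>n. of_real (inverse (real (Suc n))) * v) \<longlonglongrightarrow> of_real 0 * v"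
        by (intro tendsto_intros LIMSEQ_inverse_real_of_nat)
      then show ?thesis unfolding filterlim_at h_def using v by (simp add: field_simps del: of_nat_Suc)
    qed
    have lim: "(\<lambda>n. norm (\<psi> (z + h n) - \<psi> z - D z (h n)) / norm (h n)) \<longlonglongrightarrow> 0" if "v \<noteq> 0"
      by (rule filterlim_compose[OF q fl[OF that]])
    have eq: "norm (\<psi> (z + h n) - \<psi> z - D z (h n)) / norm (h n) = norm (s n z - D z v) / norm v" for n
    proof -
      have "D z (h n) = of_real (inverse (real (Suc n))) * D z v"
        using linear_scale[OF lin, of "inverse (real (Suc n))" v] by (simp add: h_def scaleR_conv_of_real)
      then have "of_nat (Suc n) * D z (h n) = D z v"
        by (simp add: field_simps del: of_nat_Suc)
      then have "s n z - D z v = of_nat (Suc n) * (\<psi> (z + h n) - \<psi> z - D z (h n))"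
        by (simp add: s_def algebra_simps del: of_nat_Suc)
      then show ?thesis by (simp add: norm_mult hn del: of_nat_Suc)
    qed
    show ?thesis
    proof (cases "v = 0")
      case True
      then show ?thesis using linear_0[OF lin] by (simp add: s_def h_def)
    next
      case False
      have "(\<lambda>n. norm (s n z - D z v) / norm v) \<longlonglongrightarrow> 0" using lim[OF False] by (simp add: eq)
      from tendsto_mult[OF this tendsto_const[of "norm v"]] have "(\<lambda>n. norm (s n z - D z v)) \<longlonglongrightarrow> 0"
        using False by simp
      then show ?thesis using LIM_zero_iff tendsto_norm_zero_iff by blast
    qed
  qed
  let ?w = "\<lambda>z::complex. L * norm v * indicator (cball 0 (\<bar>R\<bar> + norm v)) z"
  have w: "integrable lborel ?w"
    by (intro integrable_mult_right integrable_real_indicator)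
       (auto intro!: emeasure_bounded_finite[OF bounded_cball, simplified])
  have lim: "AE z in lborel. (\<lambda>n. s n z) \<longlonglongrightarrow> D z v"
    using AE_not_in[OF N] by eventually_elim (rule conv)
  have bound: "AE z in lborel. norm (s n z) \<le> ?w z" for n
  proof (rule AE_I2)
    fix z
    show "norm (s n z) \<le> ?w z"
      using s_bound[of n z] s_supp[of z n] by (cases "norm z \<le> \<bar>R\<bar> + norm v") (auto simp: indicator_def)
  qed
  have s_meas: "s n \<in> borel_measurable lborel" for n unfolding s_def by measurable
  have D_meas': "(\<lambda>z. D z v) \<in> borel_measurable lborel" using D_meas by simp
  show "integrable lborel (\<lambda>z. D z v)"
    using D_meas' s_meas w lim bound by (rule integrable_dominated_convergence)
  have "(\<lambda>n. \<integral>z. s n z \<partial>lborel) \<longlonglongrightarrow> (\<integral>z. D z v \<partial>lborel)"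
    using D_meas' s_meas w lim bound by (rule integral_dominated_convergence)
  then have "(\<lambda>n. 0) \<longlonglongrightarrow> (\<integral>z. D z v \<partial>lborel)" by (simp add: s0)
  then show "(\<integral>z. D z v \<partial>lborel) = 0" using LIMSEQ_unique tendsto_const by blast
qed

section \<open>Square-integrable functions\<close>

definition L2 :: "(complex \<Rightarrow> complex) \<Rightarrow> bool" where
  "L2 f \<longleftrightarrow> f \<in> borel_measurable borel \<and> integrable lborel (\<lambda>z. (norm (f z))\<^sup>2)"

definition l2 :: "(complex \<Rightarrow> complex) \<Rightarrow> real" where
  "l2 f = sqrt (\<integral>z. (norm (f z))\<^sup>2 \<partial>lborel)"

lemma L2_measurable [measurable_dest]: "L2 f \<Longrightarrow> f \<in> borel_measurable borel"
  by (simp add: L2_def)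

lemma l2_nonneg [simp]: "0 \<le> l2 f"
  by (simp add: l2_def)

lemma l2_power2: "(l2 f)\<^sup>2 = (\<integral>z. (norm (f z))\<^sup>2 \<partial>lborel)"
  by (simp add: l2_def)

lemma L2_bound:
  assumes "L2 f" "g \<in> borel_measurable borel" "\<And>z. norm (g z) \<le> B * norm (f z)"
  shows "L2 g"
  unfolding L2_def
proof
  show "integrable lborel (\<lambda>z. (norm (g z))\<^sup>2)"
  proof (rule Bochner_Integration.integrable_bound)
    show "integrable lborel (\<lambda>z. B\<^sup>2 * (norm (f z))\<^sup>2)" using assms(1) by (simp add: L2_def)
    show "AE z in lborel. norm ((norm (g z))\<^sup>2) \<le> norm (B\<^sup>2 * (norm (f z))\<^sup>2)"
      using power_mono[OF assms(3) norm_ge_zero, of _ 2] by (auto simp: power_mult_distrib)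
  qed (use assms in measurable)
qed (use assms in auto)

lemma l2_mono:
  assumes "L2 f" "L2 g" "AE z in lborel. norm (g z) \<le> norm (f z)"
  shows "l2 g \<le> l2 f"
  unfolding l2_def using assms
  by (auto intro!: real_sqrt_le_mono integral_mono_AE simp: L2_def power_mono elim!: eventually_mono)

lemma measurable_cnj [measurable]: "cnj \<in> borel_measurable borel"
  by (intro borel_measurable_continuous_onI continuous_intros)

lemma L2_cnj: "L2 f \<Longrightarrow> L2 (\<lambda>z. cnj (f z))"
  by (rule L2_bound[where B = 1], assumption) (measurable, auto)

lemma L2_cmult: "L2 f \<Longrightarrow> L2 (\<lambda>z. c * f z)"
  by (rule L2_bound[where B = "norm c"]) (auto simp: norm_mult)

lemma L2_uminus: "L2 f \<Longrightarrow> L2 (\<lambda>z. - f z)"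
  by (rule L2_bound[where B = 1]) auto

lemma L2_mult_bounded:
  assumes "L2 f" "b \<in> borel_measurable borel" "\<And>z. norm (b z) \<le> B"
  shows "L2 (\<lambda>z. b z * f z)"
  by (rule L2_bound[OF assms(1), where B = B])
     (use assms in \<open>auto simp: norm_mult intro!: mult_right_mono\<close>)

lemma L2_indicator: "L2 f \<Longrightarrow> A \<in> sets borel \<Longrightarrow> L2 (\<lambda>z. indicator A z * f z)"
  by (rule L2_mult_bounded[where B = 1]) (auto simp: indicator_def)

lemma L2_bounded_support:
  assumes "f \<in> borel_measurable borel" and "\<And>z. norm (f z) \<le> B" and "\<And>z. norm z > R \<Longrightarrow> f z = 0"
  shows "L2 f"
  unfolding L2_def
proof
  show "integrable lborel (\<lambda>z. (norm (f z))\<^sup>2)"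
    by (rule integrable_bounded_support[where B = "B\<^sup>2" and R = R])
       (use assms in \<open>auto intro!: power_mono\<close>)
qed (use assms in auto)

lemma L2_mult_integrable:
  assumes "L2 f" "L2 g" shows "integrable lborel (\<lambda>z. f z * g z)"
proof (rule Bochner_Integration.integrable_bound)
  show "integrable lborel (\<lambda>z. (norm (f z))\<^sup>2 + (norm (g z))\<^sup>2)"
    using assms by (simp add: L2_def)
  have "norm (f z * g z) \<le> (norm (f z))\<^sup>2 + (norm (g z))\<^sup>2" for z
  proof -
    have "0 \<le> (norm (f z) - norm (g z))\<^sup>2" by simp
    then have "2 * (norm (f z) * norm (g z)) \<le> (norm (f z))\<^sup>2 + (norm (g z))\<^sup>2"
      by (simp add: power2_diff algebra_simps)
    moreover have "0 \<le> norm (f z) * norm (g z)" by simp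
    ultimately show ?thesis unfolding norm_mult by linarith
  qed
  then show "AE z in lborel. norm (f z * g z) \<le> norm ((norm (f z))\<^sup>2 + (norm (g z))\<^sup>2)"
    by auto
qed (use assms in measurable)

lemma L2_add:
  assumes "L2 f" "L2 g" shows "L2 (\<lambda>z. f z + g z)"
  unfolding L2_def
proof
  show "integrable lborel (\<lambda>z. (norm (f z + g z))\<^sup>2)"
  proof (rule Bochner_Integration.integrable_bound)
    show "integrable lborel (\<lambda>z. 2 * (norm (f z))\<^sup>2 + 2 * (norm (g z))\<^sup>2)"
      using assms by (simp add: L2_def)
    have "(norm (f z + g z))\<^sup>2 \<le> 2 * (norm (f z))\<^sup>2 + 2 * (norm (g z))\<^sup>2" for z
    proof -
      have "(norm (f z + g z))\<^sup>2 \<le> (norm (f z) + norm (g z))\<^sup>2"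
        by (intro power_mono norm_triangle_ineq) auto
      also have "\<dots> \<le> 2 * (norm (f z))\<^sup>2 + 2 * (norm (g z))\<^sup>2"
        using zero_le_power2[of "norm (f z) - norm (g z)"] by (simp add: power2_eq_square algebra_simps)
      finally show ?thesis .
    qed
    then show "AE z in lborel. norm ((norm (f z + g z))\<^sup>2) \<le> norm (2 * (norm (f z))\<^sup>2 + 2 * (norm (g z))\<^sup>2)"
      by auto
  qed (use assms in measurable)
qed (use assms in measurable)

lemma L2_diff: "L2 f \<Longrightarrow> L2 g \<Longrightarrow> L2 (\<lambda>z. f z - g z)"
  using L2_add[OF _ L2_uminus, of f g] by simp

text \<open>
  The quadratic polynomial \<open>\<integral> (\<bar>f\<bar> - t \<bar>g\<bar>)\<^sup>2\<close> in \<open>t\<close> is nonnegative, which bounds its discriminant.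
\<close>

lemma L2_Cauchy_Schwarz_norm:
  assumes "L2 f" "L2 g"
  shows "(\<integral>z. norm (f z) * norm (g z) \<partial>lborel) \<le> l2 f * l2 g"
proof -
  define A where "A = (\<integral>z. (norm (f z))\<^sup>2 \<partial>lborel)"
  define B where "B = (\<integral>z. norm (f z) * norm (g z) \<partial>lborel)"
  define C where "C = (\<integral>z. (norm (g z))\<^sup>2 \<partial>lborel)"
  have iA: "integrable lborel (\<lambda>z. (norm (f z))\<^sup>2)" and iC: "integrable lborel (\<lambda>z. (norm (g z))\<^sup>2)"
    using assms by (auto simp: L2_def)
  have iB: "integrable lborel (\<lambda>z. norm (f z) * norm (g z))"
    using L2_mult_integrable[OF assms, THEN integrable_norm] by (simp add: norm_mult)
  \<comment> \<open>The minimum of this polynomial is attained at \<open>t = B / C\<close>.\<close>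
  have q: "0 \<le> A - 2 * t * B + t\<^sup>2 * C" for t
  proof -
    have "0 \<le> (\<integral>z. (norm (f z) - t * norm (g z))\<^sup>2 \<partial>lborel)" by simp
    also have "(\<lambda>z. (norm (f z) - t * norm (g z))\<^sup>2) =
        (\<lambda>z. (norm (f z))\<^sup>2 - 2 * t * (norm (f z) * norm (g z)) + t\<^sup>2 * (norm (g z))\<^sup>2)"
      by (auto simp: power2_eq_square algebra_simps)
    also have "(\<integral>z. \<dots> z \<partial>lborel) = A - 2 * t * B + t\<^sup>2 * C"
      unfolding A_def B_def C_def using iA iB iC
      by (subst Bochner_Integration.integral_add) auto
    finally show ?thesis .
  qed
  have nn: "A \<ge> 0" "B \<ge> 0" "C \<ge> 0" by (auto simp: A_def B_def C_def)
  have "B\<^sup>2 \<le> A * C"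
  proof (cases "C = 0")
    case True
    have "B = 0"
    proof (rule ccontr)
      assume "B \<noteq> 0"
      then have "B > 0" using nn by simp
      moreover have "0 \<le> A - 2 * ((A + 1) / B) * B" using q[of "(A + 1) / B"] True by simp
      ultimately show False using nn by simp
    qed
    then show ?thesis using nn by simp
  next
    case False
    then have C: "C > 0" using nn by simp
    have "0 \<le> C * (A - 2 * (B / C) * B + (B / C)\<^sup>2 * C)" using q[of "B / C"] C by simp
    also have "\<dots> = A * C - B\<^sup>2" using C by (simp add: power2_eq_square field_simps)
    finally show ?thesis by simp
  qed
  then have "B \<le> sqrt (A * C)" by (rule real_le_rsqrt)
  then show ?thesis by (simp add: l2_def A_def B_def C_def real_sqrt_mult)
qed

lemma L2_Cauchy_Schwarz:
  assumes "L2 f" "L2 g"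
  shows "norm (\<integral>z. f z * g z \<partial>lborel) \<le> l2 f * l2 g"
proof -
  have "norm (\<integral>z. f z * g z \<partial>lborel) \<le> (\<integral>z. norm (f z) * norm (g z) \<partial>lborel)"
    using integral_norm_bound[of lborel "\<lambda>z. f z * g z"] by (simp add: norm_mult)
  then show ?thesis using L2_Cauchy_Schwarz_norm[OF assms] by linarith
qed

lemma l2_triangle:
  assumes "L2 f" "L2 g"
  shows "l2 (\<lambda>z. f z + g z) \<le> l2 f + l2 g"
proof (rule power2_le_imp_le)
  have iA: "integrable lborel (\<lambda>z. (norm (f z))\<^sup>2)" and iC: "integrable lborel (\<lambda>z. (norm (g z))\<^sup>2)"
    using assms by (auto simp: L2_def)
  have iB: "integrable lborel (\<lambda>z. norm (f z) * norm (g z))"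
    using L2_mult_integrable[OF assms, THEN integrable_norm] by (simp add: norm_mult)
  have "(l2 (\<lambda>z. f z + g z))\<^sup>2 = (\<integral>z. (norm (f z + g z))\<^sup>2 \<partial>lborel)" by (rule l2_power2)
  also have "\<dots> \<le> (\<integral>z. (norm (f z))\<^sup>2 + 2 * (norm (f z) * norm (g z)) + (norm (g z))\<^sup>2 \<partial>lborel)"
  proof (rule integral_mono)
    show "integrable lborel (\<lambda>z. (norm (f z + g z))\<^sup>2)" using L2_add[OF assms] by (simp add: L2_def)
    show "integrable lborel (\<lambda>z. (norm (f z))\<^sup>2 + 2 * (norm (f z) * norm (g z)) + (norm (g z))\<^sup>2)"
      using iA iB iC by auto
    show "(norm (f z + g z))\<^sup>2 \<le> (norm (f z))\<^sup>2 + 2 * (norm (f z) * norm (g z)) + (norm (g z))\<^sup>2" for z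
      using power_mono[OF norm_triangle_ineq[of "f z" "g z"] norm_ge_zero, of 2]
      by (simp add: power2_eq_square algebra_simps)
  qed
  also have "\<dots> = (l2 f)\<^sup>2 + 2 * (\<integral>z. norm (f z) * norm (g z) \<partial>lborel) + (l2 g)\<^sup>2"
    unfolding l2_power2 using iA iB iC by simp
  also have "\<dots> \<le> (l2 f + l2 g)\<^sup>2"
    using L2_Cauchy_Schwarz_norm[OF assms] by (simp add: power2_sum)
  finally show "(l2 (\<lambda>z. f z + g z))\<^sup>2 \<le> (l2 f + l2 g)\<^sup>2" .
qed simp

definition L2_loc :: "(complex \<Rightarrow> complex) \<Rightarrow> bool" where
  "L2_loc f \<longleftrightarrow> (\<forall>R. L2 (\<lambda>z. indicator (cball 0 R) z * f z)) \<and> f \<in> borel_measurable borel"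

lemma L2_locD: "L2_loc f \<Longrightarrow> L2 (\<lambda>z. indicator (cball 0 R) z * f z)"
  by (simp add: L2_loc_def)

lemma L2_loc_measurable [measurable_dest]: "L2_loc f \<Longrightarrow> f \<in> borel_measurable borel"
  by (simp add: L2_loc_def)

lemma L2_imp_L2_loc: "L2 f \<Longrightarrow> L2_loc f"
  by (auto simp: L2_loc_def intro!: L2_indicator L2_measurable)

lemma L2_loc_cnj: "L2_loc f \<Longrightarrow> L2_loc (\<lambda>z. cnj (f z))"
  unfolding L2_loc_def
proof safe
  assume f: "\<forall>R. L2 (\<lambda>z. indicator (cball 0 R) z * f z)" "f \<in> borel_measurable borel"
  then show "(\<lambda>z. cnj (f z)) \<in> borel_measurable borel" by measurable
  fix R
  have "cnj (indicator A z) = indicator A z" for A and z :: complex by (simp add: indicator_def)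
  then show "L2 (\<lambda>z. indicator (cball 0 R) z * cnj (f z))"
    using L2_cnj[of "\<lambda>z. indicator (cball 0 R) z * f z"] f by simp
qed

lemma L2_loc_add: "L2_loc f \<Longrightarrow> L2_loc g \<Longrightarrow> L2_loc (\<lambda>z. f z + g z)"
  unfolding L2_loc_def using L2_add by (auto simp: distrib_left)

lemma continuous_bounded_cball:
  fixes f :: "complex \<Rightarrow> complex"
  assumes "continuous_on UNIV f"
  obtains B where "B \<ge> 0" "\<And>z. norm z \<le> R \<Longrightarrow> norm (f z) \<le> B"
proof -
  have "compact (f ` cball 0 R)"
    using assms by (intro compact_continuous_image) (auto intro: continuous_on_subset)
  then obtain B where "\<forall>w \<in> f ` cball 0 R. norm w \<le> B"
    using compact_imp_bounded bounded_iff by meson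
  then show ?thesis by (intro that[of "max 0 B"]) (auto simp: le_max_iff_disj)
qed

lemma L2_loc_mult_continuous:
  assumes "L2_loc f" "continuous_on UNIV b"
  shows "L2_loc (\<lambda>z. b z * f z)"
  unfolding L2_loc_def
proof safe
  have [measurable]: "b \<in> borel_measurable borel" using assms by (auto intro: borel_measurable_continuous_onI)
  show "(\<lambda>z. b z * f z) \<in> borel_measurable borel" using assms(1) by measurable
  fix R
  obtain B where B: "B \<ge> 0" "\<And>z. norm z \<le> R \<Longrightarrow> norm (b z) \<le> B"
    using continuous_bounded_cball[OF assms(2)] by blast
  show "L2 (\<lambda>z. indicator (cball 0 R) z * (b z * f z))"
    by (rule L2_bound[OF L2_locD[OF assms(1), of R], where B = B])
       (use B assms(1) in \<open>auto simp: norm_mult indicator_def intro!: mult_right_mono\<close>)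
qed

lemma L2_loc_continuous:
  assumes "continuous_on UNIV b" shows "L2_loc b"
  unfolding L2_loc_def
proof safe
  show [measurable]: "b \<in> borel_measurable borel" using assms by (auto intro: borel_measurable_continuous_onI)
  fix R
  obtain B where B: "B \<ge> 0" "\<And>z. norm z \<le> R \<Longrightarrow> norm (b z) \<le> B"
    using continuous_bounded_cball[OF assms] by blast
  show "L2 (\<lambda>z. indicator (cball 0 R) z * b z)"
    by (rule L2_bounded_support[where B = B and R = R]) (use B in \<open>auto simp: indicator_def\<close>)
qed

lemma L2_loc_bounded_support:
  assumes "L2_loc f" "\<And>z. norm z > R \<Longrightarrow> f z = 0" shows "L2 f"
proof -
  have "f = (\<lambda>z. indicator (cball 0 R) z * f z)" using assms(2) by (force simp: indicator_def)
  then show ?thesis using L2_locD[OF assms(1), of R] by simp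
qed

lemma L2_loc_mult_integrable:
  assumes "L2_loc f" "L2 g" "\<And>z. norm z > R \<Longrightarrow> g z = 0"
  shows "integrable lborel (\<lambda>z. f z * g z)"
proof -
  have "(\<lambda>z. f z * g z) = (\<lambda>z. (indicator (cball 0 R) z * f z) * g z)"
    using assms(3) by (force simp: indicator_def)
  then show ?thesis using L2_mult_integrable[OF L2_locD[OF assms(1)] assms(2)] by simp
qed

section \<open>Test functions\<close>

definition test :: "(complex \<Rightarrow> complex) \<Rightarrow> bool" where
  "test \<phi> \<longleftrightarrow> smooth \<phi> \<and> (\<exists>R. \<forall>z. norm z > R \<longrightarrow> \<phi> z = 0)"

lemma smooth_mult: "smooth f \<Longrightarrow> smooth g \<Longrightarrow> smooth (\<lambda>z. f z * g z)"
  by (simp add: smooth_def Ck_mult)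

lemma smooth_add: "smooth f \<Longrightarrow> smooth g \<Longrightarrow> smooth (\<lambda>z. f z + g z)"
  by (simp add: smooth_def Ck_add)

lemma smooth_diff: "smooth f \<Longrightarrow> smooth g \<Longrightarrow> smooth (\<lambda>z. f z - g z)"
  by (simp add: smooth_def Ck_diff)

lemma smooth_const: "smooth (\<lambda>z. c)"
  by (simp add: smooth_def Ck_const)

lemma smooth_cnj: "smooth f \<Longrightarrow> smooth (\<lambda>z. cnj (f z))"
  by (simp add: smooth_def Ck_cnj)

lemma smooth_affine: "smooth f \<Longrightarrow> smooth (\<lambda>z. f (a + of_real r * z))"
  by (simp add: smooth_def Ck_affine)

lemma pd_expand:
  assumes "f differentiable (at z)"
  shows "pd v f z = Re v *\<^sub>R pd 1 f z + Im v *\<^sub>R pd \<i> f z"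
proof -
  have L: "linear (\<lambda>v. pd v f z)" using pd_works[OF assms] by (rule has_derivative_linear)
  have "v = Re v *\<^sub>R 1 + Im v *\<^sub>R \<i>" by (simp add: complex_eq_iff)
  then have "pd v f z = pd (Re v *\<^sub>R 1 + Im v *\<^sub>R \<i>) f z" by simp
  also have "\<dots> = Re v *\<^sub>R pd 1 f z + Im v *\<^sub>R pd \<i> f z"
    using linear_add[OF L] linear_scale[OF L] by simp
  finally show ?thesis .
qed

lemma pd_locally_const:
  assumes "open S" "z \<in> S" "\<And>w. w \<in> S \<Longrightarrow> f w = c"
  shows "pd v f z = 0"
proof (rule pd_eq)
  show "(f has_derivative (\<lambda>v. 0)) (at z)"
    by (rule has_derivative_transform_within_open[OF has_derivative_const[of c] assms(1,2)])
       (use assms in auto)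
qed

lemma test_pd:
  assumes "test \<phi>" "v = 1 \<or> v = \<i>" shows "test (pd v \<phi>)"
proof -
  obtain R where R: "\<And>z. norm z > R \<Longrightarrow> \<phi> z = 0" using assms by (auto simp: test_def)
  have "pd v \<phi> z = 0" if "norm z > R" for z
    by (rule pd_locally_const[where S = "- cball 0 R" and c = 0]) (use that R in auto)
  then show ?thesis using assms smooth_pd by (auto simp: test_def)
qed

lemma test_add:
  assumes "test \<phi>" "test \<psi>" shows "test (\<lambda>z. \<phi> z + \<psi> z)"
proof -
  obtain R S where "\<And>z. norm z > R \<Longrightarrow> \<phi> z = 0" "\<And>z. norm z > S \<Longrightarrow> \<psi> z = 0"
    using assms by (auto simp: test_def)
  then show ?thesis using assms
    by (auto simp: test_def intro!: smooth_add exI[of _ "max R S"])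
qed

lemma test_mult_smooth: "smooth f \<Longrightarrow> test \<phi> \<Longrightarrow> test (\<lambda>z. f z * \<phi> z)"
  by (auto simp: test_def intro!: smooth_mult)

lemma test_cnj: "test \<phi> \<Longrightarrow> test (\<lambda>z. cnj (\<phi> z))"
  by (auto simp: test_def intro!: smooth_cnj)

lemma partial_z_pd: "partial_z f = (\<lambda>z. (1 / 2) * pd 1 f z + (- \<i> / 2) * pd \<i> f z)"
  by (simp add: fun_eq_iff partial_z_def partial_x_eq_pd partial_y_eq_pd field_simps)

lemma partial_zbar_pd: "partial_zbar f = (\<lambda>z. (1 / 2) * pd 1 f z + (\<i> / 2) * pd \<i> f z)"
  by (simp add: fun_eq_iff partial_zbar_def partial_x_eq_pd partial_y_eq_pd field_simps)

lemma test_partial: "test \<phi> \<Longrightarrow> test (partial_z \<phi>)" "test \<phi> \<Longrightarrow> test (partial_zbar \<phi>)"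
  unfolding partial_z_pd partial_zbar_pd
  by (intro test_add test_mult_smooth test_pd smooth_const; simp)+

lemma smooth_partial: "smooth f \<Longrightarrow> smooth (partial_z f)" "smooth f \<Longrightarrow> smooth (partial_zbar f)"
  unfolding partial_z_pd partial_zbar_pd
  by (intro smooth_add smooth_mult smooth_pd smooth_const; simp)+

lemma partial_commute:
  assumes "smooth f"
  shows "partial_z (partial_zbar f) = partial_zbar (partial_z f)"
proof
  fix z
  have d: "pd 1 f differentiable (at z)" "pd \<i> f differentiable (at z)"
    using assms smooth_pd smooth_differentiable by auto
  have lc: "pd v (\<lambda>z. a * pd 1 f z + b * pd \<i> f z) z = a * pd v (pd 1 f) z + b * pd v (pd \<i> f) z" for v a b
    using d by (subst pd_add) (auto simp: pd_mult intro!: differentiable_mult)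
  show "partial_z (partial_zbar f) z = partial_zbar (partial_z f) z"
    unfolding partial_z_pd[of "partial_zbar f"] partial_zbar_pd[of "partial_z f"]
    unfolding partial_z_pd[of f] partial_zbar_pd[of f] lc smooth_mixed_partials[OF assms]
    by (simp add: algebra_simps)
qed

lemma test_continuous: "test \<phi> \<Longrightarrow> continuous_on UNIV \<phi>"
  by (simp add: test_def smooth_continuous)

lemma test_measurable [measurable_dest]: "test \<phi> \<Longrightarrow> \<phi> \<in> borel_measurable borel"
  by (intro borel_measurable_continuous_onI test_continuous)

lemma test_bounded:
  assumes "test \<phi>" obtains B where "\<And>z. norm (\<phi> z) \<le> B"
proof -
  obtain R where R: "\<And>z. norm z > R \<Longrightarrow> \<phi> z = 0" using assms by (auto simp: test_def)
  obtain B where "B \<ge> 0" "\<And>z. norm z \<le> R \<Longrightarrow> norm (\<phi> z) \<le> B"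
    using continuous_bounded_cball[OF test_continuous[OF assms]] by blast
  then show ?thesis using R by (intro that[of B]) (metis norm_zero not_le)
qed

lemma test_L2: assumes "test \<phi>" shows "L2 \<phi>"
proof -
  obtain R where R: "\<And>z. norm z > R \<Longrightarrow> \<phi> z = 0" using assms by (auto simp: test_def)
  show ?thesis
    using L2_loc_bounded_support[OF L2_loc_continuous[OF test_continuous[OF assms]]] R by blast
qed

lemma L2_loc_test_integrable:
  assumes "L2_loc f" "test \<phi>" shows "integrable lborel (\<lambda>z. f z * \<phi> z)"
proof -
  obtain R where R: "\<And>z. norm z > R \<Longrightarrow> \<phi> z = 0" using assms by (auto simp: test_def)
  show ?thesis using L2_loc_mult_integrable[OF assms(1) test_L2[OF assms(2)]] R by blast
qed

lemma test_reflect: assumes "test \<phi>" shows "test (\<lambda>w. \<phi> (z - w))"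
proof -
  obtain R where R: "\<And>z. norm z > R \<Longrightarrow> \<phi> z = 0" using assms by (auto simp: test_def)
  have "\<phi> (z - w) = 0" if "norm w > R + norm z" for w
    using that norm_triangle_ineq3[of w z] by (intro R) (simp add: norm_minus_commute)
  moreover have "smooth (\<lambda>w. \<phi> (z + of_real (- 1) * w))"
    using assms by (intro smooth_affine) (simp add: test_def)
  ultimately show ?thesis by (auto simp: test_def)
qed

lemma pd_reflect: "f differentiable (at (z - w)) \<Longrightarrow> pd v (\<lambda>w. f (z - w)) w = - pd v f (z - w)"
  using pd_affine[of f z "- 1" w v] by simp

lemma uniform_continuity:
  fixes f :: "complex \<Rightarrow> complex"
  assumes f: "continuous_on UNIV f" and R: "\<And>z. norm z > R \<Longrightarrow> f z = 0" and "e > 0"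
  obtains d where "d > 0" "\<And>x y. norm (x - y) < d \<Longrightarrow> norm (f x - f y) < e"
proof -
  have "uniformly_continuous_on (cball 0 (R + 2)) f"
    using f by (intro compact_uniformly_continuous) (auto intro: continuous_on_subset)
  then obtain d where d: "d > 0"
    "\<And>x y. x \<in> cball 0 (R + 2) \<Longrightarrow> y \<in> cball 0 (R + 2) \<Longrightarrow> dist x y < d \<Longrightarrow> dist (f x) (f y) < e"
    unfolding uniformly_continuous_on_def using \<open>e > 0\<close> by (metis dist_commute)
  show ?thesis
  proof (rule that[of "min d 1"])
    fix x y :: complex assume xy: "norm (x - y) < min d 1"
    show "norm (f x - f y) < e"
    proof (cases "norm x > R + 1 \<or> norm y > R + 1")
      case True
      then have "norm x > R" "norm y > R"
        using xy norm_triangle_ineq3[of x y] by auto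
      then show ?thesis using R \<open>e > 0\<close> by simp
    next
      case False
      then show ?thesis using d(2)[of x y] xy by (auto simp: dist_norm)
    qed
  qed (use d in auto)
qed

text \<open>
  The mean value theorem turns the uniform continuity of the two partial derivatives into a remainder
  estimate that is uniform in the base point; this is what differentiation under a convolution needs.
\<close>

lemma test_uniformly_differentiable:
  assumes "test \<eta>" "e > 0"
  obtains d where "d > 0" "\<And>x h. norm h < d \<Longrightarrow> norm (\<eta> (x + h) - \<eta> x - pd h \<eta> x) \<le> e * norm h"
proof -
  have diff: "\<eta> differentiable (at z)" for z using assms smooth_differentiable by (auto simp: test_def)
  have "\<exists>d>0. \<forall>x y. norm (x - y) < d \<longrightarrow> norm (pd v \<eta> x - pd v \<eta> y) < e / 2" if v: "v = 1 \<or> v = \<i>" for v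
  proof -
    have t: "test (pd v \<eta>)" using assms v by (rule_tac test_pd)
    then obtain R where "\<And>z. norm z > R \<Longrightarrow> pd v \<eta> z = 0" by (auto simp: test_def)
    then show ?thesis
      using uniform_continuity[OF test_continuous[OF t], of R "e / 2"] \<open>e > 0\<close> by (metis half_gt_zero)
  qed
  from this[of 1] this[of \<i>] obtain d1 d2 where d1: "d1 > 0"
      "\<And>x y. norm (x - y) < d1 \<Longrightarrow> norm (pd 1 \<eta> x - pd 1 \<eta> y) < e / 2"
    and d2: "d2 > 0" "\<And>x y. norm (x - y) < d2 \<Longrightarrow> norm (pd \<i> \<eta> x - pd \<i> \<eta> y) < e / 2"
    by auto
  show ?thesis
  proof (rule that[of "min d1 d2"])
    fix x h :: complex assume h: "norm h < min d1 d2"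
    define g where "g y = \<eta> y - pd (y - x) \<eta> x" for y
    have L: "bounded_linear (\<lambda>v. pd v \<eta> x)" using pd_works[OF diff] by (rule has_derivative_bounded_linear)
    have "norm (g (x + h) - g x) \<le> e * norm (x + h - x)"
    proof (rule differentiable_bound[where S = "ball x (min d1 d2)"])
      fix y assume y: "y \<in> ball x (min d1 d2)"
      have "((\<lambda>y. pd (y - x) \<eta> x) has_derivative (\<lambda>v. pd (v - 0) \<eta> x)) (at y)"
        by (rule bounded_linear.has_derivative[OF L]) (auto intro!: derivative_eq_intros)
      then have "(g has_derivative (\<lambda>v. pd v \<eta> y - pd v \<eta> x)) (at y)"
        unfolding g_def by (intro has_derivative_diff pd_works diff) simp
      then show "(g has_derivative (\<lambda>v. pd v \<eta> y - pd v \<eta> x)) (at y within ball x (min d1 d2))"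
        by (rule has_derivative_at_withinI)
      show "onorm (\<lambda>v. pd v \<eta> y - pd v \<eta> x) \<le> e"
      proof (rule onorm_le)
        fix v
        have "pd v \<eta> y - pd v \<eta> x = Re v *\<^sub>R (pd 1 \<eta> y - pd 1 \<eta> x) + Im v *\<^sub>R (pd \<i> \<eta> y - pd \<i> \<eta> x)"
          using pd_expand[OF diff, of v] by (simp add: scaleR_diff_right)
        also have "norm \<dots> \<le> \<bar>Re v\<bar> * norm (pd 1 \<eta> y - pd 1 \<eta> x) + \<bar>Im v\<bar> * norm (pd \<i> \<eta> y - pd \<i> \<eta> x)"
          by (rule order.trans[OF norm_triangle_ineq]) simp
        also have "\<dots> \<le> norm v * (e / 2) + norm v * (e / 2)"
          using d1(2)[of y x] d2(2)[of y x] y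
          by (intro add_mono mult_mono abs_Re_le_cmod abs_Im_le_cmod) (auto simp: dist_norm norm_minus_commute)
        finally show "norm (pd v \<eta> y - pd v \<eta> x) \<le> e * norm v" by (simp add: algebra_simps)
      qed
    qed (use h d1 d2 in \<open>auto simp: dist_norm\<close>)
    moreover have "pd 0 \<eta> x = 0" using linear_0[OF bounded_linear.linear[OF L]] by simp
    ultimately show "norm (\<eta> (x + h) - \<eta> x - pd h \<eta> x) \<le> e * norm h"
      by (simp add: g_def algebra_simps)
  qed (use d1 d2 in auto)
qed

section \<open>Convolution\<close>

definition conv :: "(complex \<Rightarrow> complex) \<Rightarrow> (complex \<Rightarrow> complex) \<Rightarrow> complex \<Rightarrow> complex" where
  "conv b \<eta> z = (\<integral>w. b w * \<eta> (z - w) \<partial>lborel)"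

lemma conv_integrable:
  fixes b \<eta> :: "complex \<Rightarrow> complex"
  assumes "integrable lborel b" "\<eta> \<in> borel_measurable borel" "\<And>z. norm (\<eta> z) \<le> B"
  shows "integrable lborel (\<lambda>w. b w * \<eta> (z - w))"
proof (rule Bochner_Integration.integrable_bound)
  show "integrable lborel (\<lambda>w. B * norm (b w))" using assms by simp
  show "AE w in lborel. norm (b w * \<eta> (z - w)) \<le> norm (B * norm (b w))"
  proof (rule AE_I2)
    fix w
    have "norm (b w) * norm (\<eta> (z - w)) \<le> norm (b w) * \<bar>B\<bar>"
      using assms(3)[of "z - w"] by (intro mult_left_mono) auto
    then show "norm (b w * \<eta> (z - w)) \<le> norm (B * norm (b w))" by (simp add: norm_mult mult.commute abs_mult)
  qed
  have "b \<in> borel_measurable borel" using assms(1) by auto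
  then show "(\<lambda>w. b w * \<eta> (z - w)) \<in> borel_measurable lborel" using assms(2) by measurable
qed

lemma conv_test_integrable:
  fixes b \<eta> :: "complex \<Rightarrow> complex"
  assumes "integrable lborel b" "test \<eta>" shows "integrable lborel (\<lambda>w. b w * \<eta> (z - w))"
proof -
  obtain B where "\<And>z. norm (\<eta> z) \<le> B" using test_bounded assms by blast
  then show ?thesis using assms by (intro conv_integrable) auto
qed

lemma conv_lincomb:
  assumes "integrable lborel b" "test \<eta>" "test \<theta>"
  shows "conv b (\<lambda>z. \<alpha> * \<eta> z + \<beta> * \<theta> z) z = \<alpha> * conv b \<eta> z + \<beta> * conv b \<theta> z"
proof -
  have "conv b (\<lambda>z. \<alpha> * \<eta> z + \<beta> * \<theta> z) z =
      (\<integral>w. \<alpha> * (b w * \<eta> (z - w)) + \<beta> * (b w * \<theta> (z - w)) \<partial>lborel)"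
    by (simp add: conv_def algebra_simps)
  also have "\<dots> = \<alpha> * conv b \<eta> z + \<beta> * conv b \<theta> z"
    unfolding conv_def using conv_test_integrable[OF assms(1,2)] conv_test_integrable[OF assms(1,3)] by simp
  finally show ?thesis .
qed

text \<open>
  Only the second factor is differentiated, so a convolution inherits the smoothness of the kernel.
\<close>

lemma conv_has_derivative:
  assumes b: "integrable lborel b" and \<eta>: "test \<eta>"
  shows "(conv b \<eta> has_derivative (\<lambda>v. conv b (pd v \<eta>) z)) (at z)"
proof -
  have diff: "\<eta> differentiable (at z)" for z using \<eta> smooth_differentiable by (auto simp: test_def)
  have t: "test (pd 1 \<eta>)" "test (pd \<i> \<eta>)" using \<eta> by (auto intro: test_pd)
  have eq: "pd v \<eta> = (\<lambda>z. of_real (Re v) * pd 1 \<eta> z + of_real (Im v) * pd \<i> \<eta> z)" for v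
    using pd_expand[OF diff, of v] by (auto simp: scaleR_conv_of_real)
  have tv: "test (pd v \<eta>)" for v
    unfolding eq[of v] using t by (intro test_add test_mult_smooth smooth_const)
  have cv: "conv b (pd v \<eta>) z = Re v *\<^sub>R conv b (pd 1 \<eta>) z + Im v *\<^sub>R conv b (pd \<i> \<eta>) z" for v
    unfolding eq[of v] using conv_lincomb[OF b t] by (simp add: scaleR_conv_of_real)
  have bl: "bounded_linear (\<lambda>v. conv b (pd v \<eta>) z)"
    by (subst ext[of "\<lambda>v. conv b (pd v \<eta>) z", OF cv]) (intro bounded_linear_add bounded_linear_compose[OF bounded_linear_scaleR_left]
        bounded_linear_Re bounded_linear_Im)
  show ?thesis
    unfolding has_derivative_at_alt
  proof (intro conjI bl allI impI)
    fix e :: real assume e: "e > 0"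
    define I where "I = (\<integral>w. norm (b w) \<partial>lborel)"
    have I: "I \<ge> 0" by (simp add: I_def)
    obtain d where d: "d > 0"
      "\<And>x h. norm h < d \<Longrightarrow> norm (\<eta> (x + h) - \<eta> x - pd h \<eta> x) \<le> e / (I + 1) * norm h"
      using test_uniformly_differentiable[OF \<eta>, of "e / (I + 1)"] e I by auto
    have "norm (conv b \<eta> y - conv b \<eta> z - conv b (pd (y - z) \<eta>) z) \<le> e * norm (y - z)" if y: "norm (y - z) < d" for y
    proof -
      let ?q = "\<lambda>w. \<eta> (y - w) - \<eta> (z - w) - pd (y - z) \<eta> (z - w)"
      have ints: "integrable lborel (\<lambda>w. b w * \<eta> (y - w))" "integrable lborel (\<lambda>w. b w * \<eta> (z - w))"
        "integrable lborel (\<lambda>w. b w * pd (y - z) \<eta> (z - w))"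
        using conv_test_integrable b \<eta> tv by auto
      have eqi: "conv b \<eta> y - conv b \<eta> z - conv b (pd (y - z) \<eta>) z = (\<integral>w. b w * ?q w \<partial>lborel)"
        unfolding conv_def using ints by (simp add: right_diff_distrib)
      have "norm (conv b \<eta> y - conv b \<eta> z - conv b (pd (y - z) \<eta>) z) \<le> (\<integral>w. norm (b w * ?q w) \<partial>lborel)"
        unfolding eqi by (rule integral_norm_bound)
      also have "\<dots> \<le> (\<integral>w. norm (b w) * (e / (I + 1) * norm (y - z)) \<partial>lborel)"
      proof (rule integral_mono)
        show "integrable lborel (\<lambda>w. norm (b w * ?q w))"
          using ints by (intro integrable_norm) (simp add: right_diff_distrib)
        show "integrable lborel (\<lambda>w. norm (b w) * (e / (I + 1) * norm (y - z)))" using b by simp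
        show "norm (b w * ?q w) \<le> norm (b w) * (e / (I + 1) * norm (y - z))" for w
          using d(2)[OF y, of "z - w"] unfolding norm_mult by (intro mult_left_mono) auto
      qed
      also have "\<dots> = I / (I + 1) * (e * norm (y - z))" by (simp add: I_def)
      also have "\<dots> \<le> 1 * (e * norm (y - z))" using I e by (intro mult_right_mono) auto
      finally show ?thesis by simp
    qed
    then show "\<exists>d>0. \<forall>y. norm (y - z) < d \<longrightarrow>
        norm (conv b \<eta> y - conv b \<eta> z - conv b (pd (y - z) \<eta>) z) \<le> e * norm (y - z)"
      using d(1) by blast
  qed
qed

lemma pd_conv: "integrable lborel b \<Longrightarrow> test \<eta> \<Longrightarrow> pd v (conv b \<eta>) = conv b (pd v \<eta>)"
  by (intro ext pd_eq conv_has_derivative)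

lemma Ck_conv: "integrable lborel b \<Longrightarrow> test \<eta> \<Longrightarrow> Ck n (conv b \<eta>)"
proof (induction n arbitrary: \<eta>)
  case 0
  then have "isCont (conv b \<eta>) z" for z
    by (rule has_derivative_continuous[OF conv_has_derivative])
  then show ?case by (simp add: continuous_on_eq_continuous_at)
next
  case (Suc n)
  have "conv b \<eta> differentiable (at z)" for z
    using conv_has_derivative[OF Suc.prems] unfolding differentiable_def by blast
  then show ?case
    using Suc unfolding Ck_Suc by (auto simp: pd_conv test_pd)
qed

lemma conv_support:
  assumes "\<And>z. norm z > R \<Longrightarrow> b z = 0" "\<And>z. norm z > S \<Longrightarrow> \<eta> z = 0" "norm z > R + S"
  shows "conv b \<eta> z = 0"
proof -
  have "b w * \<eta> (z - w) = 0" for w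
    using assms norm_triangle_ineq2[of z w] by (cases "norm w > R") auto
  then have "(\<lambda>w. b w * \<eta> (z - w)) = (\<lambda>w. 0)" by blast
  then show ?thesis by (simp only: conv_def) simp
qed

lemma conv_test:
  assumes "integrable lborel b" "\<And>z. norm z > R \<Longrightarrow> b z = 0" "test \<eta>"
  shows "test (conv b \<eta>)"
proof -
  obtain S where "\<And>z. norm z > S \<Longrightarrow> \<eta> z = 0" using assms(3) by (auto simp: test_def)
  with conv_support[of R b S \<eta>] assms(2) have "\<forall>z. norm z > R + S \<longrightarrow> conv b \<eta> z = 0" by blast
  then show ?thesis using Ck_conv[OF assms(1,3)] by (auto simp: test_def smooth_def)
qed

lemma partial_conv:
  assumes "integrable lborel b" "test \<eta>"
  shows "partial_z (conv b \<eta>) = conv b (partial_z \<eta>)" "partial_zbar (conv b \<eta>) = conv b (partial_zbar \<eta>)"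
  unfolding partial_z_pd partial_zbar_pd pd_conv[OF assms]
  by (intro ext conv_lincomb[symmetric] assms test_pd; simp)+

definition mollifier :: "real \<Rightarrow> (complex \<Rightarrow> real) \<Rightarrow> bool" where
  "mollifier \<delta> k \<longleftrightarrow> test (\<lambda>z. of_real (k z)) \<and> (\<forall>z. 0 \<le> k z) \<and> (\<forall>z. norm z > \<delta> \<longrightarrow> k z = 0) \<and>
     integrable lborel k \<and> (\<integral>z. k z \<partial>lborel) = 1"

lemma mollifier_exists:
  assumes "\<delta> > 0" obtains k where "mollifier \<delta> k"
proof -
  obtain bump :: "complex \<Rightarrow> real" where b:
    "\<And>n. Ck n (\<lambda>z. of_real (bump z))" "\<And>z. 0 \<le> bump z" "\<And>z. bump z \<le> 1"
    "\<And>z. norm z \<le> 1 \<Longrightarrow> bump z = 1" "\<And>z. norm z \<ge> 2 \<Longrightarrow> bump z = 0"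
    using smooth_bump_exists by blast
  define q where "q z = bump (of_real (2 / \<delta>) * z)" for z
  have q: "smooth (\<lambda>z. of_real (q z))"
    using b(1) smooth_affine[of "\<lambda>z. of_real (bump z)" 0 "2 / \<delta>"] by (simp add: smooth_def q_def)
  have qs: "q z = 0" if "norm z > \<delta>" for z
    unfolding q_def using assms that by (intro b(5)) (simp only: norm_mult norm_of_real, simp add: field_simps)
  have q1: "q z = 1" if "norm z \<le> \<delta> / 2" for z
    unfolding q_def using assms that by (intro b(4)) (simp only: norm_mult norm_of_real, simp add: field_simps)
  have tq: "test (\<lambda>z. of_real (q z))" using q qs by (auto simp: test_def)
  have "q = (\<lambda>z. Re (of_real (q z)))" by simp
  then have [measurable]: "q \<in> borel_measurable borel"
    using test_measurable[OF tq] by (metis borel_measurable_Re measurable_compose)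
  have iq: "integrable lborel q"
    by (rule integrable_bounded_support[where B = 1 and R = \<delta>]) (use b qs in \<open>auto simp: q_def\<close>)
  have "0 < measure lborel (cball (0::complex) (\<delta> / 2))"
    using content_cball_gt_0_iff[of "0::complex" "\<delta> / 2"] assms by (simp add: measure_completion)
  also have "\<dots> = (\<integral>z. indicator (cball 0 (\<delta> / 2)) (z::complex) \<partial>lborel)" by simp
  also have "\<dots> \<le> (\<integral>z. q z \<partial>lborel)"
  proof (rule integral_mono)
    show "integrable lborel (indicator (cball (0::complex) (\<delta> / 2)) :: _ \<Rightarrow> real)"
      by (intro integrable_real_indicator) (auto intro!: emeasure_bounded_finite[OF bounded_cball, simplified])
    show "indicator (cball 0 (\<delta> / 2)) z \<le> q z" for z :: complex
      using b(2) q1[of z] by (auto simp: indicator_def q_def)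
  qed (rule iq)
  finally have pos: "(\<integral>z. q z \<partial>lborel) > 0" .
  define k where "k z = inverse (\<integral>z. q z \<partial>lborel) * q z" for z
  have "mollifier \<delta> k"
    unfolding mollifier_def
  proof (intro conjI allI impI)
    have "test (\<lambda>z. of_real (inverse (\<integral>z. q z \<partial>lborel)) * of_real (q z))"
      by (intro test_mult_smooth smooth_const tq)
    then show "test (\<lambda>z. of_real (k z))" by (simp add: k_def)
  next
    show "integrable lborel k" "(\<integral>z. k z \<partial>lborel) = 1"
      unfolding k_def[abs_def] using iq pos by simp_all
  qed (use pos b(2) qs in \<open>auto simp: k_def q_def\<close>)
  then show ?thesis by (rule that)
qed

section \<open>Mollification in the mean\<close>

lemma L2_integrable_bounded_support:
  assumes "L2 b" "\<And>z. norm z > R \<Longrightarrow> b z = 0"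
  shows "integrable lborel b"
proof -
  have "L2 (\<lambda>z. indicator (cball 0 R) z)"
    by (rule L2_bounded_support[where B = 1 and R = R]) (auto simp: indicator_def)
  from L2_mult_integrable[OF assms(1) this]
  have "integrable lborel (\<lambda>z. b z * indicator (cball 0 R) z)" .
  moreover have "(\<lambda>z. b z * indicator (cball 0 R) z) = b"
    using assms(2) by (force simp: indicator_def)
  ultimately show ?thesis by simp
qed

lemma mollifierD:
  assumes "mollifier \<delta> k"
  shows "test (\<lambda>z. of_real (k z))" "0 \<le> k z" "norm z > \<delta> \<Longrightarrow> k z = 0"
    "integrable lborel k" "(\<integral>z. k z \<partial>lborel) = 1" "k \<in> borel_measurable borel"
  using assms by (auto simp: mollifier_def)

lemma mollifier_reflect:
  assumes "mollifier \<delta> k"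
  shows "integrable lborel (\<lambda>w. k (z - w))" "(\<integral>w. k (z - w) \<partial>lborel) = 1"
  using lborel_integrable_reflect[OF mollifierD(4)[OF assms]]
    lborel_integral_reflect[OF mollifierD(6)[OF assms]] mollifierD(5)[OF assms] by auto

lemma conv_mollifier_test:
  assumes "L2 d" "\<And>z. norm z > R \<Longrightarrow> d z = 0" "mollifier \<delta> k"
  shows "test (conv d (\<lambda>z. of_real (k z)))"
  using L2_integrable_bounded_support[OF assms(1,2)] assms(2) mollifierD(1)[OF assms(3)]
  by (rule conv_test)

lemma conv_mollifier_support:
  assumes "\<And>z. norm z > R \<Longrightarrow> d z = 0" "mollifier \<delta> k" "norm z > R + \<delta>"
  shows "conv d (\<lambda>z. of_real (k z)) z = 0"
  using assms mollifierD(3)[OF assms(2)] by (intro conv_support[of R d \<delta>]) auto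

text \<open>
  Jensen's inequality for the probability density \<open>k (z - w)\<close>, in the form of the Cauchy-Schwarz inequality
  for \<open>sqrt k * d\<close> and \<open>sqrt k\<close>.
\<close>

lemma conv_mollifier_pointwise:
  assumes d: "L2 d" "\<And>z. norm z > R \<Longrightarrow> d z = 0" and k: "mollifier \<delta> k"
  shows "ennreal ((norm (conv d (\<lambda>z. of_real (k z)) z))\<^sup>2) \<le> (\<integral>\<^sup>+w. ennreal ((norm (d w))\<^sup>2 * k (z - w)) \<partial>lborel)"
proof -
  note [measurable] = mollifierD(6)[OF k] L2_measurable[OF d(1)]
  have k0: "k z \<ge> 0" for z using mollifierD(2)[OF k] .
  obtain B where B0: "\<And>z. norm (complex_of_real (k z)) \<le> B" using test_bounded[OF mollifierD(1)[OF k]] by blast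
  then have B: "k z \<le> B" for z using k0[of z] by (metis abs_of_nonneg norm_of_real)
  define q where "q w = complex_of_real (sqrt (k (z - w)))" for w
  have [measurable]: "q \<in> borel_measurable borel" unfolding q_def by measurable
  have qB: "norm (q w) \<le> sqrt B" for w
    using k0[of "z - w"] B[of "z - w"] by (simp add: q_def)
  have q2: "(norm (q w))\<^sup>2 = k (z - w)" for w using k0 by (simp add: q_def)
  have qq: "q w * q w = of_real (k (z - w))" for w
    using k0[of "z - w"] by (simp add: q_def flip: of_real_mult)
  have L2q: "L2 q" unfolding L2_def q2 using mollifier_reflect(1)[OF k] by simp
  have l2q: "l2 q = 1" unfolding l2_def q2 using mollifier_reflect(2)[OF k] by simp
  have L2dq: "L2 (\<lambda>w. q w * d w)" using d(1) qB by (intro L2_mult_bounded[where B = "sqrt B"]) auto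
  have "conv d (\<lambda>z. of_real (k z)) z = (\<integral>w. (q w * d w) * q w \<partial>lborel)"
    unfolding conv_def by (simp add: mult_ac flip: qq)
  then have "norm (conv d (\<lambda>z. of_real (k z)) z) \<le> l2 (\<lambda>w. q w * d w) * 1"
    using L2_Cauchy_Schwarz[OF L2dq L2q] by (simp add: l2q)
  then have "(norm (conv d (\<lambda>z. of_real (k z)) z))\<^sup>2 \<le> (l2 (\<lambda>w. q w * d w))\<^sup>2"
    by (intro power_mono) auto
  also have "(l2 (\<lambda>w. q w * d w))\<^sup>2 = (\<integral>w. (norm (q w * d w))\<^sup>2 \<partial>lborel)" by (rule l2_power2)
  finally have "ennreal ((norm (conv d (\<lambda>z. of_real (k z)) z))\<^sup>2) \<le> ennreal (\<integral>w. (norm (q w * d w))\<^sup>2 \<partial>lborel)"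
    by (rule ennreal_leI)
  also have "\<dots> = (\<integral>\<^sup>+w. ennreal ((norm (q w * d w))\<^sup>2) \<partial>lborel)"
    using L2dq by (subst nn_integral_eq_integral) (auto simp: L2_def)
  also have "\<dots> = (\<integral>\<^sup>+w. ennreal ((norm (d w))\<^sup>2 * k (z - w)) \<partial>lborel)"
    by (simp add: norm_mult power_mult_distrib q2 mult.commute)
  finally show ?thesis .
qed

lemma ennreal_l2_power2: "L2 f \<Longrightarrow> ennreal ((l2 f)\<^sup>2) = (\<integral>\<^sup>+z. ennreal ((norm (f z))\<^sup>2) \<partial>lborel)"
  unfolding l2_power2 by (subst nn_integral_eq_integral) (auto simp: L2_def)

text \<open>
  The pointwise bound is integrated over \<open>z\<close>, and Tonelli's theorem removes the mollifier.
\<close>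

lemma l2_conv_le:
  assumes d: "L2 d" "\<And>z. norm z > R \<Longrightarrow> d z = 0" and k: "mollifier \<delta> k"
  shows "l2 (conv d (\<lambda>z. of_real (k z))) \<le> l2 d"
proof -
  note [measurable] = mollifierD(6)[OF k] L2_measurable[OF d(1)]
  have k0: "k z \<ge> 0" for z using mollifierD(2)[OF k] .
  let ?c = "conv d (\<lambda>z. of_real (k z))"
  have "L2 ?c" using conv_mollifier_test[OF d k] by (rule test_L2)
  then have "ennreal ((l2 ?c)\<^sup>2) = (\<integral>\<^sup>+z. ennreal ((norm (?c z))\<^sup>2) \<partial>lborel)" by (rule ennreal_l2_power2)
  also have "\<dots> \<le> (\<integral>\<^sup>+z. (\<integral>\<^sup>+w. ennreal ((norm (d w))\<^sup>2 * k (z - w)) \<partial>lborel) \<partial>lborel)"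
    by (intro nn_integral_mono conv_mollifier_pointwise[OF d k])
  also have "\<dots> = (\<integral>\<^sup>+w. (\<integral>\<^sup>+z. ennreal ((norm (d w))\<^sup>2 * k (z - w)) \<partial>lborel) \<partial>lborel)"
    by (rule lborel_pair.Fubini') measurable
  also have "\<dots> = (\<integral>\<^sup>+w. ennreal ((norm (d w))\<^sup>2) \<partial>lborel)"
  proof (rule nn_integral_cong)
    fix w
    have "(\<integral>\<^sup>+z. ennreal ((norm (d w))\<^sup>2 * k (z - w)) \<partial>lborel) =
        ennreal ((norm (d w))\<^sup>2) * (\<integral>\<^sup>+z. ennreal (k (- w + z)) \<partial>lborel)"
      using k0 by (subst nn_integral_cmult[symmetric]) (auto simp: ennreal_mult)
    also have "(\<integral>\<^sup>+z. ennreal (k (- w + z)) \<partial>lborel) = (\<integral>\<^sup>+z. ennreal (k z) \<partial>lborel)"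
      by (rule nn_integral_translate) measurable
    also have "\<dots> = 1"
      using mollifierD(4,5)[OF k] k0 by (subst nn_integral_eq_integral) auto
    finally show "(\<integral>\<^sup>+z. ennreal ((norm (d w))\<^sup>2 * k (z - w)) \<partial>lborel) = ennreal ((norm (d w))\<^sup>2)" by simp
  qed
  also have "\<dots> = ennreal ((l2 d)\<^sup>2)" using d(1) by (simp add: ennreal_l2_power2)
  finally have "(l2 ?c)\<^sup>2 \<le> (l2 d)\<^sup>2" by (simp add: ennreal_le_iff)
  then show ?thesis by (rule power2_le_imp_le) simp
qed

lemma l2_tendsto_0:
  assumes f: "\<And>n. f n \<in> borel_measurable borel" and w: "integrable lborel w"
    and bd: "\<And>n z. (norm (f n z))\<^sup>2 \<le> w z"
    and lim: "AE z in lborel. (\<lambda>n. f n z) \<longlonglongrightarrow> 0"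
  shows "(\<lambda>n. l2 (f n)) \<longlonglongrightarrow> 0"
proof -
  have "(\<lambda>n. \<integral>z. (norm (f n z))\<^sup>2 \<partial>lborel) \<longlonglongrightarrow> (\<integral>z. 0 \<partial>(lborel :: complex measure))"
  proof (rule integral_dominated_convergence[OF _ _ w])
    show "AE z in lborel. (\<lambda>n. (norm (f n z))\<^sup>2) \<longlonglongrightarrow> 0"
      using lim
    proof eventually_elim
      case (elim z)
      then have "(\<lambda>n. (norm (f n z))\<^sup>2) \<longlonglongrightarrow> (norm (0::complex))\<^sup>2" by (intro tendsto_intros)
      then show ?case by simp
    qed
    show "AE z in lborel. norm ((norm (f n z))\<^sup>2) \<le> w z" for n using bd by auto
  qed (use f in measurable)
  then have "(\<lambda>n. \<integral>z. (norm (f n z))\<^sup>2 \<partial>lborel) \<longlonglongrightarrow> 0" by simp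
  from tendsto_real_sqrt[OF this] show ?thesis by (simp add: l2_def[abs_def])
qed

text \<open>
  The radial retraction onto the disc of radius \<open>M\<close>; it keeps approximating functions below the bound of the
  function that they approximate, as dominated convergence requires.
\<close>

definition clip :: "real \<Rightarrow> complex \<Rightarrow> complex" where
  "clip M w = of_real (M / max M (norm w)) * w"

lemma L2_truncation_tendsto:
  assumes "L2 b"
  shows "(\<lambda>n. l2 (\<lambda>z. b z - (if norm (b z) \<le> real n then b z else 0))) \<longlonglongrightarrow> 0"
proof (rule l2_tendsto_0)
  note [measurable] = L2_measurable[OF assms]
  show "integrable lborel (\<lambda>z. (norm (b z))\<^sup>2)" using assms by (simp add: L2_def)
  show "(\<lambda>z. b z - (if norm (b z) \<le> real n then b z else 0)) \<in> borel_measurable borel" for n by measurable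
  show "(norm (b z - (if norm (b z) \<le> real n then b z else 0)))\<^sup>2 \<le> (norm (b z))\<^sup>2" for n z by auto
  show "AE z in lborel. (\<lambda>n. b z - (if norm (b z) \<le> real n then b z else 0)) \<longlonglongrightarrow> 0"
  proof (rule AE_I2)
    fix z
    have "\<forall>\<^sub>F n in sequentially. norm (b z) \<le> real n"
      using eventually_ge_at_top[of "nat \<lceil>norm (b z)\<rceil>"] by eventually_elim linarith
    then have "\<forall>\<^sub>F n in sequentially. b z - (if norm (b z) \<le> real n then b z else 0) = 0"
      by eventually_elim simp
    then show "(\<lambda>n. b z - (if norm (b z) \<le> real n then b z else 0)) \<longlonglongrightarrow> 0"
      by (rule tendsto_eventually)
  qed
qed

text \<open>
  A measurable function is almost everywhere a limit of continuous functions. Clipping these and cutting them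
  off outside the support makes the convergence dominated.
\<close>

lemma continuous_approx_bounded:
  assumes b: "b \<in> borel_measurable borel" "\<And>z. norm (b z) \<le> M" "\<And>z. norm z > R \<Longrightarrow> b z = 0"
    and M: "M > 0" and "e > 0"
  obtains c :: "complex \<Rightarrow> complex" where
    "continuous_on UNIV c" "\<And>z. norm z > R + 1 \<Longrightarrow> c z = 0" "l2 (\<lambda>z. b z - c z) < e"
proof -
  have "b \<in> borel_measurable lebesgue" using b(1) by (intro measurable_completion) simp
  then have "b measurable_on UNIV" by (intro lebesgue_measurable_imp_measurable_on) auto
  then obtain N g where N: "negligible N" and g: "\<And>n. continuous_on UNIV (g n)"
    and lim: "\<And>x. x \<notin> N \<Longrightarrow> (\<lambda>n. g n x) \<longlonglongrightarrow> b x"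
    by (auto simp: measurable_on_def)
  \<comment> \<open>The first factor is a continuous cut-off, equal to one on the disc of radius \<open>R\<close>.\<close>
  define c where "c n z = of_real (max 0 (min 1 (R + 1 - norm z))) * clip M (g n z)" for n :: nat and z :: complex
  have clipc: "continuous_on UNIV (clip M)"
    unfolding clip_def using M by (intro continuous_intros) auto
  have clipb: "norm (clip M w) \<le> M" for w
  proof -
    have "norm (clip M w) = M / max M (norm w) * norm w"
      unfolding clip_def norm_mult norm_of_real using M by simp
    also have "\<dots> \<le> M" using M by (simp add: divide_le_eq mult_left_mono max_def)
    finally show ?thesis .
  qed
  have cc: "continuous_on UNIV (c n)" for n
    unfolding c_def by (intro continuous_intros continuous_on_compose2[OF clipc g[of n]]) auto
  have c0: "c n z = 0" if "norm z > R + 1" for n z using that by (simp add: c_def)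
  have cb: "norm (c n z) \<le> M" for n z
  proof -
    have "norm (c n z) = \<bar>max 0 (min 1 (R + 1 - norm z))\<bar> * norm (clip M (g n z))" by (simp add: c_def norm_mult)
    also have "\<dots> \<le> 1 * M" using M by (intro mult_mono clipb) auto
    finally show ?thesis by simp
  qed
  have "(\<lambda>n. l2 (\<lambda>z. b z - c n z)) \<longlonglongrightarrow> 0"
  proof (rule l2_tendsto_0[where w = "\<lambda>z. (2 * M)\<^sup>2 * indicator (cball 0 (R + 1)) z"])
    show "(\<lambda>z. b z - c n z) \<in> borel_measurable borel" for n
      using b(1) borel_measurable_continuous_onI[OF cc[of n]] by measurable
    show "integrable lborel (\<lambda>z::complex. (2 * M)\<^sup>2 * indicator (cball 0 (R + 1)) z)"
      by (intro integrable_mult_right integrable_real_indicator)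
         (auto intro!: emeasure_bounded_finite[OF bounded_cball, simplified])
    show "(norm (b z - c n z))\<^sup>2 \<le> (2 * M)\<^sup>2 * indicator (cball 0 (R + 1)) z" for n z
    proof (cases "norm z > R + 1")
      case True then show ?thesis using c0[of z n] b(3)[of z] by simp
    next
      case False
      have "norm (b z - c n z) \<le> 2 * M" using norm_triangle_ineq4[of "b z" "c n z"] b(2)[of z] cb[of n z] by simp
      then have "(norm (b z - c n z))\<^sup>2 \<le> (2 * M)\<^sup>2" by (intro power_mono) auto
      then show ?thesis using False by simp
    qed
    obtain N' where N': "N' \<in> null_sets lborel" "N \<subseteq> N'"
      using N by (auto simp: negligible_iff_null_sets null_sets_completion_iff2)
    show "AE z in lborel. (\<lambda>n. b z - c n z) \<longlonglongrightarrow> 0"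
      using AE_not_in[OF N'(1)]
    proof eventually_elim
      case (elim z)
      have "isCont (clip M) (b z)" using clipc by (simp add: continuous_on_eq_continuous_at)
      moreover have "(\<lambda>n. g n z) \<longlonglongrightarrow> b z" using lim elim N'(2) by blast
      ultimately have "(\<lambda>n. clip M (g n z)) \<longlonglongrightarrow> clip M (b z)" by (rule isCont_tendsto_compose)
      then have "(\<lambda>n. b z - c n z) \<longlonglongrightarrow> b z - of_real (max 0 (min 1 (R + 1 - norm z))) * clip M (b z)"
        unfolding c_def by (intro tendsto_intros)
      moreover have "clip M (b z) = b z" using M b(2)[of z] by (simp add: clip_def max_def)
      moreover have "of_real (max 0 (min 1 (R + 1 - norm z))) * b z = b z"
        using b(3)[of z] by (cases "norm z > R") auto
      ultimately show ?case by simp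
    qed
  qed
  then have "\<forall>\<^sub>F n in sequentially. l2 (\<lambda>z. b z - c n z) < e" using \<open>e > 0\<close> by (rule order_tendstoD)
  then obtain n where "l2 (\<lambda>z. b z - c n z) < e" using eventually_happens'[OF sequentially_bot] by blast
  then show ?thesis using that[of "c n"] cc c0 by blast
qed

lemma continuous_approx:
  assumes b: "L2 b" "\<And>z. norm z > R \<Longrightarrow> b z = 0" and "e > 0"
  obtains c :: "complex \<Rightarrow> complex" where
    "continuous_on UNIV c" "\<And>z. norm z > R + 1 \<Longrightarrow> c z = 0" "l2 (\<lambda>z. b z - c z) < e"
proof -
  note [measurable] = L2_measurable[OF b(1)]
  define t where "t n z = (if norm (b z) \<le> real n then b z else 0)" for n :: nat and z
  have [measurable]: "t n \<in> borel_measurable borel" for n unfolding t_def by measurable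
  have "(\<lambda>n. l2 (\<lambda>z. b z - t n z)) \<longlonglongrightarrow> 0"
    using L2_truncation_tendsto[OF b(1)] by (simp add: t_def)
  then have "\<forall>\<^sub>F n in sequentially. l2 (\<lambda>z. b z - t n z) < e / 2" using \<open>e > 0\<close> by (intro order_tendstoD) auto
  then have "\<forall>\<^sub>F n in sequentially. l2 (\<lambda>z. b z - t n z) < e / 2 \<and> n > 0"
    using eventually_gt_at_top[of 0] by eventually_elim auto
  then obtain n where n: "l2 (\<lambda>z. b z - t n z) < e / 2" "n > 0"
    using eventually_happens'[OF sequentially_bot] by blast
  have L2t: "L2 (t n)" by (rule L2_bound[OF b(1), where B = 1]) (auto simp: t_def)
  obtain c where c: "continuous_on UNIV c" "\<And>z. norm z > R + 1 \<Longrightarrow> c z = 0" "l2 (\<lambda>z. t n z - c z) < e / 2"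
  proof (rule continuous_approx_bounded[of "t n" "real n" R "e / 2"])
    show "norm (t n z) \<le> real n" for z by (simp add: t_def)
    show "t n z = 0" if "norm z > R" for z using b(2)[OF that] by (simp add: t_def)
  qed (use n \<open>e > 0\<close> in auto)
  have L2c: "L2 c" using L2_loc_bounded_support[OF L2_loc_continuous[OF c(1)]] c(2) by blast
  have "l2 (\<lambda>z. b z - c z) \<le> l2 (\<lambda>z. b z - t n z) + l2 (\<lambda>z. t n z - c z)"
    using l2_triangle[OF L2_diff[OF b(1) L2t] L2_diff[OF L2t L2c]] by simp
  then have "l2 (\<lambda>z. b z - c z) < e" using n c(3) by simp
  then show ?thesis using that c by blast
qed

lemma mollify_continuous:
  assumes c: "continuous_on UNIV c" "\<And>z. norm z > R \<Longrightarrow> c z = 0" and "e > 0"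
  obtains d where "d > 0" "d \<le> 1" "\<And>k. mollifier d k \<Longrightarrow> l2 (\<lambda>z. conv c (\<lambda>z. of_real (k z)) z - c z) \<le> e"
proof -
  have L2c: "L2 c" using L2_loc_bounded_support[OF L2_loc_continuous[OF c(1)]] c(2) by blast
  define V where "V = measure lborel (cball (0::complex) (R + 1))"
  define e' where "e' = e / (sqrt V + 1)"
  have V: "V \<ge> 0" by (simp add: V_def)
  have e': "e' > 0" using V \<open>e > 0\<close> by (simp add: e'_def add_nonneg_pos)
  obtain d where d: "d > 0" "\<And>x y. norm (x - y) < d \<Longrightarrow> norm (c x - c y) < e'"
    using uniform_continuity[OF c e'] by blast
  show ?thesis
  proof (rule that[of "min (d / 2) 1"])
    fix k assume k: "mollifier (min (d / 2) 1) k"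
    let ?c = "conv c (\<lambda>z. of_real (k z))"
    note [measurable] = mollifierD(6)[OF k] L2_measurable[OF L2c]
    have k0: "k z \<ge> 0" for z using mollifierD(2)[OF k] .
    have pt: "norm (?c z - c z) \<le> e'" for z
    proof -
      have i1: "integrable lborel (\<lambda>w. c w * of_real (k (z - w)))"
        using conv_test_integrable[OF L2_integrable_bounded_support[OF L2c c(2)] mollifierD(1)[OF k]] by simp
      have i2: "integrable lborel (\<lambda>w. c z * of_real (k (z - w)))"
        using mollifier_reflect(1)[OF k] by (intro integrable_mult_right integrable_of_real)
      have "c z = (\<integral>w. c z * of_real (k (z - w)) \<partial>lborel)"
        using mollifier_reflect[OF k, of z] by (simp add: integral_of_real)
      then have eq: "?c z - c z = (\<integral>w. c w * of_real (k (z - w)) - c z * of_real (k (z - w)) \<partial>lborel)"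
        unfolding conv_def using i1 i2 by simp
      have "norm (?c z - c z) \<le> (\<integral>w. norm (c w * of_real (k (z - w)) - c z * of_real (k (z - w))) \<partial>lborel)"
        unfolding eq by (rule integral_norm_bound)
      also have "\<dots> \<le> (\<integral>w. e' * k (z - w) \<partial>lborel)"
      proof (rule integral_mono)
        show "norm (c w * of_real (k (z - w)) - c z * of_real (k (z - w))) \<le> e' * k (z - w)" for w
        proof (cases "norm (z - w) > min (d / 2) 1")
          case True
          then show ?thesis using mollifierD(3)[OF k] by simp
        next
          case False
          then have "norm (w - z) < d" using d(1) by (simp add: norm_minus_commute)
          then have "norm (c w - c z) \<le> e'" using d(2)[of w z] by simp
          then show ?thesis using k0[of "z - w"]
            by (simp add: norm_mult mult_right_mono flip: left_diff_distrib)
        qed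
      qed (use i1 i2 mollifier_reflect(1)[OF k] in auto)
      also have "\<dots> = e'" using mollifier_reflect(2)[OF k] by simp
      finally show ?thesis .
    qed
    have s: "?c z - c z = 0" if "norm z > R + 1" for z
    proof -
      have "?c z = 0" using that by (intro conv_mollifier_support[OF c(2) k]) auto
      then show ?thesis using c(2)[of z] that by simp
    qed
    have L2c': "L2 ?c" using conv_mollifier_test[OF L2c c(2) k] by (rule test_L2)
    have "(l2 (\<lambda>z. ?c z - c z))\<^sup>2 = (\<integral>z. (norm (?c z - c z))\<^sup>2 \<partial>lborel)" by (rule l2_power2)
    also have "\<dots> \<le> (\<integral>z. e'\<^sup>2 * indicator (cball 0 (R + 1)) (z::complex) \<partial>lborel)"
    proof (rule integral_mono)
      show "integrable lborel (\<lambda>z. (norm (?c z - c z))\<^sup>2)" using L2_diff[OF L2c' L2c] by (simp add: L2_def)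
      show "integrable lborel (\<lambda>z::complex. e'\<^sup>2 * indicator (cball 0 (R + 1)) z :: real)"
        by (intro integrable_mult_right integrable_real_indicator)
           (auto intro!: emeasure_bounded_finite[OF bounded_cball, simplified])
      show "(norm (?c z - c z))\<^sup>2 \<le> e'\<^sup>2 * indicator (cball 0 (R + 1)) z" for z
        using power_mono[OF pt[of z] norm_ge_zero, of 2] s[of z] by (cases "norm z > R + 1") auto
    qed
    also have "\<dots> = e'\<^sup>2 * V" by (simp add: V_def)
    also have "\<dots> = (e' * sqrt V)\<^sup>2" using V by (simp add: power_mult_distrib)
    finally have sq: "(l2 (\<lambda>z. ?c z - c z))\<^sup>2 \<le> (e' * sqrt V)\<^sup>2" .
    have "l2 (\<lambda>z. ?c z - c z) \<le> e' * sqrt V"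
      by (rule power2_le_imp_le[OF sq]) (use e' V in auto)
    also have "\<dots> \<le> e' * (sqrt V + 1)" using e' by (intro mult_left_mono) auto
    also have "\<dots> = e" using add_nonneg_pos[of "sqrt V" 1] V by (simp add: e'_def)
    finally show "l2 (\<lambda>z. ?c z - c z) \<le> e" .
  qed (use d in auto)
qed

lemma mollifier_mono: "mollifier d k \<Longrightarrow> d \<le> d' \<Longrightarrow> mollifier d' k"
  by (auto simp: mollifier_def)

text \<open>
  Mollification is a contraction in the mean, so it suffices to approximate by a continuous function of compact
  support, for which the convergence is uniform.
\<close>

lemma mollify_L2:
  assumes b: "L2 b" "\<And>z. norm z > R \<Longrightarrow> b z = 0" and "e > 0"
  obtains d where "d > 0" "d \<le> 1"
    "\<And>k. mollifier d k \<Longrightarrow> l2 (\<lambda>z. conv b (\<lambda>z. of_real (k z)) z - b z) < e"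
proof -
  obtain c where c: "continuous_on UNIV c" "\<And>z. norm z > R + 1 \<Longrightarrow> c z = 0" "l2 (\<lambda>z. b z - c z) < e / 3"
    using continuous_approx[OF b, where e = "e / 3"] \<open>e > 0\<close> by auto
  have L2c: "L2 c" using L2_loc_bounded_support[OF L2_loc_continuous[OF c(1)]] c(2) by blast
  obtain d where d: "d > 0" "d \<le> 1" "\<And>k. mollifier d k \<Longrightarrow> l2 (\<lambda>z. conv c (\<lambda>z. of_real (k z)) z - c z) \<le> e / 3"
    using mollify_continuous[OF c(1,2), where e = "e / 3"] \<open>e > 0\<close> by auto
  have bs: "b z - c z = 0" if "norm z > R + 1" for z using that b(2)[of z] c(2)[of z] by simp
  have L2bc: "L2 (\<lambda>z. b z - c z)" using b(1) L2c by (rule L2_diff)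
  show ?thesis
  proof (rule that[OF d(1,2)])
    fix k assume k: "mollifier d k"
    let ?k = "\<lambda>z. complex_of_real (k z)"
    have ib: "integrable lborel b" and ic: "integrable lborel c"
      using L2_integrable_bounded_support b L2c c(2) by blast+
    have cd: "conv (\<lambda>z. b z - c z) ?k z = conv b ?k z - conv c ?k z" for z
      unfolding conv_def
      using conv_test_integrable[OF ib mollifierD(1)[OF k], of z] conv_test_integrable[OF ic mollifierD(1)[OF k], of z]
      by (simp add: left_diff_distrib)
    have 1: "l2 (conv (\<lambda>z. b z - c z) ?k) \<le> l2 (\<lambda>z. b z - c z)"
      using l2_conv_le[OF L2bc bs k] .
    have L2conv: "L2 (conv (\<lambda>z. b z - c z) ?k)" "L2 (conv c ?k)"
      using test_L2[OF conv_mollifier_test[OF L2bc bs k]] test_L2[OF conv_mollifier_test[OF L2c c(2) k]] by auto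
    have cb: "l2 (\<lambda>z. c z - b z) = l2 (\<lambda>z. b z - c z)" by (simp add: l2_def norm_minus_commute)
    have "l2 (\<lambda>z. conv b ?k z - b z) =
        l2 (\<lambda>z. conv (\<lambda>z. b z - c z) ?k z + ((conv c ?k z - c z) + (c z - b z)))"
      by (simp add: cd)
    also have "\<dots> \<le> l2 (conv (\<lambda>z. b z - c z) ?k) + l2 (\<lambda>z. (conv c ?k z - c z) + (c z - b z))"
      by (intro l2_triangle L2conv L2_add L2_diff L2c b)
    also have "l2 (\<lambda>z. (conv c ?k z - c z) + (c z - b z)) \<le> l2 (\<lambda>z. conv c ?k z - c z) + l2 (\<lambda>z. c z - b z)"
      by (intro l2_triangle L2conv L2_diff L2c b)
    finally show "l2 (\<lambda>z. conv b ?k z - b z) < e"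
      using 1 d(3)[OF k] c(3) cb by linarith
  qed
qed

section \<open>Weak derivatives\<close>

text \<open>
  The Wirtinger derivatives \<open>u1\<close> (with respect to \<open>z\<close>) and \<open>u2\<close> (with respect to the conjugate of \<open>z\<close>) in the sense of distributions on the whole plane. Continuity of
  \<open>u\<close> is part of the notion because products with continuous cut-offs are formed all the time.
\<close>

definition weak_deriv :: "(complex \<Rightarrow> complex) \<Rightarrow> (complex \<Rightarrow> complex) \<Rightarrow> (complex \<Rightarrow> complex) \<Rightarrow> bool" where
  "weak_deriv u u1 u2 \<longleftrightarrow> continuous_on UNIV u \<and> L2_loc u1 \<and> L2_loc u2 \<and>
     (\<forall>\<phi>. test \<phi> \<longrightarrow>
        (\<integral>z. u z * partial_z \<phi> z \<partial>lborel) = - (\<integral>z. u1 z * \<phi> z \<partial>lborel) \<and>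
        (\<integral>z. u z * partial_zbar \<phi> z \<partial>lborel) = - (\<integral>z. u2 z * \<phi> z \<partial>lborel))"

lemma weak_derivD:
  assumes "weak_deriv u u1 u2"
  shows "continuous_on UNIV u" "L2_loc u1" "L2_loc u2"
    "test \<phi> \<Longrightarrow> (\<integral>z. u z * partial_z \<phi> z \<partial>lborel) = - (\<integral>z. u1 z * \<phi> z \<partial>lborel)"
    "test \<phi> \<Longrightarrow> (\<integral>z. u z * partial_zbar \<phi> z \<partial>lborel) = - (\<integral>z. u2 z * \<phi> z \<partial>lborel)"
  using assms by (auto simp: weak_deriv_def)

lemma partial_cnj:
  assumes "\<And>z. f differentiable (at z)"
  shows "partial_z (\<lambda>z. cnj (f z)) = (\<lambda>z. cnj (partial_zbar f z))"
    "partial_zbar (\<lambda>z. cnj (f z)) = (\<lambda>z. cnj (partial_z f z))"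
  using assms by (auto simp: fun_eq_iff partial_z_pd partial_zbar_pd pd_cnj)

lemma test_differentiable: "test \<phi> \<Longrightarrow> \<phi> differentiable (at z)"
  by (simp add: test_def smooth_differentiable)

lemma weak_deriv_cnj:
  assumes "weak_deriv u u1 u2"
  shows "weak_deriv (\<lambda>z. cnj (u z)) (\<lambda>z. cnj (u2 z)) (\<lambda>z. cnj (u1 z))"
  unfolding weak_deriv_def
proof (intro conjI allI impI)
  show "continuous_on UNIV (\<lambda>z. cnj (u z))" using weak_derivD(1)[OF assms] by (intro continuous_intros)
  show "L2_loc (\<lambda>z. cnj (u2 z))" "L2_loc (\<lambda>z. cnj (u1 z))"
    using weak_derivD(2,3)[OF assms] L2_loc_cnj by auto
  fix \<phi> assume \<phi>: "test \<phi>"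
  let ?\<psi> = "\<lambda>z. cnj (\<phi> z)"
  have t: "test ?\<psi>" using \<phi> by (rule test_cnj)
  have eq: "partial_z \<phi> = (\<lambda>z. cnj (partial_zbar ?\<psi> z))" "partial_zbar \<phi> = (\<lambda>z. cnj (partial_z ?\<psi> z))"
    using partial_cnj[of ?\<psi>] test_differentiable[OF t] by auto
  have c: "(\<integral>z. cnj (a z) * cnj (b z) \<partial>lborel) = cnj (\<integral>z. a z * b z \<partial>lborel)" for a b :: "complex \<Rightarrow> complex"
    using Bochner_Integration.integral_cnj[of lborel "\<lambda>z. a z * b z"] by simp
  have d: "(\<integral>z. cnj (a z) * \<phi> z \<partial>lborel) = cnj (\<integral>z. a z * ?\<psi> z \<partial>lborel)" for a :: "complex \<Rightarrow> complex"
    using c[of a ?\<psi>] by simp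
  show "(\<integral>z. cnj (u z) * partial_z \<phi> z \<partial>lborel) = - (\<integral>z. cnj (u2 z) * \<phi> z \<partial>lborel)"
    unfolding eq(1) c d weak_derivD(5)[OF assms t] by simp
  show "(\<integral>z. cnj (u z) * partial_zbar \<phi> z \<partial>lborel) = - (\<integral>z. cnj (u1 z) * \<phi> z \<partial>lborel)"
    unfolding eq(2) c d weak_derivD(4)[OF assms t] by simp
qed

lemma partial_mult:
  assumes "f differentiable (at z)" "g differentiable (at z)"
  shows "partial_z (\<lambda>z. f z * g z) z = f z * partial_z g z + partial_z f z * g z"
    "partial_zbar (\<lambda>z. f z * g z) z = f z * partial_zbar g z + partial_zbar f z * g z"
  using assms by (auto simp: partial_z_pd partial_zbar_pd pd_mult algebra_simps add_divide_distrib)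

lemma weak_deriv_mult_smooth:
  assumes w: "weak_deriv u u1 u2" and f: "smooth f"
  shows "weak_deriv (\<lambda>z. f z * u z) (\<lambda>z. f z * u1 z + partial_z f z * u z)
           (\<lambda>z. f z * u2 z + partial_zbar f z * u z)"
  unfolding weak_deriv_def
proof (intro conjI allI impI)
  have fc: "continuous_on UNIV f" "continuous_on UNIV (partial_z f)" "continuous_on UNIV (partial_zbar f)"
    using f smooth_partial smooth_continuous by auto
  note wd = weak_derivD[OF w]
  show "continuous_on UNIV (\<lambda>z. f z * u z)" using wd fc by (intro continuous_intros)
  show "L2_loc (\<lambda>z. f z * u1 z + partial_z f z * u z)"
    by (intro L2_loc_add L2_loc_mult_continuous[OF wd(2) fc(1)] L2_loc_mult_continuous[OF L2_loc_continuous[OF wd(1)] fc(2)])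
  show "L2_loc (\<lambda>z. f z * u2 z + partial_zbar f z * u z)"
    by (intro L2_loc_add L2_loc_mult_continuous[OF wd(3) fc(1)] L2_loc_mult_continuous[OF L2_loc_continuous[OF wd(1)] fc(3)])
  fix \<phi> assume \<phi>: "test \<phi>"
  have t: "test (\<lambda>z. f z * \<phi> z)" using test_mult_smooth[OF f \<phi>] .
  have d: "f differentiable (at z)" "\<phi> differentiable (at z)" for z
    using smooth_differentiable f test_differentiable \<phi> by auto
  have Lu: "L2_loc u" using wd(1) by (rule L2_loc_continuous)
  have i: "integrable lborel (\<lambda>z. u z * (f z * partial_z \<phi> z))" "integrable lborel (\<lambda>z. u z * (partial_z f z * \<phi> z))"
    "integrable lborel (\<lambda>z. u z * (f z * partial_zbar \<phi> z))" "integrable lborel (\<lambda>z. u z * (partial_zbar f z * \<phi> z))"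
    "integrable lborel (\<lambda>z. u1 z * (f z * \<phi> z))" "integrable lborel (\<lambda>z. u2 z * (f z * \<phi> z))"
    using L2_loc_test_integrable Lu wd(2,3) test_mult_smooth f \<phi> smooth_partial[OF f] test_partial[OF \<phi>] by auto
  have "(\<integral>z. u z * (f z * partial_z \<phi> z) \<partial>lborel) + (\<integral>z. u z * (partial_z f z * \<phi> z) \<partial>lborel)
      = - (\<integral>z. u1 z * (f z * \<phi> z) \<partial>lborel)"
    using wd(4)[OF t] i by (simp add: partial_mult d distrib_left)
  moreover have "(\<integral>z. (f z * u1 z + partial_z f z * u z) * \<phi> z \<partial>lborel) =
     (\<integral>z. u1 z * (f z * \<phi> z) + u z * (partial_z f z * \<phi> z) \<partial>lborel)" by (simp add: algebra_simps)
  moreover have "(\<integral>z. f z * u z * partial_z \<phi> z \<partial>lborel) = (\<integral>z. u z * (f z * partial_z \<phi> z) \<partial>lborel)"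
    by (simp add: mult_ac)
  ultimately show "(\<integral>z. f z * u z * partial_z \<phi> z \<partial>lborel) = - (\<integral>z. (f z * u1 z + partial_z f z * u z) * \<phi> z \<partial>lborel)"
    using i by (simp add: algebra_simps)
  have "(\<integral>z. u z * (f z * partial_zbar \<phi> z) \<partial>lborel) + (\<integral>z. u z * (partial_zbar f z * \<phi> z) \<partial>lborel)
      = - (\<integral>z. u2 z * (f z * \<phi> z) \<partial>lborel)"
    using wd(5)[OF t] i by (simp add: partial_mult d distrib_left)
  moreover have "(\<integral>z. (f z * u2 z + partial_zbar f z * u z) * \<phi> z \<partial>lborel) =
     (\<integral>z. u2 z * (f z * \<phi> z) + u z * (partial_zbar f z * \<phi> z) \<partial>lborel)" by (simp add: algebra_simps)
  moreover have "(\<integral>z. f z * u z * partial_zbar \<phi> z \<partial>lborel) = (\<integral>z. u z * (f z * partial_zbar \<phi> z) \<partial>lborel)"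
    by (simp add: mult_ac)
  ultimately show "(\<integral>z. f z * u z * partial_zbar \<phi> z \<partial>lborel) = - (\<integral>z. (f z * u2 z + partial_zbar f z * u z) * \<phi> z \<partial>lborel)"
    using i by (simp add: algebra_simps)
qed

section \<open>The fundamental lemma and the bilinear identity\<close>

lemma mollify_pairing:
  assumes a: "L2_loc a" and b: "L2 b" "\<And>z. norm z > R \<Longrightarrow> b z = 0" and "e > 0"
  shows "\<exists>d>0. \<forall>k. mollifier d k \<longrightarrow>
    norm ((\<integral>z. a z * conv b (\<lambda>z. of_real (k z)) z \<partial>lborel) - (\<integral>z. a z * b z \<partial>lborel)) < e"
proof -
  define A where "A z = indicator (cball 0 (R + 1)) z * a z" for z
  have A: "L2 A" using L2_locD[OF a, of "R + 1"] by (simp add: A_def[abs_def])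
  define e' where "e' = e / (l2 A + 1)"
  have e': "e' > 0" using \<open>e > 0\<close> by (simp add: e'_def add_nonneg_pos)
  obtain d where d: "d > 0" "d \<le> 1"
    "\<And>k. mollifier d k \<Longrightarrow> l2 (\<lambda>z. conv b (\<lambda>z. of_real (k z)) z - b z) < e'"
    using mollify_L2[OF b e'] by blast
  show ?thesis
  proof (intro exI[of _ d] conjI allI impI d(1))
    fix k assume k: "mollifier d k"
    let ?c = "conv b (\<lambda>z. of_real (k z))"
    have c: "L2 ?c" using conv_mollifier_test[OF b k] by (rule test_L2)
    have cs: "?c z = 0" if "norm z > R + 1" for z
      using that d(2) by (intro conv_mollifier_support[OF b(2) k]) auto
    have ints: "integrable lborel (\<lambda>z. a z * ?c z)" "integrable lborel (\<lambda>z. a z * b z)"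
      using L2_loc_mult_integrable[OF a c cs] L2_loc_mult_integrable[OF a b] by auto
    have eq: "a z * ?c z - a z * b z = A z * (?c z - b z)" for z
      using cs[of z] b(2)[of z] by (auto simp: A_def indicator_def algebra_simps)
    have "(\<integral>z. a z * ?c z \<partial>lborel) - (\<integral>z. a z * b z \<partial>lborel) = (\<integral>z. A z * (?c z - b z) \<partial>lborel)"
      using ints by (simp flip: eq)
    then have "norm ((\<integral>z. a z * ?c z \<partial>lborel) - (\<integral>z. a z * b z \<partial>lborel)) \<le> l2 A * l2 (\<lambda>z. ?c z - b z)"
      using L2_Cauchy_Schwarz[OF A L2_diff[OF c b(1)]] by simp
    also have "\<dots> \<le> l2 A * e'" using d(3)[OF k] by (intro mult_left_mono) auto
    also have "\<dots> < (l2 A + 1) * e'" using e' by simp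
    also have "\<dots> = e" using add_nonneg_pos[of "l2 A" 1] by (simp add: e'_def)
    finally show "norm ((\<integral>z. a z * ?c z \<partial>lborel) - (\<integral>z. a z * b z \<partial>lborel)) < e" .
  qed
qed

lemma ball_eq_Union_cball: "ball (0::complex) r = (\<Union>n. cball 0 (r - 1 / real (Suc n)))"
proof safe
  fix z :: complex assume "z \<in> ball 0 r"
  then have "0 < r - norm z" by simp
  then obtain n where "1 / real (Suc n) < r - norm z" using nat_approx_posE by blast
  then have "z \<in> cball 0 (r - 1 / real (Suc n))" by simp
  then show "z \<in> (\<Union>n. cball 0 (r - 1 / real (Suc n)))" by blast
next
  fix z :: complex and n :: nat assume "z \<in> cball 0 (r - 1 / real (Suc n))"
  moreover have "1 / real (Suc n) > 0" by simp
  ultimately show "z \<in> ball 0 r" unfolding mem_cball_0 mem_ball_0 by linarith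
qed

text \<open>
  If \<open>d\<close> annihilates all test functions supported inside the disc, it annihilates the mollifications of
  \<open>cnj d\<close> restricted to a smaller disc, and hence in the limit that function itself: the integral of
  \<open>\<bar>d\<bar>\<^sup>2\<close> over the smaller disc vanishes.
\<close>

lemma fundamental_lemma:
  assumes d: "L2_loc d"
    and 0: "\<And>\<phi> s. test \<phi> \<Longrightarrow> s < r \<Longrightarrow> (\<And>z. norm z > s \<Longrightarrow> \<phi> z = 0) \<Longrightarrow> (\<integral>z. d z * \<phi> z \<partial>lborel) = 0"
  shows "AE z in lborel. norm z < r \<longrightarrow> d z = 0"
proof -
  note [measurable] = L2_loc_measurable[OF d]
  have *: "AE z in lborel. norm z \<le> s \<longrightarrow> d z = 0" if "s < r" for s
  proof -
    \<comment> \<open>The pairing of \<open>d\<close> with \<open>b\<close> is the integral of \<open>\<bar>d\<bar>\<^sup>2\<close> over the smaller disc.\<close>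
    define b where "b z = indicator (cball 0 s) z * cnj (d z)" for z
    have b: "L2 b" using L2_locD[OF L2_loc_cnj[OF d], of s] by (simp add: b_def[abs_def])
    have bs: "b z = 0" if "norm z > s" for z using that by (simp add: b_def)
    have "(\<integral>z. d z * b z \<partial>lborel) = 0"
    proof (rule ccontr)
      assume ne: "(\<integral>z. d z * b z \<partial>lborel) \<noteq> 0"
      then obtain \<delta> where \<delta>: "\<delta> > 0" "\<And>k. mollifier \<delta> k \<Longrightarrow>
        norm ((\<integral>z. d z * conv b (\<lambda>z. of_real (k z)) z \<partial>lborel) - (\<integral>z. d z * b z \<partial>lborel))
          < norm (\<integral>z. d z * b z \<partial>lborel)"
        using mollify_pairing[OF d b, where R = s and e = "norm (\<integral>z. d z * b z \<partial>lborel)"] bs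
        unfolding zero_less_norm_iff by blast
      define \<delta>' where "\<delta>' = min \<delta> ((r - s) / 2)"
      have "\<delta>' > 0" using \<delta>(1) that by (simp add: \<delta>'_def)
      then obtain k where k: "mollifier \<delta>' k" using mollifier_exists by blast
      have "(\<integral>z. d z * conv b (\<lambda>z. of_real (k z)) z \<partial>lborel) = 0"
      proof (rule 0)
        show "test (conv b (\<lambda>z. of_real (k z)))" by (rule conv_mollifier_test[OF b bs k])
        show "conv b (\<lambda>z. of_real (k z)) z = 0" if "norm z > s + \<delta>'" for z
          using that by (intro conv_mollifier_support[OF bs k])
        show "s + \<delta>' < r" using \<open>s < r\<close> by (auto simp: \<delta>'_def min_def field_simps)
      qed
      moreover have "mollifier \<delta> k" using k by (rule mollifier_mono) (simp add: \<delta>'_def)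
      ultimately show False using \<delta>(2)[of k] by simp
    qed
    moreover have "d z * b z = of_real ((norm (b z))\<^sup>2)" for z
      using complex_norm_square[of "d z"] by (auto simp: b_def indicator_def simp del: of_real_power)
    ultimately have "(\<integral>z. complex_of_real ((norm (b z))\<^sup>2) \<partial>lborel) = 0" by simp
    then have "(\<integral>z. (norm (b z))\<^sup>2 \<partial>lborel) = 0" unfolding integral_complex_of_real by simp
    then have "AE z in lborel. (norm (b z))\<^sup>2 = 0"
      using b by (subst (asm) integral_nonneg_eq_0_iff_AE) (auto simp: L2_def)
    then show ?thesis by eventually_elim (auto simp: b_def indicator_def split: if_splits)
  qed
  have "AE z in lborel. \<forall>n. norm z \<le> r - 1 / real (Suc n) \<longrightarrow> d z = 0"
    unfolding AE_all_countable by (intro allI *) simp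
  then show ?thesis
  proof eventually_elim
    case (elim z)
    then show ?case using ball_eq_Union_cball[of r] by (auto simp: set_eq_iff)
  qed
qed

text \<open>
  The mixed second derivatives of a test function agree.
\<close>

lemma weak_deriv_swap:
  assumes u: "weak_deriv u u1 u2" and \<phi>: "test \<phi>"
  shows "(\<integral>z. u1 z * partial_zbar \<phi> z \<partial>lborel) = (\<integral>z. u2 z * partial_z \<phi> z \<partial>lborel)"
  using weak_derivD(4)[OF u test_partial(2)[OF \<phi>]] weak_derivD(5)[OF u test_partial(1)[OF \<phi>]]
    partial_commute[of \<phi>] \<phi> by (simp add: test_def)

lemma partial_reflect:
  assumes "test \<eta>"
  shows "partial_z (\<lambda>w. \<eta> (z - w)) w = - partial_z \<eta> (z - w)"
    "partial_zbar (\<lambda>w. \<eta> (z - w)) w = - partial_zbar \<eta> (z - w)"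
  using test_differentiable[OF assms] by (simp_all add: partial_z_pd partial_zbar_pd pd_reflect algebra_simps)

lemma conv_weak_deriv:
  assumes v: "weak_deriv v v1 v2" and \<eta>: "test \<eta>"
  shows "conv v (partial_z \<eta>) = conv v1 \<eta>" "conv v (partial_zbar \<eta>) = conv v2 \<eta>"
  using weak_derivD(4,5)[OF v test_reflect[OF \<eta>]] by (simp_all add: fun_eq_iff conv_def partial_reflect[OF \<eta>])

text \<open>
  The vanishing of the integral of \<open>du \<and> dv\<close> for compactly supported \<open>v\<close>. For a test function \<open>v\<close> this is
  the symmetry of second derivatives; in general \<open>v\<close> is mollified, and its derivatives then converge in the mean.
\<close>

lemma bilinear_identity_compact:
  assumes u: "weak_deriv u u1 u2" and v: "weak_deriv v v1 v2"
    and supp: "\<And>z. norm z > R \<Longrightarrow> v z = 0" "\<And>z. norm z > R \<Longrightarrow> v1 z = 0" "\<And>z. norm z > R \<Longrightarrow> v2 z = 0"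
  shows "(\<integral>z. u1 z * v2 z \<partial>lborel) = (\<integral>z. u2 z * v1 z \<partial>lborel)"
proof (rule ccontr)
  define e where "e = norm ((\<integral>z. u1 z * v2 z \<partial>lborel) - (\<integral>z. u2 z * v1 z \<partial>lborel)) / 2"
  assume "(\<integral>z. u1 z * v2 z \<partial>lborel) \<noteq> (\<integral>z. u2 z * v1 z \<partial>lborel)"
  then have e: "e > 0" by (simp add: e_def)
  have Lv: "L2 v" "L2 v1" "L2 v2"
    using L2_loc_bounded_support supp weak_derivD(1,2,3)[OF v] L2_loc_continuous by blast+
  obtain d1 where d1: "d1 > 0" "\<And>k. mollifier d1 k \<Longrightarrow>
    norm ((\<integral>z. u1 z * conv v2 (\<lambda>z. of_real (k z)) z \<partial>lborel) - (\<integral>z. u1 z * v2 z \<partial>lborel)) < e"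
    using mollify_pairing[OF weak_derivD(2)[OF u] Lv(3), where R = R and e = e] supp(3) e by blast
  obtain d2 where d2: "d2 > 0" "\<And>k. mollifier d2 k \<Longrightarrow>
    norm ((\<integral>z. u2 z * conv v1 (\<lambda>z. of_real (k z)) z \<partial>lborel) - (\<integral>z. u2 z * v1 z \<partial>lborel)) < e"
    using mollify_pairing[OF weak_derivD(3)[OF u] Lv(2), where R = R and e = e] supp(2) e by blast
  obtain k where k: "mollifier (min d1 d2) k" using mollifier_exists[of "min d1 d2"] d1 d2 by auto
  let ?k = "\<lambda>z. complex_of_real (k z)"
  have t: "test ?k" and tv: "test (conv v ?k)"
    using mollifierD(1)[OF k] conv_mollifier_test[OF Lv(1) supp(1) k] by auto
  have "(\<integral>z. u1 z * conv v2 ?k z \<partial>lborel) = (\<integral>z. u2 z * conv v1 ?k z \<partial>lborel)"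
    using weak_deriv_swap[OF u tv] partial_conv[OF L2_integrable_bounded_support[OF Lv(1) supp(1)] t]
      conv_weak_deriv[OF v t] by simp
  moreover have "mollifier d1 k" "mollifier d2 k" using k by (auto intro: mollifier_mono)
  ultimately have "norm ((\<integral>z. u1 z * v2 z \<partial>lborel) - (\<integral>z. u2 z * v1 z \<partial>lborel)) < e + e"
    using d1(2)[of k] d2(2)[of k]
      norm_triangle_ineq4[of "(\<integral>z. u2 z * conv v1 ?k z \<partial>lborel) - (\<integral>z. u2 z * v1 z \<partial>lborel)"
        "(\<integral>z. u1 z * conv v2 ?k z \<partial>lborel) - (\<integral>z. u1 z * v2 z \<partial>lborel)"] by simp
  then show False by (simp add: e_def)
qed

section \<open>Cut-offs and functions of finite energy\<close>

text \<open>
  Rescaling one bump function: the gradient decays like the reciprocal of the radius, while the area of the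
  annulus on which it lives grows like the square of the radius, so that the gradients stay bounded in the mean.
\<close>

lemma cutoff_exists:
  obtains X :: "nat \<Rightarrow> complex \<Rightarrow> real" and C where
    "\<And>n. test (\<lambda>z. of_real (X n z))" "\<And>n z. 0 \<le> X n z" "\<And>n z. X n z \<le> 1"
    "\<And>n z. norm z \<le> real (Suc n) \<Longrightarrow> X n z = 1" "\<And>n z. norm z \<ge> 2 * real (Suc n) \<Longrightarrow> X n z = 0"
    "\<And>n z. norm (partial_z (\<lambda>z. of_real (X n z)) z) \<le> C / real (Suc n)"
    "\<And>n z. norm (partial_zbar (\<lambda>z. of_real (X n z)) z) \<le> C / real (Suc n)"
    "\<And>n z. norm z < real (Suc n) \<or> norm z > 2 * real (Suc n) \<Longrightarrow> partial_z (\<lambda>z. of_real (X n z)) z = 0"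
    "\<And>n z. norm z < real (Suc n) \<or> norm z > 2 * real (Suc n) \<Longrightarrow> partial_zbar (\<lambda>z. of_real (X n z)) z = 0"
proof -
  obtain bump :: "complex \<Rightarrow> real" where b:
    "\<And>n. Ck n (\<lambda>z. of_real (bump z))" "\<And>z. 0 \<le> bump z" "\<And>z. bump z \<le> 1"
    "\<And>z. norm z \<le> 1 \<Longrightarrow> bump z = 1" "\<And>z. norm z \<ge> 2 \<Longrightarrow> bump z = 0"
    using smooth_bump_exists by blast
  let ?b = "\<lambda>z. complex_of_real (bump z)"
  have tb: "test ?b" unfolding test_def smooth_def using b(1,5) by (auto intro!: exI[of _ 2])
  obtain C1 C2 where C1: "\<And>z. norm (partial_z ?b z) \<le> C1" and C2: "\<And>z. norm (partial_zbar ?b z) \<le> C2"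
    using test_bounded[OF test_partial(1)[OF tb]] test_bounded[OF test_partial(2)[OF tb]] by metis
  define X where "X n z = bump (of_real (inverse (real (Suc n))) * z)" for n z
  have n: "norm (of_real (inverse (real (Suc n))) * z) = norm z / real (Suc n)" for n and z :: complex
    unfolding norm_mult norm_of_real by (simp add: divide_inverse mult.commute)
  have P: "partial_z (\<lambda>z. of_real (X n z)) z = of_real (inverse (real (Suc n))) * partial_z ?b (of_real (inverse (real (Suc n))) * z)"
    "partial_zbar (\<lambda>z. of_real (X n z)) z = of_real (inverse (real (Suc n))) * partial_zbar ?b (of_real (inverse (real (Suc n))) * z)"
    for n z
    using pd_affine[of ?b 0 "inverse (real (Suc n))" z, OF test_differentiable[OF tb]]
    by (simp_all only: partial_z_pd partial_zbar_pd X_def add_0_left) (simp_all add: algebra_simps)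
  have const: "pd v (\<lambda>z. of_real (X n z)) z = 0" if "norm z < real (Suc n) \<or> norm z > 2 * real (Suc n)" for n z v
  proof (cases "norm z < real (Suc n)")
    case True
    show ?thesis
    proof (rule pd_locally_const[where S = "ball 0 (real (Suc n))" and c = 1])
      show "complex_of_real (X n w) = 1" if "w \<in> ball 0 (real (Suc n))" for w
      proof -
        have "norm (of_real (inverse (real (Suc n))) * w) \<le> 1" unfolding n using that by (simp add: field_simps)
        then show ?thesis using b(4) by (simp add: X_def)
      qed
    qed (use True in auto)
  next
    case False
    show ?thesis
    proof (rule pd_locally_const[where S = "- cball 0 (2 * real (Suc n))" and c = 0])
      show "complex_of_real (X n w) = 0" if "w \<in> - cball 0 (2 * real (Suc n))" for w
      proof -
        have "norm (of_real (inverse (real (Suc n))) * w) \<ge> 2" unfolding n using that by (simp add: field_simps)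
        then show ?thesis using b(5) by (simp add: X_def)
      qed
    qed (use False that in auto)
  qed
  show ?thesis
  proof (rule that[of X "max C1 C2"])
    fix n z
    show "test (\<lambda>z. of_real (X n z))"
      unfolding test_def
    proof (intro conjI exI[of _ "2 * real (Suc n)"] allI impI)
      show "smooth (\<lambda>z. of_real (X n z))"
        using smooth_affine[of ?b 0 "inverse (real (Suc n))"] tb by (simp add: X_def test_def)
      show "complex_of_real (X n w) = 0" if "norm w > 2 * real (Suc n)" for w
      proof -
        have "norm (of_real (inverse (real (Suc n))) * w) \<ge> 2" unfolding n using that by (simp add: field_simps)
        then show ?thesis using b(5) by (simp add: X_def)
      qed
    qed
    show "0 \<le> X n z" "X n z \<le> 1" using b by (auto simp: X_def)
    show "X n z = 1" if "norm z \<le> real (Suc n)"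
      unfolding X_def by (rule b(4), unfold n) (use that in \<open>simp add: field_simps\<close>)
    show "X n z = 0" if "norm z \<ge> 2 * real (Suc n)"
      unfolding X_def by (rule b(5), unfold n) (use that in \<open>simp add: field_simps\<close>)
    have le: "norm (of_real (inverse (real (Suc n))) * y) \<le> max C1 C2 / real (Suc n)"
      if "norm y \<le> max C1 C2" for y :: complex
      unfolding n using that by (simp add: divide_right_mono)
    show "norm (partial_z (\<lambda>z. of_real (X n z)) z) \<le> max C1 C2 / real (Suc n)"
      unfolding P by (intro le max.coboundedI1 C1)
    show "norm (partial_zbar (\<lambda>z. of_real (X n z)) z) \<le> max C1 C2 / real (Suc n)"
      unfolding P by (intro le max.coboundedI2 C2)
    show "partial_z (\<lambda>z. of_real (X n z)) z = 0" "partial_zbar (\<lambda>z. of_real (X n z)) z = 0"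
      if "norm z < real (Suc n) \<or> norm z > 2 * real (Suc n)"
      using const[OF that] by (simp_all add: partial_z_pd partial_zbar_pd)
  qed
qed

lemma measure_cball_complex: "r \<ge> 0 \<Longrightarrow> measure lborel (cball (0::complex) r) = pi * r\<^sup>2"
  using content_cball[of r "0::complex"] by (simp add: unit_ball_vol_2 measure_completion)

lemma l2_cutoff_gradient:
  assumes g: "g \<in> borel_measurable borel" and b: "\<And>z. norm (g z) \<le> C / r"
    and s: "\<And>z. norm z > 2 * r \<Longrightarrow> g z = 0" and r: "r > 0"
  shows "L2 g" "l2 g \<le> 4 * C"
proof -
  have C: "C \<ge> 0" using order.trans[OF norm_ge_zero b[of 0]] r by (simp add: zero_le_divide_iff)
  show L: "L2 g" using L2_bounded_support[OF g b s] .
  have "(l2 g)\<^sup>2 = (\<integral>z. (norm (g z))\<^sup>2 \<partial>lborel)" by (rule l2_power2)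
  also have "\<dots> \<le> (\<integral>z. (C / r)\<^sup>2 * indicator (cball 0 (2 * r)) (z::complex) \<partial>lborel)"
  proof (rule integral_mono)
    show "integrable lborel (\<lambda>z. (norm (g z))\<^sup>2)" using L by (simp add: L2_def)
    show "integrable lborel (\<lambda>z::complex. (C / r)\<^sup>2 * indicator (cball 0 (2 * r)) z :: real)"
      by (intro integrable_mult_right integrable_real_indicator)
         (auto intro!: emeasure_bounded_finite[OF bounded_cball, simplified])
    show "(norm (g z))\<^sup>2 \<le> (C / r)\<^sup>2 * indicator (cball 0 (2 * r)) z" for z
      using power_mono[OF b[of z] norm_ge_zero, of 2] s[of z] by (cases "norm z > 2 * r") auto
  qed
  also have "\<dots> = (C / r)\<^sup>2 * (pi * (2 * r)\<^sup>2)" using r by (simp add: measure_cball_complex)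
  also have "\<dots> = pi * (4 * C\<^sup>2)" using r by (simp add: power2_eq_square field_simps)
  also have "\<dots> \<le> 4 * (4 * C\<^sup>2)" using pi_less_4 by (intro mult_right_mono) auto
  also have "\<dots> = (4 * C)\<^sup>2" by (simp add: power2_eq_square)
  finally have sq: "(l2 g)\<^sup>2 \<le> (4 * C)\<^sup>2" .
  show "l2 g \<le> 4 * C" by (rule power2_le_imp_le[OF sq]) (use C in simp)
qed

lemma l2_tail_tendsto_0:
  assumes "L2 f" shows "(\<lambda>n. l2 (\<lambda>z. indicator {z::complex. norm z \<ge> real (Suc n)} z * f z)) \<longlonglongrightarrow> 0"
proof (rule l2_tendsto_0)
  show "integrable lborel (\<lambda>z. (norm (f z))\<^sup>2)" using assms by (simp add: L2_def)
  show "(\<lambda>z. indicator {z. norm z \<ge> real (Suc n)} z * f z) \<in> borel_measurable borel" for n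
    using assms by measurable
  show "(norm (indicator {z. norm z \<ge> real (Suc n)} z * f z))\<^sup>2 \<le> (norm (f z))\<^sup>2" for n z
    by (auto simp: indicator_def)
  show "AE z in lborel. (\<lambda>n. indicator {z. norm z \<ge> real (Suc n)} z * f z) \<longlonglongrightarrow> 0"
  proof (rule AE_I2)
    fix z :: complex
    have "\<forall>\<^sub>F n in sequentially. norm z < real (Suc n)"
      using eventually_ge_at_top[of "nat \<lceil>norm z\<rceil>"] by eventually_elim linarith
    then have "\<forall>\<^sub>F n in sequentially. indicator {z. norm z \<ge> real (Suc n)} z * f z = 0"
      by eventually_elim (auto simp: indicator_def)
    then show "(\<lambda>n. indicator {z. norm z \<ge> real (Suc n)} z * f z) \<longlonglongrightarrow> 0" by (rule tendsto_eventually)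
  qed
qed

lemma cutoff_pairing_tendsto:
  fixes X :: "nat \<Rightarrow> complex \<Rightarrow> real"
  assumes X: "\<And>n. (\<lambda>z. complex_of_real (X n z)) \<in> borel_measurable borel" "\<And>n z. 0 \<le> X n z" "\<And>n z. X n z \<le> 1"
    "\<And>n z. norm z \<le> real (Suc n) \<Longrightarrow> X n z = 1"
    and f: "integrable lborel f"
  shows "(\<lambda>n. \<integral>z. of_real (X n z) * f z \<partial>lborel) \<longlonglongrightarrow> (\<integral>z. (f z :: complex) \<partial>lborel)"
proof (rule integral_dominated_convergence[where w = "\<lambda>z. norm (f z)"])
  show "integrable lborel (\<lambda>z. norm (f z))" using f by simp
  show [measurable]: "f \<in> borel_measurable lborel" using f by simp
  show "(\<lambda>z. complex_of_real (X n z) * f z) \<in> borel_measurable lborel" for n using X(1)[of n] by measurable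
  show "AE z in lborel. norm (of_real (X n z) * f z) \<le> norm (f z)" for n
    using X(2,3) by (auto simp: norm_mult intro!: AE_I2 mult_left_le_one_le)
  show "AE z in lborel. (\<lambda>n. of_real (X n z) * f z) \<longlonglongrightarrow> f z"
  proof (rule AE_I2)
    fix z :: complex
    have "\<forall>\<^sub>F n in sequentially. norm z \<le> real (Suc n)"
      using eventually_ge_at_top[of "nat \<lceil>norm z\<rceil>"] by eventually_elim linarith
    then have "\<forall>\<^sub>F n in sequentially. of_real (X n z) * f z = f z"
      by eventually_elim (simp add: X(4))
    then show "(\<lambda>n. of_real (X n z) * f z) \<longlonglongrightarrow> f z" by (rule tendsto_eventually)
  qed
qed

text \<open>
  The cut-offs of the bounded function \<open>v\<close> contribute error terms \<open>\<integral> w v d X\<close> with \<open>w = u1\<close> or \<open>w = u2\<close>. Because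
  the gradients of the cut-offs are bounded in the mean and supported far out, these are controlled by the
  tails of the square-integrable function \<open>w\<close> and tend to zero.
\<close>

lemma bilinear_identity:
  assumes u: "weak_deriv u u1 u2" and v: "weak_deriv v v1 v2"
    and L: "L2 u1" "L2 u2" "L2 v1" "L2 v2" and B: "\<And>z. norm (v z) \<le> B"
  shows "(\<integral>z. u1 z * v2 z \<partial>lborel) = (\<integral>z. u2 z * v1 z \<partial>lborel)"
proof -
  obtain X C where X: "\<And>n. test (\<lambda>z. of_real (X n z))" "\<And>n z. 0 \<le> X n z" "\<And>n z. X n z \<le> 1"
    "\<And>n z. norm z \<le> real (Suc n) \<Longrightarrow> X n z = 1" "\<And>n z. norm z \<ge> 2 * real (Suc n) \<Longrightarrow> X n z = 0"
    and dX: "\<And>n z. norm (partial_z (\<lambda>z. of_real (X n z)) z) \<le> C / real (Suc n)"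
    "\<And>n z. norm (partial_zbar (\<lambda>z. of_real (X n z)) z) \<le> C / real (Suc n)"
    "\<And>n z. norm z < real (Suc n) \<or> norm z > 2 * real (Suc n) \<Longrightarrow> partial_z (\<lambda>z. of_real (X n z)) z = 0"
    "\<And>n z. norm z < real (Suc n) \<or> norm z > 2 * real (Suc n) \<Longrightarrow> partial_zbar (\<lambda>z. of_real (X n z)) z = 0"
    using cutoff_exists by blast
  define P where "P n = partial_z (\<lambda>z. complex_of_real (X n z))" for n
  define Q where "Q n = partial_zbar (\<lambda>z. complex_of_real (X n z))" for n
  have tPQ: "test (P n)" "test (Q n)" for n using test_partial[OF X(1)] by (auto simp: P_def Q_def)
  have small: "(\<lambda>n. \<integral>z. w z * (G n z * v z) \<partial>lborel) \<longlonglongrightarrow> 0"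
    if w: "L2 w" and G: "\<And>n. test (G n)" "\<And>n z. norm (G n z) \<le> C / real (Suc n)"
      "\<And>n z. norm z < real (Suc n) \<or> norm z > 2 * real (Suc n) \<Longrightarrow> G n z = 0" for w G
  proof (rule Lim_null_comparison[OF always_eventually])
    note [measurable] = test_measurable[OF G(1)] borel_measurable_continuous_onI[OF weak_derivD(1)[OF v]]
    show "\<forall>n. norm (\<integral>z. w z * (G n z * v z) \<partial>lborel) \<le>
        l2 (\<lambda>z. indicator {z. norm z \<ge> real (Suc n)} z * w z) * (4 * (C * \<bar>B\<bar>))"
    proof
      fix n
      have b: "norm (G n z * v z) \<le> C * \<bar>B\<bar> / real (Suc n)" for z
      proof -
        have "norm (G n z) * norm (v z) \<le> (C / real (Suc n)) * \<bar>B\<bar>"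
          using G(2)[of n z] B[of z] order.trans[OF norm_ge_zero G(2)[of n z]] by (intro mult_mono) auto
        then show ?thesis by (simp add: norm_mult)
      qed
      have L2n: "L2 (\<lambda>z. G n z * v z)" "l2 (\<lambda>z. G n z * v z) \<le> 4 * (C * \<bar>B\<bar>)"
        using l2_cutoff_gradient[of "\<lambda>z. G n z * v z" "C * \<bar>B\<bar>" "real (Suc n)"] b G(3) by auto
      have L2w: "L2 (\<lambda>z. indicator {z. norm z \<ge> real (Suc n)} z * w z)"
        by (rule L2_indicator[OF w]) measurable
      have "(\<lambda>z. w z * (G n z * v z)) = (\<lambda>z. (indicator {z. norm z \<ge> real (Suc n)} z * w z) * (G n z * v z))"
        using G(3)[where n = n] by (auto simp: fun_eq_iff indicator_def simp del: of_nat_Suc)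
      then have "norm (\<integral>z. w z * (G n z * v z) \<partial>lborel) \<le>
          l2 (\<lambda>z. indicator {z. norm z \<ge> real (Suc n)} z * w z) * l2 (\<lambda>z. G n z * v z)"
        using L2_Cauchy_Schwarz[OF L2w L2n(1)] by simp
      also have "\<dots> \<le> l2 (\<lambda>z. indicator {z. norm z \<ge> real (Suc n)} z * w z) * (4 * (C * \<bar>B\<bar>))"
        using L2n(2) by (intro mult_left_mono) auto
      finally show "norm (\<integral>z. w z * (G n z * v z) \<partial>lborel) \<le>
          l2 (\<lambda>z. indicator {z. norm z \<ge> real (Suc n)} z * w z) * (4 * (C * \<bar>B\<bar>))" .
    qed
    show "(\<lambda>n. l2 (\<lambda>z. indicator {z. norm z \<ge> real (Suc n)} z * w z) * (4 * (C * \<bar>B\<bar>))) \<longlonglongrightarrow> 0"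
      using tendsto_mult[OF l2_tail_tendsto_0[OF w] tendsto_const] by simp
  qed
  have small1: "(\<lambda>n. \<integral>z. u1 z * (Q n z * v z) \<partial>lborel) \<longlonglongrightarrow> 0"
    by (rule small[OF L(1) tPQ(2)]) (use dX in \<open>auto simp: Q_def\<close>)
  have small2: "(\<lambda>n. \<integral>z. u2 z * (P n z * v z) \<partial>lborel) \<longlonglongrightarrow> 0"
    by (rule small[OF L(2) tPQ(1)]) (use dX in \<open>auto simp: P_def\<close>)
  have i12: "integrable lborel (\<lambda>z. u1 z * v2 z)" "integrable lborel (\<lambda>z. u2 z * v1 z)"
    using L by (auto intro: L2_mult_integrable)
  have lim1: "(\<lambda>n. \<integral>z. of_real (X n z) * (u1 z * v2 z) \<partial>lborel) \<longlonglongrightarrow> (\<integral>z. u1 z * v2 z \<partial>lborel)"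
    using X(2,3,4) test_measurable[OF X(1)] by (intro cutoff_pairing_tendsto i12)
  have lim2: "(\<lambda>n. \<integral>z. of_real (X n z) * (u2 z * v1 z) \<partial>lborel) \<longlonglongrightarrow> (\<integral>z. u2 z * v1 z \<partial>lborel)"
    using X(2,3,4) test_measurable[OF X(1)] by (intro cutoff_pairing_tendsto i12)
  have eq: "(\<integral>z. of_real (X n z) * (u1 z * v2 z) \<partial>lborel) + (\<integral>z. u1 z * (Q n z * v z) \<partial>lborel)
     = (\<integral>z. of_real (X n z) * (u2 z * v1 z) \<partial>lborel) + (\<integral>z. u2 z * (P n z * v z) \<partial>lborel)" for n
  proof -
    have sX: "smooth (\<lambda>z. of_real (X n z))" using X(1) by (simp add: test_def)
    have w: "weak_deriv (\<lambda>z. of_real (X n z) * v z) (\<lambda>z. of_real (X n z) * v1 z + P n z * v z)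
        (\<lambda>z. of_real (X n z) * v2 z + Q n z * v z)"
      using weak_deriv_mult_smooth[OF v sX] by (simp add: P_def Q_def)
    have z: "of_real (X n z) = (0::complex)" "P n z = 0" "Q n z = 0" if "norm z > 2 * real (Suc n)" for z
      using that X(5)[of n z] dX(3,4)[of z n] by (auto simp: P_def Q_def)
    have bc: "(\<integral>z. u1 z * (of_real (X n z) * v2 z + Q n z * v z) \<partial>lborel) =
        (\<integral>z. u2 z * (of_real (X n z) * v1 z + P n z * v z) \<partial>lborel)"
      by (rule bilinear_identity_compact[OF u w, of "2 * real (Suc n)"]) (simp_all add: z del: of_nat_Suc)
    have cv: "continuous_on UNIV v" by (rule weak_derivD(1)[OF v])
    have i: "integrable lborel (\<lambda>z. of_real (X n z) * (u1 z * v2 z))" "integrable lborel (\<lambda>z. of_real (X n z) * (u2 z * v1 z))"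
    proof -
      have *: "integrable lborel (\<lambda>z. of_real (X n z) * f z)" if "integrable lborel f" for f :: "complex \<Rightarrow> complex"
      proof (rule Bochner_Integration.integrable_bound[OF that])
        show "(\<lambda>z. complex_of_real (X n z) * f z) \<in> borel_measurable lborel"
          using test_measurable[OF X(1)[of n]] borel_measurable_integrable[OF that] by measurable
        show "AE z in lborel. norm (of_real (X n z) * f z) \<le> norm (f z)"
          using X(2,3) by (auto simp: norm_mult intro!: AE_I2 mult_left_le_one_le)
      qed
      show "integrable lborel (\<lambda>z. of_real (X n z) * (u1 z * v2 z))" "integrable lborel (\<lambda>z. of_real (X n z) * (u2 z * v1 z))"
        using * i12 by auto
    qed
    have j: "integrable lborel (\<lambda>z. u1 z * (Q n z * v z))" "integrable lborel (\<lambda>z. u2 z * (P n z * v z))"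
      using L2_loc_test_integrable[OF L2_loc_mult_continuous[OF L2_imp_L2_loc[OF L(1)] cv] tPQ(2)]
        L2_loc_test_integrable[OF L2_loc_mult_continuous[OF L2_imp_L2_loc[OF L(2)] cv] tPQ(1)]
      by (simp_all add: mult_ac)
    have "(\<integral>z. u1 z * (of_real (X n z) * v2 z + Q n z * v z) \<partial>lborel) =
        (\<integral>z. of_real (X n z) * (u1 z * v2 z) + u1 z * (Q n z * v z) \<partial>lborel)"
      by (simp add: algebra_simps)
    moreover have "(\<integral>z. u2 z * (of_real (X n z) * v1 z + P n z * v z) \<partial>lborel) =
        (\<integral>z. of_real (X n z) * (u2 z * v1 z) + u2 z * (P n z * v z) \<partial>lborel)"
      by (simp add: algebra_simps)
    ultimately show ?thesis using bc i j by simp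
  qed
  have "(\<lambda>n. (\<integral>z. of_real (X n z) * (u1 z * v2 z) \<partial>lborel) + (\<integral>z. u1 z * (Q n z * v z) \<partial>lborel))
      \<longlonglongrightarrow> (\<integral>z. u1 z * v2 z \<partial>lborel) + 0"
    by (intro tendsto_add lim1 small1)
  moreover have "(\<lambda>n. (\<integral>z. of_real (X n z) * (u1 z * v2 z) \<partial>lborel) + (\<integral>z. u1 z * (Q n z * v z) \<partial>lborel))
      \<longlonglongrightarrow> (\<integral>z. u2 z * v1 z \<partial>lborel) + 0"
    unfolding eq by (intro tendsto_add lim2 small2)
  ultimately show ?thesis using LIMSEQ_unique by fastforce
qed

section \<open>Lipschitz functions\<close>

lemma lipschitz_of_bounded_derivative:
  fixes \<psi> :: "complex \<Rightarrow> complex"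
  assumes D: "\<And>z. (\<psi> has_derivative D z) (at z)" and b: "\<And>z h. norm (D z h) \<le> L * norm h" and "L \<ge> 0"
  shows "L-lipschitz_on UNIV \<psi>"
proof (rule lipschitz_onI)
  fix x y :: complex
  have "norm (\<psi> x - \<psi> y) \<le> L * norm (x - y)"
    by (rule differentiable_bound[where S = UNIV and f' = D]) (use D b in \<open>auto intro!: onorm_le\<close>)
  then show "dist (\<psi> x) (\<psi> y) \<le> L * dist x y" by (simp add: dist_norm)
qed fact

lemma test_lipschitz:
  assumes "test \<phi>" obtains L where "L-lipschitz_on UNIV \<phi>"
proof -
  obtain B1 B2 where B: "\<And>z. norm (pd 1 \<phi> z) \<le> B1" "\<And>z. norm (pd \<i> \<phi> z) \<le> B2"
    using test_bounded[OF test_pd[OF assms]] by metis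
  have d: "\<phi> differentiable (at z)" for z using test_differentiable[OF assms] .
  have "norm (pd h \<phi> z) \<le> (B1 + B2) * norm h" for z h
  proof -
    have "norm (pd h \<phi> z) \<le> \<bar>Re h\<bar> * norm (pd 1 \<phi> z) + \<bar>Im h\<bar> * norm (pd \<i> \<phi> z)"
      unfolding pd_expand[OF d, of h] by (rule order.trans[OF norm_triangle_ineq]) simp
    also have "\<dots> \<le> norm h * B1 + norm h * B2"
      by (intro add_mono mult_mono abs_Re_le_cmod abs_Im_le_cmod B) auto
    finally show ?thesis by (simp add: algebra_simps)
  qed
  moreover have "B1 + B2 \<ge> 0" using order.trans[OF norm_ge_zero B(1)] order.trans[OF norm_ge_zero B(2)] by simp
  ultimately have "(B1 + B2)-lipschitz_on UNIV \<phi>"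
    by (intro lipschitz_of_bounded_derivative[OF pd_works[OF d]]) auto
  then show ?thesis by (rule that)
qed

lemma lipschitz_mult_bounded:
  fixes f g :: "complex \<Rightarrow> complex"
  assumes f: "L-lipschitz_on S f" and g: "M-lipschitz_on S g"
    and bf: "\<And>z. z \<in> S \<Longrightarrow> norm (f z) \<le> A" and bg: "\<And>z. z \<in> S \<Longrightarrow> norm (g z) \<le> B"
    and "A \<ge> 0" "B \<ge> 0"
  shows "(A * M + B * L)-lipschitz_on S (\<lambda>z. f z * g z)"
proof (rule lipschitz_onI)
  fix x y assume xy: "x \<in> S" "y \<in> S"
  have "f x * g x - f y * g y = f x * (g x - g y) + g y * (f x - f y)" by (simp add: algebra_simps)
  then have "norm (f x * g x - f y * g y) \<le> norm (f x) * norm (g x - g y) + norm (g y) * norm (f x - f y)"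
    by (metis norm_mult norm_triangle_ineq)
  also have "\<dots> \<le> A * (M * norm (x - y)) + B * (L * norm (x - y))"
    using bf bg xy lipschitz_on_normD[OF f] lipschitz_on_normD[OF g] assms(5,6)
    by (intro add_mono mult_mono) auto
  finally show "dist (f x * g x) (f y * g y) \<le> (A * M + B * L) * dist x y"
    by (simp add: dist_norm algebra_simps)
qed (use assms lipschitz_on_nonneg[OF f] lipschitz_on_nonneg[OF g] in auto)

text \<open>
  The two Wirtinger coefficients are combinations of the derivatives in the directions \<open>1\<close> and \<open>\<i>\<close>.
\<close>

lemma integral_wirtinger_eq_0:
  assumes lip: "L-lipschitz_on UNIV \<psi>"
    and supp: "\<And>z. norm z > R \<Longrightarrow> \<psi> z = 0"
    and N: "N \<in> null_sets lborel"
    and D: "\<And>z. z \<notin> N \<Longrightarrow> (\<psi> has_derivative (\<lambda>h. a z * h + b z * cnj h)) (at z)"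
    and m: "a \<in> borel_measurable borel" "b \<in> borel_measurable borel"
  shows "integrable lborel a" "(\<integral>z. a z \<partial>lborel) = 0" "integrable lborel b" "(\<integral>z. b z \<partial>lborel) = 0"
proof -
  have *: "integrable lborel (\<lambda>z. a z * v + b z * cnj v)" "(\<integral>z. a z * v + b z * cnj v \<partial>lborel) = 0" for v
    using integral_derivative_eq_0[OF lip supp N D, where v = v] m by auto
  have a: "a = (\<lambda>z. (1 / 2) * ((a z * 1 + b z * cnj 1) + (- \<i>) * (a z * \<i> + b z * cnj \<i>)))"
    by (auto simp: fun_eq_iff algebra_simps)
  have b: "b = (\<lambda>z. (1 / 2) * ((a z * 1 + b z * cnj 1) + \<i> * (a z * \<i> + b z * cnj \<i>)))"
    by (auto simp: fun_eq_iff algebra_simps)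
  show "integrable lborel a"
    by (subst a) (intro integrable_mult_right Bochner_Integration.integrable_add *)
  show "integrable lborel b"
    by (subst b) (intro integrable_mult_right Bochner_Integration.integrable_add *)
  show "(\<integral>z. a z \<partial>lborel) = 0"
    by (subst a, subst integral_mult_right_zero, subst Bochner_Integration.integral_add)
       (intro integrable_mult_right *, intro integrable_mult_right *, simp only: integral_mult_right_zero * mult_zero_right add_0_left)
  show "(\<integral>z. b z \<partial>lborel) = 0"
    by (subst b, subst integral_mult_right_zero, subst Bochner_Integration.integral_add)
       (intro integrable_mult_right *, intro integrable_mult_right *, simp only: integral_mult_right_zero * mult_zero_right add_0_left)
qed

lemma wirtinger_of_differentiable:
  assumes "f differentiable (at z)"
  shows "(f has_derivative (\<lambda>h. partial_z f z * h + partial_zbar f z * cnj h)) (at z)"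
proof -
  have "pd h f z = partial_z f z * h + partial_zbar f z * cnj h" for h
  proof -
    have "partial_z f z * h + partial_zbar f z * cnj h =
        (1 / 2) * pd 1 f z * (h + cnj h) - (\<i> / 2) * pd \<i> f z * (h - cnj h)"
      by (simp add: partial_z_pd partial_zbar_pd field_simps)
    also have "\<dots> = Re h *\<^sub>R pd 1 f z + Im h *\<^sub>R pd \<i> f z"
      unfolding complex_add_cnj complex_diff_cnj by (simp add: scaleR_conv_of_real algebra_simps)
    finally show ?thesis using pd_expand[OF assms, of h] by simp
  qed
  then show ?thesis using pd_works[OF assms] by simp
qed

text \<open>
  For a Lipschitz function the derivatives that exist off a null set are the weak ones: the product with a test
  function is again Lipschitz, and its derivatives integrate to zero.
\<close>

lemma weak_deriv_lipschitz:
  assumes lip: "L-lipschitz_on UNIV v" and B: "\<And>z. norm (v z) \<le> B"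
    and N: "N \<in> null_sets lborel"
    and D: "\<And>z. z \<notin> N \<Longrightarrow> (v has_derivative (\<lambda>h. v1 z * h + v2 z * cnj h)) (at z)"
    and L2: "L2_loc v1" "L2_loc v2"
  shows "weak_deriv v v1 v2"
  unfolding weak_deriv_def
proof (intro conjI allI impI)
  show c: "continuous_on UNIV v" using lip by (rule lipschitz_on_continuous_on)
  fix \<phi> assume \<phi>: "test \<phi>"
  obtain R where R: "\<And>z. norm z > R \<Longrightarrow> \<phi> z = 0" using \<phi> by (auto simp: test_def)
  obtain M where M: "M-lipschitz_on UNIV \<phi>" using test_lipschitz[OF \<phi>] .
  obtain A where A: "\<And>z. norm (\<phi> z) \<le> A" using test_bounded[OF \<phi>] by blast
  have pos: "A \<ge> 0" "B \<ge> 0" using order.trans[OF norm_ge_zero A] order.trans[OF norm_ge_zero B] by auto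
  note [measurable] = L2_loc_measurable[OF L2(1)] L2_loc_measurable[OF L2(2)]
    borel_measurable_continuous_onI[OF c] test_measurable[OF \<phi>]
    test_measurable[OF test_partial(1)[OF \<phi>]] test_measurable[OF test_partial(2)[OF \<phi>]]
  have lipm: "(B * M + A * L)-lipschitz_on UNIV (\<lambda>z. v z * \<phi> z)"
    using lip M B A pos by (intro lipschitz_mult_bounded) auto
  have der: "((\<lambda>z. v z * \<phi> z) has_derivative
     (\<lambda>h. (v z * partial_z \<phi> z + v1 z * \<phi> z) * h + (v z * partial_zbar \<phi> z + v2 z * \<phi> z) * cnj h)) (at z)"
    if "z \<notin> N" for z
    by (rule has_derivative_eq_rhs[OF has_derivative_mult[OF D[OF that] wirtinger_of_differentiable[OF test_differentiable[OF \<phi>]]]])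
       (simp add: fun_eq_iff algebra_simps)
  have supp: "v z * \<phi> z = 0" if "norm z > R" for z using R[OF that] by simp
  have Lv: "L2_loc v" using c by (rule L2_loc_continuous)
  note i = L2_loc_test_integrable[OF Lv test_partial(1)[OF \<phi>]] L2_loc_test_integrable[OF Lv test_partial(2)[OF \<phi>]]
    L2_loc_test_integrable[OF L2(1) \<phi>] L2_loc_test_integrable[OF L2(2) \<phi>]
  have "(\<integral>z. v z * partial_z \<phi> z + v1 z * \<phi> z \<partial>lborel) = 0" "(\<integral>z. v z * partial_zbar \<phi> z + v2 z * \<phi> z \<partial>lborel) = 0"
    using integral_wirtinger_eq_0(2,4)[OF lipm supp N der] by auto
  then show "(\<integral>z. v z * partial_z \<phi> z \<partial>lborel) = - (\<integral>z. v1 z * \<phi> z \<partial>lborel)"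
    "(\<integral>z. v z * partial_zbar \<phi> z \<partial>lborel) = - (\<integral>z. v2 z * \<phi> z \<partial>lborel)"
    using i by (simp_all add: add_eq_0_iff2)
qed (use L2 in auto)

section \<open>Sewing along the unit circle\<close>

definition fold_disc :: "complex \<Rightarrow> complex" where
  "fold_disc z = (if norm z \<le> 1 then z else 1 / cnj z)"

lemma norm_fold_disc: "norm (fold_disc z) \<le> 1"
  by (auto simp: fold_disc_def norm_divide divide_simps)

text \<open>
  The identity \<open>\<bar>1 - z cnj w\<bar>\<^sup>2 = \<bar>z - w\<bar>\<^sup>2 + (1 - \<bar>z\<bar>\<^sup>2) (1 - \<bar>w\<bar>\<^sup>2)\<close> has a last term that is not positive when
  \<open>z\<close> lies inside and \<open>w\<close> outside of the disc.
\<close>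

lemma fold_disc_mixed:
  assumes "norm z \<le> 1" "norm w > 1"
  shows "norm (z - 1 / cnj w) \<le> norm (z - w)"
proof -
  have w: "w \<noteq> 0" using assms by auto
  have "(norm (1 - z * cnj w))\<^sup>2 = (norm (z - w))\<^sup>2 + (1 - (norm z)\<^sup>2) * (1 - (norm w)\<^sup>2)"
    unfolding cmod_power2 by (simp add: power2_eq_square algebra_simps)
  also have "\<dots> \<le> (norm (z - w))\<^sup>2"
    using assms by (simp add: mult_le_0_iff abs_square_le_1 power_le_one one_le_power)
  finally have sq: "(norm (1 - z * cnj w))\<^sup>2 \<le> (norm (z - w))\<^sup>2" .
  have 1: "norm (1 - z * cnj w) \<le> norm (z - w)" by (rule power2_le_imp_le[OF sq]) simp
  have "z - 1 / cnj w = (z * cnj w - 1) / cnj w" using w by (simp add: field_simps)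
  then have "norm (z - 1 / cnj w) = norm (1 - z * cnj w) / norm w"
    by (simp add: norm_divide norm_minus_commute)
  also have "\<dots> \<le> norm (1 - z * cnj w)" using assms by (simp add: divide_le_eq mult_le_cancel_left1)
  finally show ?thesis using 1 by linarith
qed

lemma fold_disc_nonexpansive: "norm (fold_disc z - fold_disc w) \<le> norm (z - w)"
proof -
  consider "norm z \<le> 1" "norm w \<le> 1" | "norm z \<le> 1" "norm w > 1" | "norm z > 1" "norm w \<le> 1" | "norm z > 1" "norm w > 1"
    by linarith
  then show ?thesis
  proof cases
    case 2
    then show ?thesis using fold_disc_mixed[of z w] by (simp add: fold_disc_def)
  next
    case 3
    then show ?thesis using fold_disc_mixed[of w z] by (simp add: fold_disc_def norm_minus_commute)
  next
    case 4
    then have nz: "z \<noteq> 0" "w \<noteq> 0" by auto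
    have "1 / cnj z - 1 / cnj w = cnj (w - z) / (cnj z * cnj w)" using nz by (simp add: field_simps)
    then have "norm (1 / cnj z - 1 / cnj w) = norm (z - w) / (norm z * norm w)"
      by (simp add: norm_divide norm_mult norm_minus_commute flip: complex_cnj_diff)
    also have "\<dots> \<le> norm (z - w)"
    proof -
      have "1 \<le> norm z * norm w" using 4 by (simp add: less_imp_le mult_ge1_I)
      then show ?thesis using nz by (simp add: divide_le_eq mult_le_cancel_left1)
    qed
    finally show ?thesis using 4 by (simp add: fold_disc_def)
  qed (simp add: fold_disc_def)
qed

text \<open>
  On the unit circle the analytic function \<open>z / (1 - p z)\<close> coincides with the complex conjugate of \<open>1 / (z - p)\<close>.
  Sewing the two along the circle gives a bounded Lipschitz function that is analytic inside and antianalytic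
  outside. It replaces integration along the circle: orthogonality to the derivative of \<open>1 / (z - p)\<close> on
  the exterior becomes an instance of the bilinear identity.
\<close>

definition sewn :: "real \<Rightarrow> complex \<Rightarrow> complex" where
  "sewn p z = (if norm z \<le> 1 then z / (1 - of_real p * z) else 1 / (cnj z - of_real p))"

text \<open>
  The Wirtinger derivatives of \<open>sewn p\<close> off the unit circle. The value \<open>sewn_zbar p z\<close> for \<open>\<bar>z\<bar> > 1\<close> is the conjugate of
  the derivative of \<open>1 / (z - p)\<close>.
\<close>

definition sewn_z :: "real \<Rightarrow> complex \<Rightarrow> complex" where
  "sewn_z p z = (if norm z < 1 then 1 / (1 - of_real p * z)\<^sup>2 else 0)"

definition sewn_zbar :: "real \<Rightarrow> complex \<Rightarrow> complex" where
  "sewn_zbar p z = (if norm z > 1 then - 1 / (cnj z - of_real p)\<^sup>2 else 0)"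

lemma denominator_disc:
  fixes w :: complex
  assumes "0 \<le> p" "norm w \<le> 1" shows "1 - p \<le> norm (1 - of_real p * w)"
proof -
  have "norm (of_real p * w) \<le> p * 1" using assms by (simp add: norm_mult mult_left_le)
  then show ?thesis using norm_triangle_ineq2[of 1 "of_real p * w"] by simp
qed

lemma denominator_exterior:
  fixes z :: complex
  assumes "0 \<le> p" "norm z \<ge> 1" shows "(1 - p) * norm z \<le> norm (cnj z - of_real p)"
proof -
  have "p \<le> p * norm z" using assms by (simp add: mult_le_cancel_left1)
  then show ?thesis using norm_triangle_ineq2[of "cnj z" "of_real p"] assms by (simp add: algebra_simps)
qed

text \<open>
  This form makes boundedness and the Lipschitz property of \<open>sewn p\<close> evident.
\<close>

lemma sewn_fold:
  "sewn p z = fold_disc z / (1 - of_real p * fold_disc z)"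
proof (cases "norm z \<le> 1")
  case False
  then have "z \<noteq> 0" by auto
  then show ?thesis using False by (simp add: sewn_def fold_disc_def divide_simps)
qed (simp add: sewn_def fold_disc_def)

lemma sewn_bounded:
  assumes "0 \<le> p" "p < 1" shows "norm (sewn p z) \<le> 1 / (1 - p)"
  unfolding sewn_fold norm_divide
  using denominator_disc[OF assms(1) norm_fold_disc, of z] assms norm_fold_disc[of z]
  by (intro frac_le) auto

lemma sewn_lipschitz:
  assumes p: "0 \<le> p" "p < 1" shows "(1 / (1 - p)\<^sup>2)-lipschitz_on UNIV (sewn p)"
proof (rule lipschitz_onI)
  fix z w :: complex
  let ?a = "fold_disc z" and ?b = "fold_disc w"
  have d: "1 - p \<le> norm (1 - of_real p * ?a)" "1 - p \<le> norm (1 - of_real p * ?b)"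
    using denominator_disc[OF p(1)] norm_fold_disc by auto
  then have nz: "1 - of_real p * ?a \<noteq> 0" "1 - of_real p * ?b \<noteq> 0" using p by auto
  have "sewn p z - sewn p w = (?a - ?b) / ((1 - of_real p * ?a) * (1 - of_real p * ?b))"
    unfolding sewn_fold using nz by (simp add: field_simps)
  then have "norm (sewn p z - sewn p w) = norm (?a - ?b) / (norm (1 - of_real p * ?a) * norm (1 - of_real p * ?b))"
    by (simp add: norm_divide norm_mult)
  also have "\<dots> \<le> norm (z - w) / ((1 - p) * (1 - p))"
    using d p by (intro frac_le mult_mono fold_disc_nonexpansive) auto
  finally show "dist (sewn p z) (sewn p w) \<le> 1 / (1 - p)\<^sup>2 * dist z w"
    by (simp add: dist_norm power2_eq_square)
qed simp

lemma sewn_has_derivative: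
  assumes p: "0 \<le> p" "p < 1" and z: "norm z \<noteq> 1"
  shows "(sewn p has_derivative (\<lambda>h. sewn_z p z * h + sewn_zbar p z * cnj h)) (at z)"
proof (cases "norm z < 1")
  case True
  have nz: "1 - of_real p * z \<noteq> 0" using denominator_disc[OF p(1), of z] True p by auto
  have "((\<lambda>z. z / (1 - of_real p * z)) has_field_derivative 1 / (1 - of_real p * z)\<^sup>2) (at z)"
    using nz by (auto intro!: derivative_eq_intros simp: power2_eq_square divide_simps)
  moreover have "(*) (1 / (1 - of_real p * z)\<^sup>2) = (\<lambda>h. sewn_z p z * h + sewn_zbar p z * cnj h)"
    using True by (auto simp: fun_eq_iff sewn_z_def sewn_zbar_def)
  ultimately have "((\<lambda>z. z / (1 - of_real p * z)) has_derivative (\<lambda>h. sewn_z p z * h + sewn_zbar p z * cnj h)) (at z)"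
    unfolding has_field_derivative_def by simp
  then show ?thesis
    by (rule has_derivative_transform_within_open[OF _ open_ball[of 0 1]]) (use True in \<open>auto simp: sewn_def\<close>)
next
  case False
  then have z1: "norm z > 1" using z by simp
  have nz: "cnj z - of_real p \<noteq> 0" using denominator_exterior[OF p(1), of z] z1 p by (auto simp: mult_le_0_iff)
  have "((\<lambda>w. 1 / (w - of_real p)) has_field_derivative - 1 / (cnj z - of_real p)\<^sup>2) (at (cnj z))"
    using nz by (auto intro!: derivative_eq_intros simp: power2_eq_square divide_simps)
  then have 1: "((\<lambda>w. 1 / (w - of_real p)) has_derivative (*) (- 1 / (cnj z - of_real p)\<^sup>2)) (at (cnj z))"
    by (simp only: has_field_derivative_def)
  have 2: "(cnj has_derivative cnj) (at z)" using has_derivative_cnj[OF has_derivative_ident] .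
  have "((\<lambda>z. 1 / (cnj z - of_real p)) has_derivative (\<lambda>h. sewn_z p z * h + sewn_zbar p z * cnj h)) (at z)"
    using has_derivative_compose[OF 2 1] z1 by (simp add: sewn_z_def sewn_zbar_def)
  then show ?thesis
    by (rule has_derivative_transform_within_open[OF _ open_Compl[OF closed_cball[of 0 1]]]) (use z1 in \<open>auto simp: sewn_def\<close>)
qed

lemma sewn_partials_measurable [measurable]:
  "sewn_z p \<in> borel_measurable borel" "sewn_zbar p \<in> borel_measurable borel"
  unfolding sewn_z_def sewn_zbar_def by measurable

lemma L2_sewn_z: assumes "0 \<le> p" "p < 1" shows "L2 (sewn_z p)"
proof (rule L2_bounded_support[where B = "1 / (1 - p)\<^sup>2" and R = 1])
  fix z
  show "norm (sewn_z p z) \<le> 1 / (1 - p)\<^sup>2"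
  proof (cases "norm z < 1")
    case True
    then show ?thesis using denominator_disc[OF assms(1), of z] assms
      by (auto simp: sewn_z_def norm_divide norm_power intro!: frac_le power_mono)
  qed (simp add: sewn_z_def)
qed (auto simp: sewn_z_def)

lemma measure_ball_complex: "r \<ge> 0 \<Longrightarrow> emeasure lborel (cball (0::complex) r) = ennreal (pi * r\<^sup>2)"
  using measure_cball_complex[of r] emeasure_bounded_finite[OF bounded_cball, of "0::complex" r]
  by (simp add: emeasure_eq_ennreal_measure)

lemma inverse_square_dyadic:
  assumes "x > (1::real)" obtains n where "x \<le> 2 ^ Suc n" "1 / x ^ 4 \<le> (1 / 16) ^ n"
proof -
  define n where "n = (LEAST n. x \<le> 2 ^ Suc n)"
  obtain m where "x < 2 ^ m" using real_arch_pow[of 2 x] by auto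
  moreover have "(2::real) ^ m \<le> 2 ^ Suc m" by (rule power_increasing) auto
  ultimately have "x \<le> 2 ^ Suc m" by linarith
  then have 1: "x \<le> 2 ^ Suc n" unfolding n_def by (rule LeastI)
  have 2: "2 ^ n \<le> x"
  proof (cases n)
    case (Suc k)
    then have "\<not> x \<le> 2 ^ Suc k" using not_less_Least[of k "\<lambda>n. x \<le> 2 ^ Suc n"] by (simp add: n_def)
    then show ?thesis using Suc by simp
  qed (use assms in simp)
  have "((2::real) ^ n) ^ 4 = (2 ^ 4) ^ n" by (simp only: power_mult[symmetric] mult.commute)
  then have "(16::real) ^ n = (2 ^ n) ^ 4" by simp
  also have "\<dots> \<le> x ^ 4" using 2 by (intro power_mono) auto
  finally have "1 / x ^ 4 \<le> 1 / 16 ^ n" by (intro frac_le) auto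
  then show ?thesis using that[OF 1] by (simp add: power_one_over)
qed

text \<open>
  On the dyadic annulus \<open>2 ^ n \<le> \<bar>z\<bar> \<le> 2 ^ (n + 1)\<close> the squared modulus of the function is at most \<open>16 ^ (- n)\<close>, and the
  annulus has area at most \<open>4 \<pi> 4 ^ n\<close>.
\<close>

lemma L2_inverse_square_exterior: "L2 (\<lambda>z. if norm z > 1 then 1 / z\<^sup>2 else 0)"
  unfolding L2_def
proof
  show [measurable]: "(\<lambda>z::complex. if norm z > 1 then 1 / z\<^sup>2 else 0) \<in> borel_measurable borel" by measurable
  let ?f = "\<lambda>z::complex. (norm (if norm z > 1 then 1 / z\<^sup>2 else 0))\<^sup>2"
  show "integrable lborel ?f"
  proof (rule integrableI_bounded)
    have le: "ennreal (norm (?f z)) \<le> (\<Sum>n. ennreal ((1 / 16) ^ n) * indicator (cball 0 (2 ^ Suc n)) z)" for z :: complex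
    proof (cases "norm z > 1")
      case True
      obtain n where n: "norm z \<le> 2 ^ Suc n" "1 / norm z ^ 4 \<le> (1 / 16) ^ n" using inverse_square_dyadic[OF True] .
      have "ennreal (norm (?f z)) = ennreal (1 / norm z ^ 4)"
        using True by (simp add: norm_divide norm_power power_divide flip: power_mult)
      also have "\<dots> \<le> ennreal ((1 / 16) ^ n) * indicator (cball 0 (2 ^ Suc n)) z"
        using n by (simp add: ennreal_leI)
      also have "\<dots> \<le> (\<Sum>n. ennreal ((1 / 16) ^ n) * indicator (cball 0 (2 ^ Suc n)) z)"
      proof -
        have "t n \<le> (\<Sum>n. t n)" for t :: "nat \<Rightarrow> ennreal"
          using sum_le_suminf[of t "{n}"] by simp
        then show ?thesis .
      qed
      finally show ?thesis .
    qed auto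
    have "(\<integral>\<^sup>+z. ennreal (norm (?f z)) \<partial>lborel) \<le>
        (\<integral>\<^sup>+z. (\<Sum>n. ennreal ((1 / 16) ^ n) * indicator (cball 0 (2 ^ Suc n)) z) \<partial>(lborel :: complex measure))"
      by (intro nn_integral_mono le)
    also have "\<dots> = (\<Sum>n. \<integral>\<^sup>+z. ennreal ((1 / 16) ^ n) * indicator (cball 0 (2 ^ Suc n)) z \<partial>(lborel :: complex measure))"
      using borel_closed[OF closed_cball, measurable] by (intro nn_integral_suminf) measurable
    also have "\<dots> = (\<Sum>n. ennreal ((4 * pi) * (1 / 4) ^ n))"
    proof (rule suminf_cong)
      fix n
      have "(\<integral>\<^sup>+z. ennreal ((1 / 16) ^ n) * indicator (cball 0 (2 ^ Suc n)) z \<partial>(lborel :: complex measure))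
          = ennreal ((1 / 16) ^ n) * ennreal (pi * (2 ^ Suc n)\<^sup>2)"
        by (subst nn_integral_cmult_indicator) (simp_all add: measure_ball_complex del: power_Suc)
      also have "\<dots> = ennreal ((1 / 16) ^ n * (pi * (2 ^ Suc n)\<^sup>2))" by (simp add: ennreal_mult)
      also have "(1 / 16) ^ n * (pi * (2 ^ Suc n)\<^sup>2) = (4 * pi) * (1 / 4) ^ n"
      proof -
        have "(2 ^ Suc n)\<^sup>2 = ((2::real)\<^sup>2) ^ Suc n" by (simp only: power_mult[symmetric] mult.commute)
        then have *: "(2 ^ Suc n)\<^sup>2 = (4::real) * 4 ^ n" by simp
        have "(1 / 16) ^ n * 4 ^ n = (1 / 4 :: real) ^ n" unfolding power_mult_distrib[symmetric] by simp
        then show ?thesis unfolding * by (metis mult.assoc mult.commute)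
      qed
      finally show "(\<integral>\<^sup>+z. ennreal ((1 / 16) ^ n) * indicator (cball 0 (2 ^ Suc n)) z \<partial>(lborel :: complex measure))
          = ennreal ((4 * pi) * (1 / 4) ^ n)" .
    qed
    also have "\<dots> < \<infinity>"
      by (subst suminf_ennreal2) (auto intro!: summable_mult summable_geometric)
    finally show "(\<integral>\<^sup>+z. ennreal (norm (?f z)) \<partial>lborel) < \<infinity>" .
  qed measurable
qed

lemma L2_sewn_zbar: assumes "0 \<le> p" "p < 1" shows "L2 (sewn_zbar p)"
proof (rule L2_bound[OF L2_inverse_square_exterior, where B = "1 / (1 - p)\<^sup>2"])
  fix z
  show "norm (sewn_zbar p z) \<le> 1 / (1 - p)\<^sup>2 * norm (if norm z > 1 then 1 / z\<^sup>2 else 0)"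
  proof (cases "norm z > 1")
    case True
    then have nz: "norm z > 0" by linarith
    have "1 / (norm (cnj z - of_real p))\<^sup>2 \<le> 1 / ((1 - p) * norm z)\<^sup>2"
      using denominator_exterior[OF assms(1), of z] True assms nz by (intro frac_le power_mono) auto
    then show ?thesis using True by (simp add: sewn_zbar_def norm_divide norm_power power_mult_distrib)
  qed (simp add: sewn_zbar_def)
qed measurable

lemma null_circle: "sphere (0::complex) r \<in> null_sets lborel"
  using negligible_sphere[of "0::complex" r] by (simp add: negligible_iff_null_sets null_sets_completion_iff)

lemma sewn_weak_deriv:
  assumes "0 \<le> p" "p < 1" shows "weak_deriv (sewn p) (sewn_z p) (sewn_zbar p)"
  by (rule weak_deriv_lipschitz[OF sewn_lipschitz[OF assms] sewn_bounded[OF assms] null_circle[of 1]])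
     (use assms in \<open>auto intro!: sewn_has_derivative L2_imp_L2_loc L2_sewn_z L2_sewn_zbar\<close>)

section \<open>Green's formula on discs\<close>

lemma holomorphic_lipschitz:
  assumes f: "f holomorphic_on S" "open S" "cball 0 R \<subseteq> S"
  obtains L where "L-lipschitz_on (cball 0 R) f"
proof -
  have "continuous_on (cball 0 R) (deriv f)"
    using f by (intro holomorphic_on_imp_continuous_on holomorphic_on_subset[OF holomorphic_deriv])
  then have "compact (deriv f ` cball 0 R)" by (rule compact_continuous_image) simp
  then obtain B where B: "\<And>z. z \<in> cball 0 R \<Longrightarrow> norm (deriv f z) \<le> B"
    using compact_imp_bounded bounded_iff by (metis imageI)
  have "(max 0 B)-lipschitz_on (cball 0 R) f"
  proof (rule lipschitz_onI)
    fix x y :: complex assume xy: "x \<in> cball 0 R" "y \<in> cball 0 R"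
    have "norm (f x - f y) \<le> max 0 B * norm (x - y)"
    proof (rule field_differentiable_bound[where S = "cball 0 R" and f' = "deriv f"])
      fix z assume "z \<in> cball (0::complex) R"
      then show "(f has_field_derivative deriv f z) (at z within cball 0 R)"
        using f(3) by (rule_tac has_field_derivative_at_within[OF holomorphic_derivI[OF f(1,2)]]) auto
      show "norm (deriv f z) \<le> max 0 B" using B[OF \<open>z \<in> cball 0 R\<close>] by simp
    qed (use xy in auto)
    then show "dist (f x) (f y) \<le> max 0 B * dist x y" by (simp add: dist_norm)
  qed simp
  then show ?thesis by (rule that)
qed

lemma lipschitz_cnj: "L-lipschitz_on S f \<Longrightarrow> L-lipschitz_on S (\<lambda>z. cnj (f z))"
  by (simp add: lipschitz_on_def dist_norm flip: complex_cnj_diff)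

lemma lipschitz_bounded_cball:
  fixes f :: "complex \<Rightarrow> complex"
  assumes "L-lipschitz_on (cball 0 R) f" "R \<ge> 0"
  obtains B where "B \<ge> 0" "\<And>z. z \<in> cball 0 R \<Longrightarrow> norm (f z) \<le> B"
proof (rule that[of "norm (f 0) + L * R"])
  have L: "L \<ge> 0" using assms(1) by (rule lipschitz_on_nonneg)
  show "norm (f 0) + L * R \<ge> 0" using L assms by simp
  fix z :: complex assume z: "z \<in> cball 0 R"
  have "norm (f z - f 0) \<le> L * norm (z - 0)" using lipschitz_on_normD[OF assms(1) z, of 0] assms(2) by simp
  also have "\<dots> \<le> L * R" using z L by (intro mult_left_mono) auto
  finally show "norm (f z) \<le> norm (f 0) + L * R" using norm_triangle_sub[of "f z" "f 0"] by linarith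
qed

text \<open>
  The factor \<open>\<bar>z\<bar>\<^sup>2 - R\<^sup>2\<close> vanishes on the boundary circle, so extension by zero creates only a kink.
\<close>

lemma lipschitz_extend_by_zero:
  fixes \<kappa> :: "complex \<Rightarrow> complex"
  assumes R: "R > 0" and \<kappa>: "M-lipschitz_on (cball 0 R) \<kappa>"
  obtains L where "L-lipschitz_on UNIV (\<lambda>z. if norm z \<le> R then (z * cnj z - of_real (R\<^sup>2)) * \<kappa> z else 0)"
proof -
  let ?q = "\<lambda>z. z * cnj z - of_real (R\<^sup>2)"
  let ?\<psi> = "\<lambda>z. if norm z \<le> R then ?q z * \<kappa> z else 0"
  obtain K where K: "K \<ge> 0" "\<And>z. z \<in> cball 0 R \<Longrightarrow> norm (\<kappa> z) \<le> K"
    using lipschitz_bounded_cball[OF \<kappa>] R by auto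
  have M: "M \<ge> 0" using \<kappa> by (rule lipschitz_on_nonneg)
  have q: "norm (?q z) = R\<^sup>2 - (norm z)\<^sup>2" if "norm z \<le> R" for z
  proof -
    have "?q z = of_real ((norm z)\<^sup>2 - R\<^sup>2)" by (simp only: of_real_diff complex_norm_square)
    then have "norm (?q z) = \<bar>(norm z)\<^sup>2 - R\<^sup>2\<bar>" by (simp only: norm_of_real)
    then show ?thesis using power_mono[OF that norm_ge_zero, of 2] by simp
  qed
  have "(R * 1 + R * 1)-lipschitz_on (cball 0 R) (\<lambda>z. z * cnj z)"
    by (rule lipschitz_mult_bounded) (use R in \<open>auto intro: lipschitz_on_id lipschitz_cnj\<close>)
  then have "(R * 1 + R * 1 + 0)-lipschitz_on (cball 0 R) ?q"
    by (intro lipschitz_on_diff lipschitz_on_constant)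
  then have "(R\<^sup>2 * M + K * (R * 1 + R * 1 + 0))-lipschitz_on (cball 0 R) (\<lambda>z. ?q z * \<kappa> z)"
    by (rule lipschitz_mult_bounded[OF _ \<kappa>]) (use K q in auto)
  then have inn: "(R\<^sup>2 * M + K * (2 * R))-lipschitz_on (cball 0 R) (\<lambda>z. ?q z * \<kappa> z)"
    by (simp add: algebra_simps)
  have mixed: "norm (?q z * \<kappa> z) \<le> (R\<^sup>2 * M + K * (2 * R)) * norm (z - w)" if "norm z \<le> R" "norm w > R" for z w
  proof -
    have "norm (?q z * \<kappa> z) = (R + norm z) * (R - norm z) * norm (\<kappa> z)"
      unfolding norm_mult q[OF that(1)] by (simp add: power2_eq_square algebra_simps)
    also have "\<dots> \<le> (2 * R) * norm (z - w) * K"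
      using that K norm_triangle_ineq2[of w z] R
      by (intro mult_mono) (auto simp: norm_minus_commute)
    also have "\<dots> \<le> (R\<^sup>2 * M + K * (2 * R)) * norm (z - w)" using M by (simp add: algebra_simps)
    finally show ?thesis .
  qed
  have "(R\<^sup>2 * M + K * (2 * R))-lipschitz_on UNIV ?\<psi>"
  proof (rule lipschitz_onI)
    fix z w :: complex
    show "dist (?\<psi> z) (?\<psi> w) \<le> (R\<^sup>2 * M + K * (2 * R)) * dist z w"
      using lipschitz_on_normD[OF inn, of z w] mixed[of z w] mixed[of w z] K(1) M R
      by (auto simp: dist_norm norm_minus_commute)
  qed (use K(1) M R in auto)
  then show ?thesis by (rule that)
qed

lemma measurable_on_ball:
  fixes f :: "complex \<Rightarrow> complex"
  assumes "continuous_on (ball 0 R) f" shows "(\<lambda>z. if norm z < R then f z else 0) \<in> borel_measurable borel"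
proof -
  have "(\<lambda>z. indicator (ball 0 R) z *\<^sub>R f z) \<in> borel_measurable borel"
    using assms by (intro borel_measurable_continuous_on_indicator) auto
  moreover have "(\<lambda>z. indicator (ball 0 R) z *\<^sub>R f z) = (\<lambda>z. if norm z < R then f z else 0)"
    by (auto simp: fun_eq_iff indicator_def)
  ultimately show ?thesis by simp
qed

text \<open>
  The integrand is the derivative with respect to the conjugate variable of \<open>(\<bar>z\<bar>\<^sup>2 - R\<^sup>2) a z cnj (b z)\<close>, which
  vanishes on the boundary of the disc. Suitable choices of \<open>a\<close> and \<open>b\<close> give mean value formulas and norms
  without polar coordinates.
\<close>

lemma disc_green:
  assumes a: "a holomorphic_on S" and b: "b holomorphic_on S" and S: "open S" "cball 0 R \<subseteq> S" and R: "R > 0"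
  shows "(\<integral>z. (if norm z < R then a z * (z * cnj (b z) + (z * cnj z - of_real (R\<^sup>2)) * cnj (deriv b z)) else 0) \<partial>lborel) = 0"
proof -
  obtain La Lb where La: "La-lipschitz_on (cball 0 R) a" and Lb: "Lb-lipschitz_on (cball 0 R) b"
    using holomorphic_lipschitz a b S by metis
  obtain A where A: "A \<ge> 0" "\<And>z. z \<in> cball 0 R \<Longrightarrow> norm (a z) \<le> A" using lipschitz_bounded_cball[OF La] R by auto
  obtain B where B: "B \<ge> 0" "\<And>z. z \<in> cball 0 R \<Longrightarrow> norm (b z) \<le> B" using lipschitz_bounded_cball[OF Lb] R by auto
  have \<kappa>: "(A * Lb + B * La)-lipschitz_on (cball 0 R) (\<lambda>z. a z * cnj (b z))"
    by (rule lipschitz_mult_bounded[OF La lipschitz_cnj[OF Lb]]) (use A B in auto)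
  obtain L where L: "L-lipschitz_on UNIV (\<lambda>z. if norm z \<le> R then (z * cnj z - of_real (R\<^sup>2)) * (a z * cnj (b z)) else 0)"
    using lipschitz_extend_by_zero[OF R \<kappa>] by blast
  define \<alpha> where "\<alpha> z = (if norm z < R then cnj z * (a z * cnj (b z)) + (z * cnj z - of_real (R\<^sup>2)) * (deriv a z * cnj (b z)) else 0)" for z
  define \<beta> where "\<beta> z = (if norm z < R then a z * (z * cnj (b z) + (z * cnj z - of_real (R\<^sup>2)) * cnj (deriv b z)) else 0)" for z
  have sub: "ball 0 R \<subseteq> S" using S(2) ball_subset_cball by blast
  have c: "continuous_on (ball 0 R) a" "continuous_on (ball 0 R) b"
    "continuous_on (ball 0 R) (deriv a)" "continuous_on (ball 0 R) (deriv b)"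
    using a b S sub by (auto intro!: holomorphic_on_imp_continuous_on intro: holomorphic_on_subset holomorphic_deriv)
  have "(\<integral>z. \<beta> z \<partial>lborel) = 0"
  proof (rule integral_wirtinger_eq_0(4)[where R = R and a = \<alpha>, OF L _ null_circle[of R]])
    show "\<alpha> \<in> borel_measurable borel" unfolding \<alpha>_def by (intro measurable_on_ball continuous_intros c)
    show "\<beta> \<in> borel_measurable borel" unfolding \<beta>_def by (intro measurable_on_ball continuous_intros c)
    fix z :: complex assume z: "z \<notin> sphere 0 R"
    show "((\<lambda>z. if norm z \<le> R then (z * cnj z - of_real (R\<^sup>2)) * (a z * cnj (b z)) else 0) has_derivative
        (\<lambda>h. \<alpha> z * h + \<beta> z * cnj h)) (at z)"
    proof (cases "norm z < R")
      case True
      then have zS: "z \<in> S" using sub by auto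
      have da: "(a has_derivative (*) (deriv a z)) (at z)" "(b has_derivative (*) (deriv b z)) (at z)"
        using holomorphic_derivI[OF a S(1) zS] holomorphic_derivI[OF b S(1) zS] by (auto simp: has_field_derivative_def)
      have "((\<lambda>z. (z * cnj z - of_real (R\<^sup>2)) * (a z * cnj (b z))) has_derivative (\<lambda>h. \<alpha> z * h + \<beta> z * cnj h)) (at z)"
        by (rule has_derivative_eq_rhs, (rule derivative_intros da)+)
           (use True in \<open>simp add: fun_eq_iff \<alpha>_def \<beta>_def algebra_simps\<close>)
      then show ?thesis
        by (rule has_derivative_transform_within_open[OF _ open_ball[of 0 R]]) (use True in auto)
    next
      case False
      then have "norm z > R" using z by simp
      have "((\<lambda>z. 0) has_derivative (\<lambda>h. \<alpha> z * h + \<beta> z * cnj h)) (at z)"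
        using False by (simp add: \<alpha>_def \<beta>_def)
      then show ?thesis
        by (rule has_derivative_transform_within_open[OF _ open_Compl[OF closed_cball[of 0 R]]])
           (use \<open>norm z > R\<close> in auto)
    qed
  qed auto
  then show ?thesis by (simp add: \<beta>_def[abs_def])
qed

lemma integral_disc_const: "R \<ge> 0 \<Longrightarrow> (\<integral>z. (if norm (z::complex) < R then c else 0) \<partial>lborel) = of_real (pi * R\<^sup>2) * (c::complex)"
proof -
  assume R: "R \<ge> 0"
  have "measure lborel (ball (0::complex) R) = pi * R\<^sup>2"
    using content_ball[of R "0::complex"] R by (simp add: unit_ball_vol_2 measure_completion)
  moreover have "(\<lambda>z::complex. if norm z < R then c else 0) = (\<lambda>z. indicator (ball 0 R) z *\<^sub>R c)"
    by (auto simp: fun_eq_iff indicator_def)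
  moreover have "emeasure lborel (ball (0::complex) R) < \<infinity>" by (rule emeasure_bounded_finite) simp
  ultimately show ?thesis by (simp add: integral_scaleR_left scaleR_conv_of_real)
qed

lemma integrable_disc_const: "integrable lborel (\<lambda>z. (if norm (z::complex) < R then c else 0) :: complex)"
  by (rule integrable_bounded_support[where B = "norm c" and R = R]) auto

text \<open>
  The mean value property of \<open>1 / (1 - p z)\<^sup>2\<close>: the difference of this function and its value at the origin
  is divisible by \<open>z\<close>.
\<close>

lemma integral_sewn_z:
  assumes p: "0 \<le> p" "p < 1" shows "(\<integral>z. sewn_z p z \<partial>lborel) = of_real pi"
proof -
  define S where "S = {z. 1 - of_real p * z \<noteq> (0::complex)}"
  have S: "open S" "cball 0 1 \<subseteq> S"
  proof -
    show "open S" unfolding S_def by (intro open_Collect_neq continuous_intros)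
    show "cball 0 1 \<subseteq> S" 
    proof
      fix z :: complex assume "z \<in> cball 0 1"
      then have "0 < norm (1 - of_real p * z)" using denominator_disc[OF p(1), of z] p(2) by auto
      then show "z \<in> S" by (auto simp: S_def)
    qed
  qed
  \<comment> \<open>chosen such that \<open>z a z = 1 / (1 - p z)\<^sup>2 - 1\<close>\<close>
  let ?a = "\<lambda>z. (2 * of_real p - (of_real p)\<^sup>2 * z) / (1 - of_real p * z)\<^sup>2"
  have a: "?a holomorphic_on S" by (intro holomorphic_intros) (auto simp: S_def)
  have i: "integrable lborel (sewn_z p)"
    by (rule L2_integrable_bounded_support[OF L2_sewn_z[OF p], of 1]) (simp add: sewn_z_def)
  have pt: "(if norm z < 1 then ?a z * (z * cnj 1 + (z * cnj z - of_real (1\<^sup>2)) * cnj (deriv (\<lambda>z. 1) z)) else 0) =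
      sewn_z p z - (if norm z < 1 then 1 else 0)" for z
  proof (cases "norm z < 1")
    case True
    then have "z \<in> S" by (intro subsetD[OF S(2)]) simp
    then have "1 - of_real p * z \<noteq> 0" by (simp add: S_def)
    then show ?thesis using True by (simp add: sewn_z_def field_simps) (simp add: power2_eq_square algebra_simps)
  qed (simp add: sewn_z_def)
  have "(\<integral>z. sewn_z p z - (if norm z < 1 then 1 else 0) \<partial>lborel) = 0"
    using disc_green[OF a _ S, of "\<lambda>z. 1"] unfolding pt by simp
  then show ?thesis using i integrable_disc_const[of 1 1] integral_disc_const[of 1 1] by simp
qed

text \<open>
  Up to the factor \<open>\<pi>\<close> the function \<open>sewn_z p\<close> is the Bergman kernel of the disc at \<open>p\<close>. With \<open>b = 1 / (1 - p z)\<close> the bracket in Green's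
  formula becomes \<open>(z - p) / (1 - p cnj z)\<^sup>2\<close>, so the formula says that analytic functions vanishing at \<open>p\<close>
  are orthogonal to the kernel: in a pairing with it, an analytic function may be replaced by its value at \<open>p\<close>.
\<close>

lemma l2_sewn_z:
  assumes p: "0 \<le> p" "p < 1" shows "(l2 (sewn_z p))\<^sup>2 = pi / (1 - p\<^sup>2)\<^sup>2"
proof -
  define P where "P = complex_of_real p"
  define S where "S = {z. 1 - P * z \<noteq> 0}"
  have S: "open S" "cball 0 1 \<subseteq> S"
  proof -
    show "open S" unfolding S_def by (intro open_Collect_neq continuous_intros)
    show "cball 0 1 \<subseteq> S" 
    proof
      fix z :: complex assume "z \<in> cball 0 1"
      then have "0 < norm (1 - P * z)" using denominator_disc[OF p(1), of z] p(2) by (auto simp: P_def)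
      then show "z \<in> S" by (auto simp: S_def)
    qed
  qed
  have p2: "p\<^sup>2 < 1" using p by (simp add: power_less_one_iff abs_square_less_1)
  then have P2: "1 - P\<^sup>2 \<noteq> 0" unfolding P_def by (metis of_real_1 of_real_diff of_real_eq_0_iff of_real_power diff_gt_0_iff_gt less_irrefl)
  \<comment> \<open>chosen such that \<open>(z - p) a z = 1 / (1 - p z)\<^sup>2 - 1 / (1 - p\<^sup>2)\<^sup>2\<close>\<close>
  let ?a = "\<lambda>z. P * (2 - P\<^sup>2 - P * z) / ((1 - P * z)\<^sup>2 * (1 - P\<^sup>2)\<^sup>2)"
  let ?b = "\<lambda>z. 1 / (1 - P * z)"
  have a: "?a holomorphic_on S" by (intro holomorphic_intros) (use P2 in \<open>auto simp: S_def\<close>)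
  have b: "?b holomorphic_on S" by (intro holomorphic_intros) (auto simp: S_def)
  have pt: "(if norm z < 1 then ?a z * (z * cnj (?b z) + (z * cnj z - of_real (1\<^sup>2)) * cnj (deriv ?b z)) else 0) =
      sewn_z p z * cnj (sewn_z p z) - 1 / (1 - P\<^sup>2)\<^sup>2 * cnj (sewn_z p z)" for z
  proof (cases "norm z < 1")
    case True
    \<comment> \<open>Algebra in \<open>z\<close> and its conjugate as independent variables.\<close>
    define w where "w = cnj z"
    have "z \<in> S" using True by (intro subsetD[OF S(2)]) simp
    then have nz: "1 - P * z \<noteq> 0" by (simp add: S_def)
    then have "cnj (1 - P * z) \<noteq> 0" by (simp only: complex_cnj_zero_iff not_False_eq_True)
    then have nw: "1 - P * w \<noteq> 0" by (simp add: w_def P_def)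
    have d: "deriv ?b z = P / (1 - P * z)\<^sup>2"
      by (rule DERIV_imp_deriv) (use nz in \<open>auto intro!: derivative_eq_intros simp: power2_eq_square\<close>)
    have "z * cnj (?b z) + (z * cnj z - of_real (1\<^sup>2)) * cnj (deriv ?b z) = z * (1 / (1 - P * w)) + (z * w - 1) * (P / (1 - P * w)\<^sup>2)"
      unfolding d by (simp add: w_def P_def)
    also have "\<dots> = (z - P) / (1 - P * w)\<^sup>2"
      using nw by (simp add: divide_simps) (simp add: power2_eq_square algebra_simps)
    finally have e1: "z * cnj (?b z) + (z * cnj z - of_real (1\<^sup>2)) * cnj (deriv ?b z) = (z - P) / (1 - P * w)\<^sup>2" .
    have e2: "?a z * (z - P) = 1 / (1 - P * z)\<^sup>2 - 1 / (1 - P\<^sup>2)\<^sup>2"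
      using nz P2 by (simp add: divide_simps) (simp add: power2_eq_square algebra_simps)
    have e3: "sewn_z p z = 1 / (1 - P * z)\<^sup>2" "cnj (sewn_z p z) = 1 / (1 - P * w)\<^sup>2"
      using True by (simp_all add: sewn_z_def P_def w_def)
    have "?a z * ((z - P) / (1 - P * w)\<^sup>2) = (?a z * (z - P)) * (1 / (1 - P * w)\<^sup>2)" by simp
    also have "\<dots> = sewn_z p z * cnj (sewn_z p z) - 1 / (1 - P\<^sup>2)\<^sup>2 * cnj (sewn_z p z)"
      unfolding e2 e3(2) left_diff_distrib by (simp only: e3(1))
    finally show ?thesis using True unfolding e1 by simp
  qed (simp add: sewn_z_def)
  have i: "integrable lborel (sewn_z p)"
    by (rule L2_integrable_bounded_support[OF L2_sewn_z[OF p], of 1]) (simp add: sewn_z_def)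
  have ii: "integrable lborel (\<lambda>z. sewn_z p z * cnj (sewn_z p z))"
    by (intro L2_mult_integrable L2_cnj L2_sewn_z p)
  have "(\<integral>z. sewn_z p z * cnj (sewn_z p z) - 1 / (1 - P\<^sup>2)\<^sup>2 * cnj (sewn_z p z) \<partial>lborel) = 0"
    using disc_green[OF a b S] unfolding pt by simp
  then have "(\<integral>z. sewn_z p z * cnj (sewn_z p z) \<partial>lborel) = 1 / (1 - P\<^sup>2)\<^sup>2 * cnj (\<integral>z. sewn_z p z \<partial>lborel)"
    using i ii by simp
  also have "\<dots> = of_real (pi / (1 - p\<^sup>2)\<^sup>2)" unfolding integral_sewn_z[OF p] by (simp add: P_def)
  finally have "(\<integral>z. sewn_z p z * cnj (sewn_z p z) \<partial>lborel) = of_real (pi / (1 - p\<^sup>2)\<^sup>2)" .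
  moreover have "(\<integral>z. sewn_z p z * cnj (sewn_z p z) \<partial>lborel) = of_real ((l2 (sewn_z p))\<^sup>2)"
    unfolding l2_power2 by (simp flip: complex_norm_square integral_complex_of_real)
  ultimately show ?thesis by (metis of_real_eq_iff)
qed

lemma L2_self_pairing: "(\<integral>z. f z * cnj (f z) \<partial>lborel) = of_real ((l2 f)\<^sup>2)"
  unfolding l2_power2 by (simp flip: complex_norm_square integral_complex_of_real)

text \<open>
  The bilinear identity for \<open>sewn p\<close> and its conjugate equates the energies inside and outside of the disc.
\<close>

lemma l2_sewn_zbar:
  assumes p: "0 \<le> p" "p < 1" shows "(l2 (sewn_zbar p))\<^sup>2 = pi / (1 - p\<^sup>2)\<^sup>2"
proof -
  have "(\<integral>z. sewn_z p z * cnj (sewn_z p z) \<partial>lborel) = (\<integral>z. sewn_zbar p z * cnj (sewn_zbar p z) \<partial>lborel)"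
    by (rule bilinear_identity[OF sewn_weak_deriv[OF p] weak_deriv_cnj[OF sewn_weak_deriv[OF p]], where B = "1 / (1 - p)"])
       (use p sewn_bounded[OF p] in \<open>auto intro: L2_cnj L2_sewn_z L2_sewn_zbar\<close>)
  then have "(l2 (sewn_zbar p))\<^sup>2 = (l2 (sewn_z p))\<^sup>2" unfolding L2_self_pairing of_real_eq_iff by simp
  then show ?thesis using l2_sewn_z[OF p] by simp
qed

lemma mean_value_smaller_disc:
  assumes f: "f holomorphic_on ball 0 1" and R: "0 < R" "R < 1"
  shows "(\<integral>z. (if norm z < R then f z else 0) \<partial>lborel) = of_real (pi * R\<^sup>2) * f 0"
proof -
  let ?a = "\<lambda>z. if z = 0 then deriv f 0 else (f z - f 0) / (z - 0)"
  have a: "?a holomorphic_on ball 0 1" by (rule pole_lemma[OF f]) simp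
  have S: "cball 0 R \<subseteq> ball (0::complex) 1" using R by auto
  have pt: "(if norm z < R then ?a z * (z * cnj 1 + (z * cnj z - of_real (R\<^sup>2)) * cnj (deriv (\<lambda>z. 1) z)) else 0) =
      (if norm z < R then f z else 0) - (if norm z < R then f 0 else 0)" for z by simp
  have "(\<integral>z. (if norm z < R then f z else 0) - (if norm z < R then f 0 else 0) \<partial>lborel) = 0"
    using disc_green[OF a _ open_ball S R(1), of "\<lambda>z. 1"] unfolding pt by simp
  moreover have "integrable lborel (\<lambda>z. if norm z < R then f z else 0)"
  proof -
    have c: "continuous_on (cball 0 R) f"
      using f S by (intro holomorphic_on_imp_continuous_on) (auto intro: holomorphic_on_subset)
    then have "compact (f ` cball 0 R)" by (rule compact_continuous_image) simp
    then obtain B where B: "\<And>z. z \<in> cball 0 R \<Longrightarrow> norm (f z) \<le> B"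
      using compact_imp_bounded bounded_iff by (metis imageI)
    have "B \<ge> 0" using order.trans[OF norm_ge_zero B[of 0]] R by simp
    then show ?thesis
      by (intro integrable_bounded_support[where B = B and R = R] measurable_on_ball)
         (use B c in \<open>auto intro: continuous_on_subset\<close>)
  qed
  ultimately show ?thesis
    using integrable_disc_const[of R "f 0"] integral_disc_const[of R "f 0"] R by simp
qed

lemma mean_value_disc:
  assumes f: "f holomorphic_on ball 0 1" and i: "integrable lborel (\<lambda>z. if norm z < 1 then f z else 0)"
  shows "(\<integral>z. (if norm z < 1 then f z else 0) \<partial>lborel) = of_real pi * f 0"
proof -
  define R where "R n = 1 - inverse (real (Suc (Suc n)))" for n
  have R: "0 < R n" "R n < 1" for n by (auto simp: R_def field_simps)
  have Rlim: "R \<longlonglongrightarrow> 1"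
    using tendsto_diff[OF tendsto_const LIMSEQ_Suc[OF LIMSEQ_inverse_real_of_nat], of 1] by (simp add: R_def[abs_def])
  have cont: "continuous_on (ball 0 1) f" using f by (rule holomorphic_on_imp_continuous_on)
  have "(\<lambda>n. \<integral>z. (if norm z < R n then f z else 0) \<partial>lborel) \<longlonglongrightarrow> (\<integral>z. (if norm z < 1 then f z else 0) \<partial>lborel)"
  proof (rule integral_dominated_convergence[where w = "\<lambda>z. norm (if norm z < 1 then f z else 0)"])
    show "(\<lambda>z. if norm z < 1 then f z else 0) \<in> borel_measurable lborel" using i by simp
    show "(\<lambda>z. if norm z < R n then f z else 0) \<in> borel_measurable lborel" for n
    proof -
      have "continuous_on (ball 0 (R n)) f" by (rule continuous_on_subset[OF cont]) (use R[of n] in auto)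
      then show ?thesis using measurable_on_ball[of "R n" f] by simp
    qed
    show "AE z in lborel. norm (if norm z < R n then f z else 0) \<le> norm (if norm z < 1 then f z else 0)" for n
      using R[of n] by auto
    show "AE z in lborel. (\<lambda>n. if norm z < R n then f z else 0) \<longlonglongrightarrow> (if norm z < 1 then f z else 0)"
    proof (rule AE_I2)
      fix z
      have "\<forall>\<^sub>F n in sequentially. (if norm z < R n then f z else 0) = (if norm z < 1 then f z else 0)"
      proof (cases "norm z < 1")
        case True
        then have "\<forall>\<^sub>F n in sequentially. norm z < R n" using Rlim by (intro order_tendstoD)
        then show ?thesis by eventually_elim (use True in simp)
      next
        case False
        then have "\<not> norm z < R n" for n using R(2)[of n] by linarith
        then show ?thesis using False by simp
      qed
      then show "(\<lambda>n. if norm z < R n then f z else 0) \<longlonglongrightarrow> (if norm z < 1 then f z else 0)"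
        by (rule tendsto_eventually)
    qed
  qed (use i in simp)
  moreover have "(\<lambda>n. \<integral>z. (if norm z < R n then f z else 0) \<partial>lborel) \<longlonglongrightarrow> of_real (pi * 1\<^sup>2) * f 0"
    unfolding mean_value_smaller_disc[OF f R] by (intro tendsto_intros Rlim)
  ultimately show ?thesis using LIMSEQ_unique by fastforce
qed

section \<open>Finiteness of the energy\<close>

text \<open>
  Monotone convergence over the discs on which the cut-offs equal one.
\<close>

lemma L2_of_cutoff_bounds:
  assumes f: "f \<in> borel_measurable borel"
    and X: "\<And>n z. norm z \<le> real (Suc n) \<Longrightarrow> X n z = (1::real)"
    and b: "\<And>n. L2 (\<lambda>z. of_real (X n z) * f z)" "\<And>n. l2 (\<lambda>z. of_real (X n z) * f z) \<le> M"
  shows "L2 f"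
proof -
  note [measurable] = f
  define F where "F n z = (norm (indicator (cball 0 (real (Suc n))) z * f z))\<^sup>2" for n and z :: complex
  have F_le: "F n z \<le> (norm (of_real (X n z) * f z))\<^sup>2" for n z
    using X[of z n] by (auto simp: F_def indicator_def simp del: of_nat_Suc)
  have iX: "integrable lborel (\<lambda>z. (norm (of_real (X n z) * f z))\<^sup>2)" for n using b(1) by (simp add: L2_def)
  have [measurable]: "F n \<in> borel_measurable borel" for n unfolding F_def
    using f borel_closed[OF closed_cball, measurable] by measurable
  have iF: "integrable lborel (F n)" for n
    by (rule Bochner_Integration.integrable_bound[OF iX[of n]]) (use F_le in \<open>auto simp: F_def\<close>)
  have mono: "F m z \<le> F n z" if "m \<le> n" for m n z
    using that by (auto simp: F_def indicator_def)
  have M: "M \<ge> 0" using order.trans[OF l2_nonneg b(2)] .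
  have bound: "(\<integral>z. F n z \<partial>lborel) \<le> M\<^sup>2" for n
  proof -
    have "(\<integral>z. F n z \<partial>lborel) \<le> (\<integral>z. (norm (of_real (X n z) * f z))\<^sup>2 \<partial>lborel)"
      by (rule integral_mono[OF iF iX]) (rule F_le)
    also have "\<dots> = (l2 (\<lambda>z. of_real (X n z) * f z))\<^sup>2" by (rule l2_power2[symmetric])
    also have "\<dots> \<le> M\<^sup>2" using b(2) by (intro power_mono) auto
    finally show ?thesis .
  qed
  have "incseq (\<lambda>n. \<integral>z. F n z \<partial>lborel)"
    by (intro incseq_SucI integral_mono iF mono) simp
  then obtain L where L: "(\<lambda>n. \<integral>z. F n z \<partial>lborel) \<longlonglongrightarrow> L"
    using incseq_convergent[of _ "M\<^sup>2"] bound by blast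
  have "integrable lborel (\<lambda>z. (norm (f z))\<^sup>2)"
  proof (rule integrable_monotone_convergence[OF iF _ _ L])
    show "AE z in lborel. mono (\<lambda>n. F n z)" by (intro AE_I2 monoI mono)
    show "AE z in lborel. (\<lambda>n. F n z) \<longlonglongrightarrow> (norm (f z))\<^sup>2"
    proof (rule AE_I2)
      fix z :: complex
      have "\<forall>\<^sub>F n in sequentially. norm z \<le> real (Suc n)"
        using eventually_ge_at_top[of "nat \<lceil>norm z\<rceil>"] by eventually_elim linarith
      then have "\<forall>\<^sub>F n in sequentially. F n z = (norm (f z))\<^sup>2"
        by eventually_elim (simp add: F_def)
      then show "(\<lambda>n. F n z) \<longlonglongrightarrow> (norm (f z))\<^sup>2" by (rule tendsto_eventually)
    qed
  qed measurable
  then show ?thesis by (simp add: L2_def)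
qed

lemma l2_cmult: "l2 (\<lambda>z. c * f z) = norm c * l2 f"
  by (simp add: l2_def norm_mult power_mult_distrib real_sqrt_mult)

text \<open>
  A Caccioppoli estimate. Testing against \<open>X\<^sup>2 cnj G\<close> shows that the cut-off norms \<open>x\<close> of \<open>g\<close> and \<open>y\<close> of \<open>h\<close>
  satisfy \<open>x\<^sup>2 - y\<^sup>2 \<le> const * (x + y)\<close>, where the constant depends on the bound of \<open>G\<close> but not on the radius
  of the cut-off; hence \<open>x - y \<le> const\<close>. The dilatation bound gives \<open>y \<le> k (x + l2 \<sigma>)\<close>, and since \<open>k < 1\<close> both
  norms are bounded uniformly in the radius.
\<close>

lemma finite_energy:
  assumes w: "weak_deriv G g h" and B: "\<And>z. norm (G z) \<le> B" and \<sigma>: "L2 \<sigma>"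
    and k: "0 \<le> k" "k < 1" and qc: "AE z in lborel. norm (h z) \<le> k * norm (g z + \<sigma> z)"
  shows "L2 g" "L2 h"
proof -
  obtain X C where X: "\<And>n. test (\<lambda>z. of_real (X n z))" "\<And>n z. 0 \<le> X n z" "\<And>n z. X n z \<le> 1"
    "\<And>n z. norm z \<le> real (Suc n) \<Longrightarrow> X n z = 1" "\<And>n z. norm z \<ge> 2 * real (Suc n) \<Longrightarrow> X n z = 0"
    and dX: "\<And>n z. norm (partial_z (\<lambda>z. of_real (X n z)) z) \<le> C / real (Suc n)"
    "\<And>n z. norm (partial_zbar (\<lambda>z. of_real (X n z)) z) \<le> C / real (Suc n)"
    "\<And>n z. norm z < real (Suc n) \<or> norm z > 2 * real (Suc n) \<Longrightarrow> partial_z (\<lambda>z. of_real (X n z)) z = 0"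
    "\<And>n z. norm z < real (Suc n) \<or> norm z > 2 * real (Suc n) \<Longrightarrow> partial_zbar (\<lambda>z. of_real (X n z)) z = 0"
    using cutoff_exists by blast
  note wd = weak_derivD[OF w]
  note [measurable] = L2_loc_measurable[OF wd(2)] L2_loc_measurable[OF wd(3)] L2_measurable[OF \<sigma>]
    borel_measurable_continuous_onI[OF wd(1)]
  have B0: "B \<ge> 0" using order.trans[OF norm_ge_zero B] .
  \<comment> \<open>\<open>K\<close> bounds the norm of \<open>G\<close> times the gradient of a cut-off, uniformly in the radius.\<close>
  define K where "K = 4 * (C * B)"
  define s where "s = l2 \<sigma>"
  define M where "M = (k * s + 2 * \<bar>K\<bar>) / (1 - k)"
  have main: "L2 (\<lambda>z. of_real (X n z) * g z) \<and> L2 (\<lambda>z. of_real (X n z) * h z) \<and>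
      l2 (\<lambda>z. of_real (X n z) * g z) \<le> M \<and> l2 (\<lambda>z. of_real (X n z) * h z) \<le> k * (M + s)" for n
  proof -
    define Y where "Y z = complex_of_real (X n z)" for z
    define P where "P = partial_z Y"
    define Q where "Q = partial_zbar Y"
    have tY: "test Y" using X(1) by (simp add: Y_def[abs_def])
    then have sY: "smooth Y" by (simp add: test_def)
    note [measurable] = test_measurable[OF tY] test_measurable[OF test_partial(1)[OF tY], folded P_def]
      test_measurable[OF test_partial(2)[OF tY], folded Q_def]
    have Y0: "Y z = 0" "P z = 0" "Q z = 0" if "norm z > 2 * real (Suc n)" for z
      using that X(5)[of n z] dX(3,4)[of z n] by (auto simp: Y_def P_def Q_def fun_eq_iff[symmetric] cong: if_cong simp flip: Y_def[abs_def])
    have cY: "cnj (Y z) = Y z" "norm (Y z) \<le> 1" for z using X(2,3) by (auto simp: Y_def)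
    have yc: "continuous_on UNIV Y" using tY by (rule test_continuous)
    define \<gamma> where "\<gamma> z = Y z * g z" for z
    define \<eta> where "\<eta> z = Y z * h z" for z
    define \<pi>1 where "\<pi>1 z = P z * cnj (G z)" for z
    define \<pi>2 where "\<pi>2 z = Q z * cnj (G z)" for z
    have L\<gamma>: "L2 \<gamma>" and L\<eta>: "L2 \<eta>"
      using L2_loc_bounded_support[OF L2_loc_mult_continuous[OF wd(2) yc]]
        L2_loc_bounded_support[OF L2_loc_mult_continuous[OF wd(3) yc]] Y0(1)
      unfolding \<gamma>_def \<eta>_def by (metis mult_zero_left)+
    have pb: "norm (P z * cnj (G z)) \<le> C * B / real (Suc n)" "norm (Q z * cnj (G z)) \<le> C * B / real (Suc n)" for z
    proof -
      have *: "norm (t * cnj (G z)) \<le> C * B / real (Suc n)" if "norm t \<le> C / real (Suc n)" for t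
      proof -
        have "norm t * norm (G z) \<le> (C / real (Suc n)) * B"
          using that B[of z] order.trans[OF norm_ge_zero that] by (intro mult_mono) auto
        then show ?thesis by (simp add: norm_mult)
      qed
      show "norm (P z * cnj (G z)) \<le> C * B / real (Suc n)" "norm (Q z * cnj (G z)) \<le> C * B / real (Suc n)"
        using * dX(1,2)[of n z] by (auto simp: P_def Q_def Y_def[abs_def])
    qed
    have \<pi>1: "L2 \<pi>1" "l2 \<pi>1 \<le> K" and \<pi>2: "L2 \<pi>2" "l2 \<pi>2 \<le> K"
      using l2_cutoff_gradient[of \<pi>1 "C * B" "real (Suc n)"] l2_cutoff_gradient[of \<pi>2 "C * B" "real (Suc n)"] pb Y0
      by (auto simp: \<pi>1_def[abs_def] \<pi>2_def[abs_def] K_def)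
    have YY: "partial_z (\<lambda>z. Y z * Y z) z = 2 * Y z * P z" "partial_zbar (\<lambda>z. Y z * Y z) z = 2 * Y z * Q z" for z
      using smooth_differentiable[OF sY] by (simp_all add: partial_mult P_def Q_def)
    \<comment> \<open>The square of the cut-off distributes evenly: one factor goes to each of \<open>g\<close> and \<open>cnj g\<close>.\<close>
    have wY: "weak_deriv (\<lambda>z. (Y z * Y z) * cnj (G z)) (\<lambda>z. (Y z * Y z) * cnj (h z) + 2 * Y z * P z * cnj (G z))
        (\<lambda>z. (Y z * Y z) * cnj (g z) + 2 * Y z * Q z * cnj (G z))"
      using weak_deriv_mult_smooth[OF weak_deriv_cnj[OF w] smooth_mult[OF sY sY]] by (simp add: YY)
    have "(\<integral>z. g z * ((Y z * Y z) * cnj (g z) + 2 * Y z * Q z * cnj (G z)) \<partial>lborel) =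
        (\<integral>z. h z * ((Y z * Y z) * cnj (h z) + 2 * Y z * P z * cnj (G z)) \<partial>lborel)"
      by (rule bilinear_identity_compact[OF w wY, of "2 * real (Suc n)"]) (simp_all add: Y0 del: of_nat_Suc)
    moreover have "g z * ((Y z * Y z) * cnj (g z) + 2 * Y z * Q z * cnj (G z)) = \<gamma> z * cnj (\<gamma> z) + 2 * (\<gamma> z * \<pi>2 z)"
      "h z * ((Y z * Y z) * cnj (h z) + 2 * Y z * P z * cnj (G z)) = \<eta> z * cnj (\<eta> z) + 2 * (\<eta> z * \<pi>1 z)" for z
      by (simp_all add: \<gamma>_def \<eta>_def \<pi>1_def \<pi>2_def cY algebra_simps)
    moreover have "integrable lborel (\<lambda>z. \<gamma> z * cnj (\<gamma> z))" "integrable lborel (\<lambda>z. \<eta> z * cnj (\<eta> z))"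
      "integrable lborel (\<lambda>z. \<gamma> z * \<pi>2 z)" "integrable lborel (\<lambda>z. \<eta> z * \<pi>1 z)"
      using L\<gamma> L\<eta> \<pi>1(1) \<pi>2(1) by (auto intro!: L2_mult_integrable intro: L2_cnj)
    ultimately have id: "of_real ((l2 \<gamma>)\<^sup>2) + 2 * (\<integral>z. \<gamma> z * \<pi>2 z \<partial>lborel) =
        of_real ((l2 \<eta>)\<^sup>2) + 2 * (\<integral>z. \<eta> z * \<pi>1 z \<partial>lborel)"
      by (simp add: L2_self_pairing)
    have "complex_of_real ((l2 \<gamma>)\<^sup>2 - (l2 \<eta>)\<^sup>2) = 2 * ((\<integral>z. \<eta> z * \<pi>1 z \<partial>lborel) - (\<integral>z. \<gamma> z * \<pi>2 z \<partial>lborel))"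
      using id by (simp add: algebra_simps)
    then have "\<bar>(l2 \<gamma>)\<^sup>2 - (l2 \<eta>)\<^sup>2\<bar> = 2 * norm ((\<integral>z. \<eta> z * \<pi>1 z \<partial>lborel) - (\<integral>z. \<gamma> z * \<pi>2 z \<partial>lborel))"
      by (metis norm_mult norm_numeral norm_of_real)
    also have "\<dots> \<le> 2 * (l2 \<eta> * l2 \<pi>1 + l2 \<gamma> * l2 \<pi>2)"
      by (rule mult_left_mono[OF order.trans[OF norm_triangle_ineq4
            add_mono[OF L2_Cauchy_Schwarz[OF L\<eta> \<pi>1(1)] L2_Cauchy_Schwarz[OF L\<gamma> \<pi>2(1)]]]]) simp
    also have "\<dots> \<le> 2 * (l2 \<eta> * \<bar>K\<bar> + l2 \<gamma> * \<bar>K\<bar>)"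
      using \<pi>1(2) \<pi>2(2) by (intro mult_left_mono add_mono) auto
    finally have "(l2 \<gamma> - l2 \<eta>) * (l2 \<gamma> + l2 \<eta>) \<le> 2 * \<bar>K\<bar> * (l2 \<gamma> + l2 \<eta>)"
      by (simp add: power2_eq_square algebra_simps)
    then have d: "l2 \<gamma> - l2 \<eta> \<le> 2 * \<bar>K\<bar>"
      using l2_nonneg[of \<gamma>] l2_nonneg[of \<eta>]
      by (cases "l2 \<gamma> + l2 \<eta> = 0") (auto simp: mult_le_cancel_right add_nonneg_eq_0_iff)
    have LY\<sigma>: "L2 (\<lambda>z. Y z * \<sigma> z)" by (rule L2_mult_bounded[OF \<sigma>, where B = 1]) (use cY in auto)
    have "l2 \<eta> \<le> l2 (\<lambda>z. of_real k * (\<gamma> z + Y z * \<sigma> z))"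
    proof (rule l2_mono[OF L2_cmult[OF L2_add[OF L\<gamma> LY\<sigma>]] L\<eta>])
      show "AE z in lborel. norm (\<eta> z) \<le> norm (of_real k * (\<gamma> z + Y z * \<sigma> z))"
        using qc
      proof eventually_elim
        case (elim z)
        have "norm (\<eta> z) \<le> norm (Y z) * (k * norm (g z + \<sigma> z))"
          unfolding \<eta>_def norm_mult using elim by (rule mult_left_mono) simp
        also have "\<dots> = k * norm (Y z * (g z + \<sigma> z))" by (simp add: norm_mult)
        also have "\<dots> = norm (of_real k * (\<gamma> z + Y z * \<sigma> z))"
          using k by (simp add: norm_mult \<gamma>_def distrib_left[symmetric])
        finally show ?case .
      qed
    qed
    also have "\<dots> \<le> k * (l2 \<gamma> + l2 (\<lambda>z. Y z * \<sigma> z))"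
      unfolding l2_cmult using l2_triangle[OF L\<gamma> LY\<sigma>] k by (simp add: mult_left_mono)
    also have "\<dots> \<le> k * (l2 \<gamma> + s)"
      unfolding s_def using k cY(2)
      by (intro mult_left_mono add_left_mono l2_mono[OF \<sigma> LY\<sigma>] AE_I2) (auto simp: norm_mult mult_left_le_one_le)
    finally have y: "l2 \<eta> \<le> k * (l2 \<gamma> + s)" .
    have "(1 - k) * l2 \<gamma> \<le> k * s + 2 * \<bar>K\<bar>" using d y by (simp add: algebra_simps)
    then have x: "l2 \<gamma> \<le> M" using k by (simp add: M_def le_divide_eq mult.commute)
    have "k * (l2 \<gamma> + s) \<le> k * (M + s)" using x k by (intro mult_left_mono) auto
    then have "l2 \<eta> \<le> k * (M + s)" using y by linarith
    then show ?thesis using x L\<gamma> L\<eta> unfolding \<gamma>_def \<eta>_def Y_def by simp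
  qed
  show "L2 g"
    by (rule L2_of_cutoff_bounds[OF L2_loc_measurable[OF wd(2)], of X M]) (use main X(4) in blast)+
  show "L2 h"
    by (rule L2_of_cutoff_bounds[OF L2_loc_measurable[OF wd(3)], of X "k * (M + s)"]) (use main X(4) in blast)+
qed

section \<open>The area theorem\<close>

lemma l2_eq_0_AE: assumes "L2 f" "l2 f = 0" shows "AE z in lborel. f z = 0"
proof -
  have "(\<integral>z. (norm (f z))\<^sup>2 \<partial>lborel) = 0" using assms(2) by (simp flip: l2_power2)
  then have "AE z in lborel. (norm (f z))\<^sup>2 = 0"
    using assms(1) by (subst (asm) integral_nonneg_eq_0_iff_AE) (auto simp: L2_def)
  then show ?thesis by eventually_elim simp
qed

lemma l2_add_power2:
  assumes "L2 f" "L2 g"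
  shows "(l2 (\<lambda>z. f z + g z))\<^sup>2 = (l2 f)\<^sup>2 + (l2 g)\<^sup>2 + 2 * Re (\<integral>z. f z * cnj (g z) \<partial>lborel)"
proof -
  have i: "integrable lborel (\<lambda>z. f z * cnj (f z))" "integrable lborel (\<lambda>z. g z * cnj (g z))"
    "integrable lborel (\<lambda>z. f z * cnj (g z))"
    using assms by (auto intro!: L2_mult_integrable intro: L2_cnj)
  have "of_real ((l2 (\<lambda>z. f z + g z))\<^sup>2) = (\<integral>z. (f z + g z) * cnj (f z + g z) \<partial>lborel)"
    by (rule L2_self_pairing[symmetric])
  also have "(\<lambda>z. (f z + g z) * cnj (f z + g z)) =
      (\<lambda>z. f z * cnj (f z) + g z * cnj (g z) + (f z * cnj (g z) + cnj (f z * cnj (g z))))"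
    by (auto simp: fun_eq_iff algebra_simps)
  also have "(\<integral>z. \<dots> z \<partial>lborel) = of_real ((l2 f)\<^sup>2) + of_real ((l2 g)\<^sup>2) +
      ((\<integral>z. f z * cnj (g z) \<partial>lborel) + cnj (\<integral>z. f z * cnj (g z) \<partial>lborel))"
    using i by (simp add: L2_self_pairing del: complex_cnj_mult)
  finally have "complex_of_real ((l2 (\<lambda>z. f z + g z))\<^sup>2) =
      of_real ((l2 f)\<^sup>2 + (l2 g)\<^sup>2 + 2 * Re (\<integral>z. f z * cnj (g z) \<partial>lborel))"
    unfolding complex_add_cnj by simp
  then show ?thesis unfolding of_real_eq_iff .
qed

lemma AE_open_point:
  assumes "AE z in lborel. P z" "r > 0"
  obtains z :: complex where "z \<in> ball c r" "P z"
proof -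
  have "\<exists>z\<in>ball c r. P z"
  proof (rule ccontr)
    assume none: "\<not> (\<exists>z\<in>ball c r. P z)"
    from assms(1) have "AE z in lborel. z \<notin> ball c r" by eventually_elim (use none in auto)
    then have "ball c r \<in> null_sets lborel" by (subst AE_iff_null_sets) auto
    then have "measure lborel (ball c r) = 0" by (rule measure_eq_0_null_sets)
    then show False using content_ball_gt_0_iff[of c r] assms(2) by (simp add: measure_completion)
  qed
  then show ?thesis using that by blast
qed

lemma l2_cnj: "l2 (\<lambda>z. cnj (f z)) = l2 f"
  by (simp add: l2_def)

lemma power2_bound_from_pairing:
  assumes "pi * x \<le> y * l" "l\<^sup>2 = pi" "x \<ge> 0" "y \<ge> 0" "l \<ge> 0"
  shows "pi * x\<^sup>2 \<le> y\<^sup>2"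
proof -
  have "(pi * x)\<^sup>2 \<le> (y * l)\<^sup>2" using assms by (intro power_mono) auto
  then have "pi\<^sup>2 * x\<^sup>2 \<le> y\<^sup>2 * pi" by (simp add: power_mult_distrib assms(2))
  then have "pi * (pi * x\<^sup>2) \<le> pi * y\<^sup>2" by (simp add: power2_eq_square mult_ac)
  then show ?thesis by (rule mult_left_le_imp_le) simp
qed

text \<open>
  The area theorem with dilatation. Write \<open>s z = 1 / (z - p)\<close>, and let \<open>E\<close> be the exterior of the unit disc \<open>D\<close>, on
  which \<open>\<sigma> = s'\<close>. The norms below are those of \<open>L2\<close>.
  The bilinear identity is used three times: with \<open>cnj G\<close> it gives \<open>\<parallel>g\<parallel> = \<parallel>h\<parallel>\<close>, with \<open>sewn p\<close> the orthogonality of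
  \<open>\<sigma>\<close> to \<open>g\<close> on \<open>E\<close>, and with the conjugate of \<open>sewn 0\<close> the equality of the integral of \<open>g\<close> over \<open>D\<close>,
  which is \<open>\<pi> r 0\<close>, with a pairing of \<open>h\<close> with a function of norm \<open>sqrt \<pi>\<close>.
  So \<open>\<pi> \<bar>r 0\<bar>\<^sup>2\<close> is at most \<open>\<parallel>h\<parallel>\<^sup>2\<close> and at most the energy \<open>\<delta>\<close> of \<open>g\<close> on \<open>D\<close>, while the dilatation bound reads
  \<open>\<parallel>h\<parallel>\<^sup>2 \<le> k\<^sup>2 (\<parallel>h\<parallel>\<^sup>2 - \<delta> + \<parallel>\<sigma>\<parallel>\<^sup>2)\<close>. Together they yield \<open>\<pi> \<bar>r 0\<bar>\<^sup>2 \<le> k\<^sup>2 \<parallel>\<sigma>\<parallel>\<^sup>2\<close>, the non-strict bound. In the case of equality \<open>g = 0\<close>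
  and \<open>h = - r 0 / cnj z\<^sup>2\<close> almost everywhere on \<open>E\<close>, and the dilatation bound fails near \<open>z = - 2\<close>, where
  \<open>\<bar>z - p\<bar> > \<bar>z\<bar>\<close>.
\<close>

theorem area_estimate:
  assumes p: "0 < p" "p < 1" and k: "0 < k" "k < 1"
    and w: "weak_deriv G g h" and B: "\<And>z. norm (G z) \<le> B"
    and r: "r holomorphic_on ball 0 1"
    and inD: "AE z in lborel. norm z < 1 \<longrightarrow> g z = r z \<and> h z = 0"
    and inE: "AE z in lborel. norm z > 1 \<longrightarrow> norm (h z) \<le> k * norm (g z + cnj (sewn_zbar p z))"
  shows "norm (r 0) < k / (1 - p\<^sup>2)"
proof -
  define \<sigma> where "\<sigma> z = cnj (sewn_zbar p z)" for z
  define \<zeta> where "\<zeta> = sewn_zbar 0"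
  have p0: "0 \<le> p" using p by simp
  have L\<sigma>: "L2 \<sigma>" using L2_cnj[OF L2_sewn_zbar[OF p0 p(2)]] by (simp add: \<sigma>_def[abs_def])
  have L\<zeta>: "L2 \<zeta>" "L2 (sewn_z 0)" using L2_sewn_zbar[of 0] L2_sewn_z[of 0] by (auto simp: \<zeta>_def)
  have \<sigma>0: "\<sigma> z = 0" if "norm z \<le> 1" for z using that by (simp add: \<sigma>_def sewn_zbar_def)
  have P: "(l2 \<sigma>)\<^sup>2 = pi / (1 - p\<^sup>2)\<^sup>2" using l2_sewn_zbar[OF p0 p(2)] by (simp add: \<sigma>_def[abs_def] l2_cnj)
  have l\<zeta>: "(l2 \<zeta>)\<^sup>2 = pi" "(l2 (sewn_z 0))\<^sup>2 = pi" using l2_sewn_zbar[of 0] l2_sewn_z[of 0] by (auto simp: \<zeta>_def)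
  have qc: "AE z in lborel. norm (h z) \<le> k * norm (g z + \<sigma> z)"
    using inD inE AE_not_in[OF null_circle[of 1]]
  proof eventually_elim
    case (elim z)
    then show ?case using k by (cases "norm z < 1") (auto simp: \<sigma>_def)
  qed
  have Lg: "L2 g" and Lh: "L2 h"
    using finite_energy[OF w B L\<sigma> _ _ qc] k by auto
  note [measurable] = L2_measurable[OF Lg] L2_measurable[OF Lh]
  define gD where "gD z = (if norm z < 1 then g z else 0)" for z
  define gE where "gE z = (if norm z > 1 then g z else 0)" for z
  have [measurable]: "gD \<in> borel_measurable borel" "gE \<in> borel_measurable borel"
    unfolding gD_def[abs_def] gE_def[abs_def] by measurable
  have LgD: "L2 gD" by (rule L2_bound[OF Lg, where B = 1]) (auto simp: gD_def)
  have LgE: "L2 gE" by (rule L2_bound[OF Lg, where B = 1]) (auto simp: gE_def)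
  have isometry: "(l2 g)\<^sup>2 = (l2 h)\<^sup>2"
  proof -
    have "(\<integral>z. g z * cnj (g z) \<partial>lborel) = (\<integral>z. h z * cnj (h z) \<partial>lborel)"
      by (rule bilinear_identity[OF w weak_deriv_cnj[OF w] Lg Lh L2_cnj[OF Lh] L2_cnj[OF Lg], of B])
         (simp add: B)
    then show ?thesis unfolding L2_self_pairing of_real_eq_iff .
  qed
  have split: "(l2 g)\<^sup>2 = (l2 gD)\<^sup>2 + (l2 gE)\<^sup>2"
  proof -
    have "(\<integral>z. (norm (g z))\<^sup>2 \<partial>lborel) = (\<integral>z. (norm (gD z))\<^sup>2 + (norm (gE z))\<^sup>2 \<partial>lborel)"
    proof (rule integral_cong_AE)
      show "AE z in lborel. (norm (g z))\<^sup>2 = (norm (gD z))\<^sup>2 + (norm (gE z))\<^sup>2"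
        using AE_not_in[OF null_circle[of 1]] by eventually_elim (auto simp: gD_def gE_def)
    qed measurable
    also have "\<dots> = (\<integral>z. (norm (gD z))\<^sup>2 \<partial>lborel) + (\<integral>z. (norm (gE z))\<^sup>2 \<partial>lborel)"
      using LgD LgE by (intro Bochner_Integration.integral_add) (auto simp: L2_def)
    finally show ?thesis by (simp add: l2_power2)
  qed
  have orth: "(\<integral>z. gE z * cnj (\<sigma> z) \<partial>lborel) = 0"
  proof -
    have "(\<lambda>z. gE z * cnj (\<sigma> z)) = (\<lambda>z. g z * sewn_zbar p z)"
      by (auto simp: fun_eq_iff gE_def \<sigma>_def sewn_zbar_def)
    then have "(\<integral>z. gE z * cnj (\<sigma> z) \<partial>lborel) = (\<integral>z. g z * sewn_zbar p z \<partial>lborel)" by simp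
    also have "\<dots> = (\<integral>z. h z * sewn_z p z \<partial>lborel)"
      by (rule bilinear_identity[OF w sewn_weak_deriv[OF p0 p(2)] Lg Lh L2_sewn_z[OF p0 p(2)] L2_sewn_zbar[OF p0 p(2)]
            sewn_bounded[OF p0 p(2)]])
    also have "\<dots> = 0"
    proof (rule integral_eq_zero_AE)
      show "AE z in lborel. h z * sewn_z p z = 0"
        using inD by eventually_elim (auto simp: sewn_z_def)
    qed
    finally show ?thesis .
  qed
  have hbound: "(l2 h)\<^sup>2 \<le> k\<^sup>2 * ((l2 gE)\<^sup>2 + (l2 \<sigma>)\<^sup>2)"
  proof -
    have "l2 h \<le> l2 (\<lambda>z. of_real k * (gE z + \<sigma> z))"
    proof (rule l2_mono[OF L2_cmult[OF L2_add[OF LgE L\<sigma>]] Lh])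
      show "AE z in lborel. norm (h z) \<le> norm (of_real k * (gE z + \<sigma> z))"
        using inD qc AE_not_in[OF null_circle[of 1]]
      proof eventually_elim
        case (elim z)
        then show ?case using k by (cases "norm z < 1") (auto simp: gE_def norm_mult)
      qed
    qed
    then have "l2 h \<le> k * l2 (\<lambda>z. gE z + \<sigma> z)" using k by (simp add: l2_cmult)
    then have "(l2 h)\<^sup>2 \<le> (k * l2 (\<lambda>z. gE z + \<sigma> z))\<^sup>2" by (intro power_mono) auto
    also have "\<dots> = k\<^sup>2 * ((l2 gE)\<^sup>2 + (l2 \<sigma>)\<^sup>2)"
      by (simp add: power_mult_distrib l2_add_power2[OF LgE L\<sigma>] orth)
    finally show ?thesis .
  qed
  have mean: "(\<integral>z. gD z \<partial>lborel) = of_real pi * r 0"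
  proof -
    have eq: "AE z in lborel. gD z = (if norm z < 1 then r z else 0)"
      using inD by eventually_elim (simp add: gD_def)
    have m: "(\<lambda>z. if norm z < 1 then r z else 0) \<in> borel_measurable borel"
      by (intro measurable_on_ball holomorphic_on_imp_continuous_on r)
    have igD: "integrable lborel gD"
      by (rule L2_integrable_bounded_support[OF LgD, of 1]) (simp add: gD_def)
    then have ir: "integrable lborel (\<lambda>z. if norm z < 1 then r z else 0)"
      using integrable_cong_AE[OF _ _ eq] m L2_measurable[OF LgD] by simp
    have "(\<integral>z. gD z \<partial>lborel) = (\<integral>z. (if norm z < 1 then r z else 0) \<partial>lborel)"
      by (rule integral_cong_AE[OF _ _ eq]) (use m L2_measurable[OF LgD] in auto)
    then show ?thesis using mean_value_disc[OF r ir] by simp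
  qed
  have pair_h: "(\<integral>z. h z * cnj (\<zeta> z) \<partial>lborel) = of_real pi * r 0"
  proof -
    have "(\<integral>z. g z * cnj (sewn_z 0 z) \<partial>lborel) = (\<integral>z. h z * cnj (sewn_zbar 0 z) \<partial>lborel)"
      by (rule bilinear_identity[OF w weak_deriv_cnj[OF sewn_weak_deriv[of 0]] Lg Lh, of 1])
         (use sewn_bounded[of 0] L\<zeta> in \<open>auto simp: \<zeta>_def intro: L2_cnj\<close>)
    moreover have "(\<lambda>z. g z * cnj (sewn_z 0 z)) = gD" by (auto simp: fun_eq_iff gD_def sewn_z_def)
    ultimately show ?thesis using mean by (simp add: \<zeta>_def)
  qed
  have D: "pi * (norm (r 0))\<^sup>2 \<le> (l2 gD)\<^sup>2"
  proof (rule power2_bound_from_pairing)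
    have "(\<lambda>z. gD z * sewn_z 0 z) = gD" by (auto simp: fun_eq_iff gD_def sewn_z_def)
    then have "norm (\<integral>z. gD z \<partial>lborel) \<le> l2 gD * l2 (sewn_z 0)"
      using L2_Cauchy_Schwarz[OF LgD L\<zeta>(2)] by simp
    then show "pi * norm (r 0) \<le> l2 gD * l2 (sewn_z 0)" by (simp add: mean norm_mult)
  qed (use l\<zeta> in auto)
  have H: "pi * (norm (r 0))\<^sup>2 \<le> (l2 h)\<^sup>2"
  proof (rule power2_bound_from_pairing)
    show "pi * norm (r 0) \<le> l2 h * l2 \<zeta>"
      using L2_Cauchy_Schwarz[OF Lh L2_cnj[OF L\<zeta>(1)]] by (simp add: pair_h norm_mult l2_cnj)
  qed (use l\<zeta> in auto)
  show ?thesis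
  proof (rule ccontr)
    assume "\<not> norm (r 0) < k / (1 - p\<^sup>2)"
    then have ge: "k / (1 - p\<^sup>2) \<le> norm (r 0)" by simp
    define q where "q = pi * (norm (r 0))\<^sup>2"
    have p2: "0 < 1 - p\<^sup>2" "1 - p\<^sup>2 < 1" using p by (auto simp: abs_square_less_1)
    have "(k / (1 - p\<^sup>2))\<^sup>2 \<le> (norm (r 0))\<^sup>2" using ge k p2 by (intro power_mono) auto
    then have q: "k\<^sup>2 * (l2 \<sigma>)\<^sup>2 \<le> q"
      using mult_left_mono[of "(k / (1 - p\<^sup>2))\<^sup>2" "(norm (r 0))\<^sup>2" pi] by (simp add: P q_def power_divide mult.commute)
    have k2: "0 < k\<^sup>2" "0 < 1 - k\<^sup>2" using k by (auto simp: abs_square_less_1)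
    \<comment> \<open>Two nonnegative terms with nonpositive sum vanish.\<close>
    have gE_eq: "(l2 gE)\<^sup>2 = (l2 h)\<^sup>2 - (l2 gD)\<^sup>2" using isometry split by simp
    have "(1 - k\<^sup>2) * ((l2 h)\<^sup>2 - q) + k\<^sup>2 * ((l2 gD)\<^sup>2 - q) \<le> 0"
      using hbound q unfolding gE_eq by (simp add: algebra_simps)
    moreover have "0 \<le> (1 - k\<^sup>2) * ((l2 h)\<^sup>2 - q)" "0 \<le> k\<^sup>2 * ((l2 gD)\<^sup>2 - q)"
      using k2 D H by (auto simp: q_def)
    ultimately have "(1 - k\<^sup>2) * ((l2 h)\<^sup>2 - q) = 0" "k\<^sup>2 * ((l2 gD)\<^sup>2 - q) = 0" by linarith+
    then have Hq: "(l2 h)\<^sup>2 = q" and Dq: "(l2 gD)\<^sup>2 = q" using k2 by auto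
    have "(l2 gE)\<^sup>2 = 0" using isometry split Hq Dq by simp
    then have gE0: "AE z in lborel. gE z = 0" using l2_eq_0_AE[OF LgE] by simp
    have La: "L2 (\<lambda>z. - r 0 * \<zeta> z)" using L\<zeta>(1) by (rule L2_cmult)
    have "(\<lambda>z. h z * cnj (- r 0 * \<zeta> z)) = (\<lambda>z. - cnj (r 0) * (h z * cnj (\<zeta> z)))"
      by (simp add: fun_eq_iff mult_ac)
    then have "(\<integral>z. h z * cnj (- r 0 * \<zeta> z) \<partial>lborel) = - cnj (r 0) * (\<integral>z. h z * cnj (\<zeta> z) \<partial>lborel)"
      by (simp only: integral_mult_right_zero)
    also have "\<dots> = - of_real (pi * (norm (r 0))\<^sup>2)"
      unfolding pair_h using complex_norm_square[of "r 0"] by (simp add: mult_ac del: of_real_power)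
    finally have "(l2 (\<lambda>z. h z + - r 0 * \<zeta> z))\<^sup>2 = q + (norm (r 0))\<^sup>2 * pi - 2 * q"
      unfolding l2_add_power2[OF Lh La] l2_cmult by (simp add: Hq l\<zeta> power_mult_distrib q_def)
    then have "l2 (\<lambda>z. h z + - r 0 * \<zeta> z) = 0" by (simp add: q_def)
    then have "AE z in lborel. h z + - r 0 * \<zeta> z = 0" using l2_eq_0_AE[OF L2_add[OF Lh La]] by blast
    then have ae: "AE z in lborel. norm z > 1 \<longrightarrow> norm (r 0 * \<zeta> z) \<le> k * norm (\<sigma> z)"
      using gE0 qc by eventually_elim (auto simp: gE_def)
    obtain z where z: "z \<in> ball (- 2) 1" "norm z > 1 \<longrightarrow> norm (r 0 * \<zeta> z) \<le> k * norm (\<sigma> z)"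
      using AE_open_point[OF ae zero_less_one] by blast
    have Rez: "Re z < - 1"
      using abs_Re_le_cmod[of "z + 2"] z(1) by (simp add: dist_norm norm_minus_commute)
    then have nz: "norm z > 1" using abs_Re_le_cmod[of z] by linarith
    have "(norm (cnj z - of_real p))\<^sup>2 = (norm z)\<^sup>2 - 2 * p * Re z + p\<^sup>2"
      unfolding cmod_power2 by (simp add: power2_eq_square algebra_simps)
    moreover have "0 < - (2 * p * Re z)" using p Rez by (simp add: mult_pos_neg)
    ultimately have big: "(norm z)\<^sup>2 < (norm (cnj z - of_real p))\<^sup>2" using zero_le_power2[of p] by linarith
    have z2: "0 < (norm z)\<^sup>2" using nz by auto
    have "k * 1 < norm (r 0)"
    proof -
      have "k < k / (1 - p\<^sup>2)" using k p2 by (simp add: less_divide_eq mult_less_cancel_left2)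
      then show ?thesis using ge by simp
    qed
    have "norm (z - of_real p) = norm (cnj z - of_real p)"
      using complex_mod_cnj[of "z - of_real p"] by simp
    then have "norm (r 0) / (norm z)\<^sup>2 \<le> k / (norm (cnj z - of_real p))\<^sup>2"
      using z(2) nz by (simp add: \<zeta>_def \<sigma>_def sewn_zbar_def norm_mult norm_divide norm_power)
    also have "\<dots> \<le> k / (norm z)\<^sup>2" using big z2 k by (intro frac_le) linarith+
    finally have "norm (r 0) \<le> k" using z2 by (simp add: divide_le_cancel)
    then show False using \<open>k * 1 < norm (r 0)\<close> by simp
  qed
qed

section \<open>Integration by parts for holomorphic functions\<close>

lemma continuous_mult_extend:
  fixes \<kappa> \<phi> :: "complex \<Rightarrow> complex"
  assumes "continuous_on V \<kappa>" "open V" "continuous_on UNIV \<phi>" "closed K" "K \<subseteq> V" "\<And>z. z \<notin> K \<Longrightarrow> \<phi> z = 0"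
  shows "continuous_on UNIV (\<lambda>z. \<kappa> z * \<phi> z)"
proof -
  have "continuous_on (V \<union> - K) (\<lambda>z. \<kappa> z * \<phi> z)"
  proof (rule continuous_on_open_Un)
    show "continuous_on V (\<lambda>z. \<kappa> z * \<phi> z)"
      using assms by (intro continuous_intros) (auto intro: continuous_on_subset)
    have "continuous_on (- K) (\<lambda>z. 0 :: complex)" by simp
    then show "continuous_on (- K) (\<lambda>z. \<kappa> z * \<phi> z)"
      by (rule continuous_on_eq) (use assms(6) in simp)
  qed (use assms in auto)
  moreover have "V \<union> - K = UNIV" using assms by auto
  ultimately show ?thesis by simp
qed

lemma continuous_bounded_support:
  fixes f :: "complex \<Rightarrow> complex"
  assumes "continuous_on UNIV f" "\<And>z. norm z > R \<Longrightarrow> f z = 0"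
  obtains B where "B \<ge> 0" "\<And>z. norm (f z) \<le> B"
proof -
  obtain B where B: "B \<ge> 0" "\<And>z. norm z \<le> R \<Longrightarrow> norm (f z) \<le> B"
    using continuous_bounded_cball[OF assms(1)] by blast
  show ?thesis
  proof (rule that[OF B(1)])
    fix z show "norm (f z) \<le> B" using B assms(2)[of z] by (cases "norm z > R") auto
  qed
qed

lemma integrable_continuous_bounded_support:
  fixes f :: "complex \<Rightarrow> complex"
  assumes "continuous_on UNIV f" "\<And>z. norm z > R \<Longrightarrow> f z = 0"
  shows "integrable lborel f"
proof -
  obtain B where "B \<ge> 0" "\<And>z. norm (f z) \<le> B" using continuous_bounded_support[OF assms] by blast
  then show ?thesis
    using assms(2) borel_measurable_continuous_onI[OF assms(1)] by (intro integrable_bounded_support[of f B R])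
qed

lemma partial_eq_0_outside:
  assumes "closed K" "\<And>z. z \<notin> K \<Longrightarrow> \<phi> z = 0" "z \<notin> K"
  shows "partial_z \<phi> z = 0" "partial_zbar \<phi> z = 0"
proof -
  have "pd v \<phi> z = 0" for v
    by (rule pd_locally_const[where S = "- K" and c = 0]) (use assms in auto)
  then show "partial_z \<phi> z = 0" "partial_zbar \<phi> z = 0" by (simp_all add: partial_z_pd partial_zbar_pd)
qed

text \<open>
  The product of \<open>\<kappa>\<close> and \<open>\<phi>\<close> is continuously differentiable on the whole plane, whatever the values of \<open>\<kappa>\<close> are
  outside of \<open>V\<close>, because \<open>\<phi>\<close> vanishes near the complement of \<open>V\<close>.
\<close>

lemma holomorphic_integration_by_parts:
  assumes \<kappa>: "\<kappa> holomorphic_on V" "open V" and \<phi>: "test \<phi>"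
    and K: "closed K" "K \<subseteq> V" "\<And>z. z \<notin> K \<Longrightarrow> \<phi> z = 0"
  shows "(\<integral>z. \<kappa> z * partial_z \<phi> z \<partial>lborel) = - (\<integral>z. deriv \<kappa> z * \<phi> z \<partial>lborel)"
    "(\<integral>z. \<kappa> z * partial_zbar \<phi> z \<partial>lborel) = 0"
    "integrable lborel (\<lambda>z. \<kappa> z * partial_z \<phi> z)" "integrable lborel (\<lambda>z. deriv \<kappa> z * \<phi> z)"
    "integrable lborel (\<lambda>z. \<kappa> z * partial_zbar \<phi> z)"
proof -
  obtain R where R: "\<And>z. norm z > R \<Longrightarrow> \<phi> z = 0" using \<phi> by (auto simp: test_def)
  have RP: "partial_z \<phi> z = 0" "partial_zbar \<phi> z = 0" if "norm z > R" for z
    using partial_eq_0_outside[of "cball 0 R" \<phi> z] R that by auto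
  note KP = partial_eq_0_outside[OF K(1,3)]
  have ck: "continuous_on V \<kappa>" "continuous_on V (deriv \<kappa>)"
    using \<kappa> by (auto intro!: holomorphic_on_imp_continuous_on holomorphic_deriv)
  note cphi = test_continuous[OF \<phi>] test_continuous[OF test_partial(1)[OF \<phi>]] test_continuous[OF test_partial(2)[OF \<phi>]]
  have c: "continuous_on UNIV (\<lambda>z. \<kappa> z * \<phi> z)" "continuous_on UNIV (\<lambda>z. deriv \<kappa> z * \<phi> z)"
    "continuous_on UNIV (\<lambda>z. \<kappa> z * partial_z \<phi> z)" "continuous_on UNIV (\<lambda>z. \<kappa> z * partial_zbar \<phi> z)"
    using continuous_mult_extend[OF ck(1) \<kappa>(2) cphi(1) K] continuous_mult_extend[OF ck(2) \<kappa>(2) cphi(1) K]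
      continuous_mult_extend[OF ck(1) \<kappa>(2) cphi(2) K(1,2) KP(1)] continuous_mult_extend[OF ck(1) \<kappa>(2) cphi(3) K(1,2) KP(2)]
    by auto
  show i: "integrable lborel (\<lambda>z. \<kappa> z * partial_z \<phi> z)" "integrable lborel (\<lambda>z. deriv \<kappa> z * \<phi> z)"
    "integrable lborel (\<lambda>z. \<kappa> z * partial_zbar \<phi> z)"
    using R RP by (auto intro!: integrable_continuous_bounded_support[of _ R] c)
  let ?A = "\<lambda>z. \<kappa> z * partial_z \<phi> z + deriv \<kappa> z * \<phi> z" and ?B = "\<lambda>z. \<kappa> z * partial_zbar \<phi> z"
  have cA: "continuous_on UNIV ?A" and cB: "continuous_on UNIV ?B" using c by (auto intro!: continuous_intros)
  have der: "((\<lambda>z. \<kappa> z * \<phi> z) has_derivative (\<lambda>h. ?A z * h + ?B z * cnj h)) (at z)" for z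
  proof (cases "z \<in> V")
    case True
    have d1: "(\<kappa> has_derivative (*) (deriv \<kappa> z)) (at z)"
      using holomorphic_derivI[OF \<kappa> True] by (simp add: has_field_derivative_def)
    show ?thesis
      by (rule has_derivative_eq_rhs[OF has_derivative_mult[OF d1 wirtinger_of_differentiable[OF test_differentiable[OF \<phi>]]]])
         (simp add: fun_eq_iff algebra_simps)
  next
    case False
    then have zK: "z \<in> - K" using K by auto
    then have "(\<lambda>h. ?A z * h + ?B z * cnj h) = (\<lambda>h. 0)" using KP K(3) by auto
    moreover have "((\<lambda>z. \<kappa> z * \<phi> z) has_derivative (\<lambda>h. 0)) (at z)"
      by (rule has_derivative_transform_within_open[OF has_derivative_const[of 0] open_Compl[OF K(1)] zK]) (use K(3) in auto)
    ultimately show ?thesis by simp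
  qed
  obtain a where a: "a \<ge> 0" "\<And>z. norm (?A z) \<le> a"
    using continuous_bounded_support[OF cA, of R] R RP by auto
  obtain b where b: "b \<ge> 0" "\<And>z. norm (?B z) \<le> b"
    using continuous_bounded_support[OF cB, of R] RP by auto
  have lip: "(a + b)-lipschitz_on UNIV (\<lambda>z. \<kappa> z * \<phi> z)"
  proof (rule lipschitz_of_bounded_derivative[OF der])
    fix z h
    have "norm (?A z * h + ?B z * cnj h) \<le> norm (?A z) * norm h + norm (?B z) * norm h"
      by (rule order.trans[OF norm_triangle_ineq]) (simp add: norm_mult)
    also have "\<dots> \<le> a * norm h + b * norm h" using a b by (intro add_mono mult_right_mono) auto
    finally show "norm (?A z * h + ?B z * cnj h) \<le> (a + b) * norm h" by (simp add: algebra_simps)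
  qed (use a b in auto)
  have "(\<integral>z. ?A z \<partial>lborel) = 0" "(\<integral>z. ?B z \<partial>lborel) = 0"
    using integral_wirtinger_eq_0(2,4)[where R = R, OF lip _ _ der, of "{}"] R
      borel_measurable_continuous_onI[OF cA] borel_measurable_continuous_onI[OF cB] by auto
  then show "(\<integral>z. \<kappa> z * partial_z \<phi> z \<partial>lborel) = - (\<integral>z. deriv \<kappa> z * \<phi> z \<partial>lborel)"
    "(\<integral>z. \<kappa> z * partial_zbar \<phi> z \<partial>lborel) = 0"
    using i by (simp_all add: add_eq_0_iff2)
qed

section \<open>Quasiconformal extensions\<close>

lemma topspace_riemann_sphere: "topspace riemann_sphere = UNIV"
  by (auto simp: riemann_sphere_def UNIV_option_conv)

text \<open>
  Continuity at the point at infinity bounds the finite values \<open>F z\<close> for large \<open>z\<close>: they are eventually close to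
  \<open>F \<infinity>\<close>, which is finite by injectivity.
\<close>

lemma qc_sphere_map:
  fixes F :: "complex option \<Rightarrow> complex option"
  assumes F: "homeomorphic_map riemann_sphere riemann_sphere F" and Fp: "F (Some q) = None"
  shows "F (Some z) = None \<longleftrightarrow> z = q"
    "continuous_on (- {q}) (\<lambda>z. the (F (Some z)))"
    "\<exists>R B. \<forall>z. norm z > R \<longrightarrow> norm (the (F (Some z))) \<le> B"
proof -
  have inj: "inj F" using homeomorphic_imp_injective_map[OF F] by (simp add: topspace_riemann_sphere)
  show iff: "F (Some z) = None \<longleftrightarrow> z = q" for z using Fp inj by (metis injD option.inject)
  have cF: "continuous_map riemann_sphere riemann_sphere F" using F by (rule homeomorphic_imp_continuous_map)
  have pre: "openin riemann_sphere {x. F x \<in> Some ` W}" if "open W" for W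
  proof -
    have "openin riemann_sphere (Some ` W)" using that by (simp add: riemann_sphere_def)
    from openin_continuous_map_preimage[OF cF this] show ?thesis by (simp add: topspace_riemann_sphere)
  qed
  have cS: "continuous_map euclidean riemann_sphere Some"
    unfolding riemann_sphere_def by (rule continuous_map_Some)
  have pre': "open {z. F (Some z) \<in> Some ` W}" if "open W" for W
    using openin_continuous_map_preimage[OF cS pre[OF that]] by simp
  show "continuous_on (- {q}) (\<lambda>z. the (F (Some z)))"
  proof (subst continuous_on_open_vimage)
    show "\<forall>W. open W \<longrightarrow> open ((\<lambda>z. the (F (Some z))) -` W \<inter> - {q})"
    proof (intro allI impI)
      fix W :: "complex set" assume W: "open W"
      have "(\<lambda>z. the (F (Some z))) -` W \<inter> - {q} = {z. F (Some z) \<in> Some ` W}"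
      proof (intro set_eqI)
        fix z
        show "z \<in> (\<lambda>z. the (F (Some z))) -` W \<inter> - {q} \<longleftrightarrow> z \<in> {z. F (Some z) \<in> Some ` W}"
          using iff[of z] by (cases "F (Some z)") auto
      qed
      then show "open ((\<lambda>z. the (F (Some z))) -` W \<inter> - {q})" using pre'[OF W] by simp
    qed
  qed auto
  \<comment> \<open>A neighbourhood of \<open>\<infinity>\<close> is the complement of a compact set.\<close>
  have "F None \<noteq> None" using Fp inj by (metis injD option.distinct(1))
  then obtain c where c: "F None = Some c" by auto
  have "openin riemann_sphere {x. F x \<in> Some ` ball c 1}" by (rule pre) simp
  moreover have "None \<in> {x. F x \<in> Some ` ball c 1}" using c by auto
  ultimately obtain C where C: "compact C" "{x. F x \<in> Some ` ball c 1} = insert None (Some ` (UNIV - C))"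
    unfolding riemann_sphere_def openin_Alexandroff_compactification
    by auto
  obtain R where R: "\<And>z. z \<in> C \<Longrightarrow> norm z \<le> R" using C(1) compact_imp_bounded bounded_iff by metis
  have "norm (the (F (Some z))) \<le> norm c + 1" if "norm z > R" for z
  proof -
    have "Some z \<in> insert None (Some ` (UNIV - C))" using R[of z] that by auto
    then have "F (Some z) \<in> Some ` ball c 1" using C(2) by blast
    then obtain w where "F (Some z) = Some w" "dist c w < 1" by auto
    then show ?thesis using norm_triangle_ineq2[of w c] by (simp add: dist_norm norm_minus_commute)
  qed
  then show "\<exists>R B. \<forall>z. norm z > R \<longrightarrow> norm (the (F (Some z))) \<le> B" by blast
qed

lemma lebesgue_borel_version:
  fixes f :: "complex \<Rightarrow> complex"
  assumes "f \<in> borel_measurable lebesgue"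
  obtains f' where "f' \<in> borel_measurable borel" "AE z in lborel. f z = f' z"
proof -
  have m: "(\<lambda>z. Re (f z)) \<in> borel_measurable lebesgue" "(\<lambda>z. Im (f z)) \<in> borel_measurable lebesgue"
    using assms by measurable
  obtain u v where u: "u \<in> borel_measurable lborel" "AE z in lborel. Re (f z) = u z"
    and v: "v \<in> borel_measurable lborel" "AE z in lborel. Im (f z) = v z"
    using completion_ex_borel_measurable_real[OF m(1)] completion_ex_borel_measurable_real[OF m(2)] by blast
  show ?thesis
  proof (rule that[of "\<lambda>z. of_real (u z) + \<i> * of_real (v z)"])
    show "(\<lambda>z. complex_of_real (u z) + \<i> * of_real (v z)) \<in> borel_measurable borel" using u(1) v(1) by simp
    show "AE z in lborel. f z = of_real (u z) + \<i> * of_real (v z)"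
      using u(2) v(2) by eventually_elim (metis complex_eq)
  qed
qed

lemma integral_lebesgue_on_borel_version:
  fixes q q' :: "complex \<Rightarrow> complex"
  assumes U: "open U" and q: "(\<lambda>z. if z \<in> U then q z else 0) \<in> borel_measurable lebesgue"
    and q': "q' \<in> borel_measurable borel" and ae: "AE z in lborel. (if z \<in> U then q z else 0) = q' z"
  shows "(\<integral>z. q z \<partial>lebesgue_on U) = (\<integral>z. q' z \<partial>lborel)"
proof -
  have "(\<integral>z. q z \<partial>lebesgue_on U) = (\<integral>z. indicator U z *\<^sub>R q z \<partial>lebesgue)"
    using U by (intro integral_restrict_space) auto
  also have "\<dots> = (\<integral>z. (if z \<in> U then q z else 0) \<partial>lebesgue)"
    by (intro Bochner_Integration.integral_cong) (auto simp: indicator_def)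
  also have "\<dots> = (\<integral>z. q' z \<partial>lebesgue)"
    using q q' ae by (intro integral_cong_AE) (auto intro: measurable_completion AE_completion)
  also have "\<dots> = (\<integral>z. q' z \<partial>lborel)" using q' by (intro integral_completion) simp
  finally show ?thesis .
qed

text \<open>
  Fubini's theorem and translations are more convenient with Borel functions and \<open>lborel\<close> than with their completion.
\<close>

lemma locally_L2_borel_version:
  assumes U: "open U" and g: "locally_L2_on U g"
  obtains g' where "g' \<in> borel_measurable borel" "AE z in lborel. (if z \<in> U then g z else 0) = g' z"
    "\<And>K. compact K \<Longrightarrow> K \<subseteq> U \<Longrightarrow> integrable lborel (\<lambda>z. indicator K z * (norm (g' z))\<^sup>2)"
proof -
  have m: "(\<lambda>z. if z \<in> U then g z else 0) \<in> borel_measurable lebesgue"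
    using g U by (simp add: locally_L2_on_def borel_measurable_if)
  obtain g' where g': "g' \<in> borel_measurable borel" "AE z in lborel. (if z \<in> U then g z else 0) = g' z"
    using lebesgue_borel_version[OF m] .
  show ?thesis
  proof (rule that[OF g'])
    fix K assume K: "compact K" "K \<subseteq> U"
    then have Ks: "K \<in> sets borel" by (simp add: borel_compact)
    have "integrable (lebesgue_on K) (\<lambda>z. (norm (g z))\<^sup>2)" using g K by (auto simp: locally_L2_on_def)
    then have i: "integrable lebesgue (\<lambda>z. indicator K z *\<^sub>R (norm (g z))\<^sup>2)"
      using Ks by (subst (asm) integrable_restrict_space) auto
    have m': "(\<lambda>z. indicator K z * (norm (g' z))\<^sup>2) \<in> borel_measurable lborel" using g'(1) Ks by measurable
    have "AE z in lebesgue. indicator K z *\<^sub>R (norm (g z))\<^sup>2 = indicator K z * (norm (g' z))\<^sup>2"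
      using AE_completion[OF g'(2)] by eventually_elim (use K in \<open>auto simp: indicator_def\<close>)
    then have "integrable lebesgue (\<lambda>z. indicator K z * (norm (g' z))\<^sup>2)"
      by (rule integrable_cong_AE_imp[OF i measurable_completion[OF m']])
    then show "integrable lborel (\<lambda>z. indicator K z * (norm (g' z))\<^sup>2)"
      using integrable_completion[OF m'] by simp
  qed
qed

lemma test_function_onI:
  assumes \<phi>: "test \<phi>" and K: "closed K" "K \<subseteq> U" "\<And>z. z \<notin> K \<Longrightarrow> \<phi> z = 0"
  shows "test_function_on U \<phi>"
proof -
  obtain R where R: "\<And>z. norm z > R \<Longrightarrow> \<phi> z = 0" using \<phi> by (auto simp: test_def)
  have "{z. \<phi> z \<noteq> 0} \<subseteq> cball 0 R" using R by (force simp: not_less[symmetric])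
  then have "bounded {z. \<phi> z \<noteq> 0}" using bounded_cball bounded_subset by blast
  then have "compact (closure {z. \<phi> z \<noteq> 0})" by simp
  moreover have "closure {z. \<phi> z \<noteq> 0} \<subseteq> K" by (rule closure_minimal) (use K in auto)
  ultimately show ?thesis using \<phi> K(2) by (auto simp: test_function_on_def test_def smooth_def)
qed

text \<open>
  The distributional derivatives of a quasiconformal extension, expressed by Borel functions \<open>g\<close>, \<open>h\<close> and integrals over
  the plane. The extension omits the value \<open>\<infinity>\<close> on the plane except at the pole, so it is a continuous
  complex function there.
\<close>

lemma Sigma_qc_data:
  assumes p: "0 < p" "p < 1" and f: "f \<in> Sigma_qc k p"
  obtains \<Phi> g h :: "complex \<Rightarrow> complex" and R B where
    "continuous_on (- {of_real p}) \<Phi>" "\<And>z. norm z > R \<Longrightarrow> norm (\<Phi> z) \<le> B"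
    "\<And>z. z \<in> ball 0 1 - {of_real p} \<Longrightarrow> \<Phi> z = f z"
    "g \<in> borel_measurable borel" "h \<in> borel_measurable borel"
    "\<And>K. compact K \<Longrightarrow> K \<subseteq> - {of_real p} \<Longrightarrow> integrable lborel (\<lambda>z. indicator K z * (norm (g z))\<^sup>2)"
    "\<And>K. compact K \<Longrightarrow> K \<subseteq> - {of_real p} \<Longrightarrow> integrable lborel (\<lambda>z. indicator K z * (norm (h z))\<^sup>2)"
    "\<And>\<phi> K. test \<phi> \<Longrightarrow> closed K \<Longrightarrow> K \<subseteq> - {of_real p} \<Longrightarrow> (\<And>z. z \<notin> K \<Longrightarrow> \<phi> z = 0) \<Longrightarrow>
       (\<integral>z. \<Phi> z * partial_z \<phi> z \<partial>lborel) = - (\<integral>z. g z * \<phi> z \<partial>lborel)"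
    "\<And>\<phi> K. test \<phi> \<Longrightarrow> closed K \<Longrightarrow> K \<subseteq> - {of_real p} \<Longrightarrow> (\<And>z. z \<notin> K \<Longrightarrow> \<phi> z = 0) \<Longrightarrow>
       (\<integral>z. \<Phi> z * partial_zbar \<phi> z \<partial>lborel) = - (\<integral>z. h z * \<phi> z \<partial>lborel)"
    "AE z in lborel. norm (h z) \<le> k * norm (g z)"
proof -
  let ?p = "complex_of_real p"
  obtain F where qF: "quasiconformal k F" and Ff: "\<And>z. z \<in> ball 0 1 \<Longrightarrow> F (Some z) = sphere_lift f z"
    and fS: "f \<in> Sigma_class p" using f by (auto simp: Sigma_qc_def)
  have pole: "is_pole f ?p" using fS by (simp add: Sigma_class_def)
  have p1: "?p \<in> ball 0 1" using p by simp
  have Fp: "F (Some ?p) = None" using Ff[OF p1] pole by (simp add: sphere_lift_def)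
  have hom: "homeomorphic_map riemann_sphere riemann_sphere F" using qF by (simp add: quasiconformal_def)
  define \<Phi> where "\<Phi> z = the (F (Some z))" for z
  define U where "U = - {?p}"
  have oU: "open U" by (simp add: U_def open_Compl)
  have Ueq: "{z. F (Some z) \<noteq> None} = U" using qc_sphere_map(1)[OF hom Fp] by (auto simp: U_def)
  have c\<Phi>: "continuous_on U \<Phi>" using qc_sphere_map(2)[OF hom Fp] by (simp add: \<Phi>_def[abs_def] U_def)
  obtain R B where RB: "\<And>z. norm z > R \<Longrightarrow> norm (\<Phi> z) \<le> B"
    using qc_sphere_map(3)[OF hom Fp] by (auto simp: \<Phi>_def)
  have \<Phi>f: "\<Phi> z = f z" if "z \<in> ball 0 1 - {?p}" for z
  proof -
    have "F (Some z) \<noteq> None" using qc_sphere_map(1)[OF hom Fp] that by auto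
    then show ?thesis using Ff[of z] that by (auto simp: \<Phi>_def sphere_lift_def split: if_splits)
  qed
  obtain g h where g: "locally_L2_on U g" and h: "locally_L2_on U h"
    and dg: "distrib_partial_z_on U \<Phi> g" and dh: "distrib_partial_zbar_on U \<Phi> h"
    and ae: "AE z in lebesgue_on U. norm (h z) \<le> k * norm (g z)"
    using qF unfolding quasiconformal_def Let_def Ueq \<Phi>_def[abs_def, symmetric] by blast
  obtain g' where g': "g' \<in> borel_measurable borel" "AE z in lborel. (if z \<in> U then g z else 0) = g' z"
    "\<And>K. compact K \<Longrightarrow> K \<subseteq> U \<Longrightarrow> integrable lborel (\<lambda>z. indicator K z * (norm (g' z))\<^sup>2)"
    using locally_L2_borel_version[OF oU g] by blast
  obtain h' where h': "h' \<in> borel_measurable borel" "AE z in lborel. (if z \<in> U then h z else 0) = h' z"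
    "\<And>K. compact K \<Longrightarrow> K \<subseteq> U \<Longrightarrow> integrable lborel (\<lambda>z. indicator K z * (norm (h' z))\<^sup>2)"
    using locally_L2_borel_version[OF oU h] by blast
  have right: "(\<integral>z. q z * \<phi> z \<partial>lebesgue_on U) = (\<integral>z. q' z * \<phi> z \<partial>lborel)"
    if q: "locally_L2_on U q" "q' \<in> borel_measurable borel" "AE z in lborel. (if z \<in> U then q z else 0) = q' z"
      and \<phi>: "test \<phi>" for q q' \<phi> :: "complex \<Rightarrow> complex"
  proof (rule integral_lebesgue_on_borel_version[OF oU])
    have "(\<lambda>z. if z \<in> U then q z else 0) \<in> borel_measurable lebesgue"
      using q(1) oU by (simp add: locally_L2_on_def borel_measurable_if)
    moreover have "\<phi> \<in> borel_measurable lebesgue"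
      using test_measurable[OF \<phi>] by (intro measurable_completion) simp
    ultimately have "(\<lambda>z. (if z \<in> U then q z else 0) * \<phi> z) \<in> borel_measurable lebesgue" by measurable
    moreover have "(\<lambda>z. (if z \<in> U then q z else 0) * \<phi> z) = (\<lambda>z. if z \<in> U then q z * \<phi> z else 0)" by auto
    ultimately show "(\<lambda>z. if z \<in> U then q z * \<phi> z else 0) \<in> borel_measurable lebesgue" by simp
    show "(\<lambda>z. q' z * \<phi> z) \<in> borel_measurable borel" using q(2) test_measurable[OF \<phi>] by measurable
    show "AE z in lborel. (if z \<in> U then q z * \<phi> z else 0) = q' z * \<phi> z"
      using q(3) by eventually_elim (auto split: if_splits)
  qed
  have left: "(\<integral>z. \<Phi> z * \<phi> z \<partial>lebesgue_on U) = (\<integral>z. \<Phi> z * \<phi> z \<partial>lborel)"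
    if \<phi>: "test \<phi>" "closed K" "K \<subseteq> U" "\<And>z. z \<notin> K \<Longrightarrow> \<phi> z = 0" for \<phi> K
  proof (rule integral_lebesgue_on_borel_version[OF oU])
    have m: "(\<lambda>z. \<Phi> z * \<phi> z) \<in> borel_measurable borel"
      by (rule borel_measurable_continuous_onI[OF continuous_mult_extend[OF c\<Phi> oU test_continuous[OF \<phi>(1)] \<phi>(2,3,4)]])
    have eq: "(\<lambda>z. if z \<in> U then \<Phi> z * \<phi> z else 0) = (\<lambda>z. \<Phi> z * \<phi> z)" using \<phi>(3,4) by (intro ext) auto
    show "(\<lambda>z. if z \<in> U then \<Phi> z * \<phi> z else 0) \<in> borel_measurable lebesgue"
      unfolding eq using m by (intro measurable_completion) simp
    show "(\<lambda>z. \<Phi> z * \<phi> z) \<in> borel_measurable borel" by (rule m)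
    show "AE z in lborel. (if z \<in> U then \<Phi> z * \<phi> z else 0) = \<Phi> z * \<phi> z" using fun_cong[OF eq] by auto
  qed
  show ?thesis
  proof (rule that[of \<Phi> R B g' h'])
    show "continuous_on (- {?p}) \<Phi>" using c\<Phi> by (simp add: U_def)
    show "integrable lborel (\<lambda>z. indicator K z * (norm (g' z))\<^sup>2)" if "compact K" "K \<subseteq> - {?p}" for K
      using g'(3) that by (simp add: U_def)
    show "integrable lborel (\<lambda>z. indicator K z * (norm (h' z))\<^sup>2)" if "compact K" "K \<subseteq> - {?p}" for K
      using h'(3) that by (simp add: U_def)
    fix \<phi> K assume \<phi>: "test \<phi>" and K: "closed K" "K \<subseteq> - {?p}" "\<And>z. z \<notin> K \<Longrightarrow> \<phi> z = 0"
    have KU: "K \<subseteq> U" using K by (simp add: U_def)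
    have tf: "test_function_on U \<phi>" by (rule test_function_onI[OF \<phi> K(1) KU K(3)])
    note P0 = partial_eq_0_outside[OF K(1,3)]
    show "(\<integral>z. \<Phi> z * partial_z \<phi> z \<partial>lborel) = - (\<integral>z. g' z * \<phi> z \<partial>lborel)"
      using dg tf left[OF test_partial(1)[OF \<phi>] K(1) KU P0(1)] right[OF g g'(1,2) \<phi>]
      by (simp add: distrib_partial_z_on_def)
    show "(\<integral>z. \<Phi> z * partial_zbar \<phi> z \<partial>lborel) = - (\<integral>z. h' z * \<phi> z \<partial>lborel)"
      using dh tf left[OF test_partial(2)[OF \<phi>] K(1) KU P0(2)] right[OF h h'(1,2) \<phi>]
      by (simp add: distrib_partial_zbar_on_def)
  next
    have "AE z in lebesgue. z \<in> U \<longrightarrow> norm (h z) \<le> k * norm (g z)"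
      using ae oU by (subst (asm) AE_restrict_space_iff) auto
    then have "AE z in lborel. z \<in> U \<longrightarrow> norm (h z) \<le> k * norm (g z)" by (simp add: AE_completion_iff)
    then show "AE z in lborel. norm (h' z) \<le> k * norm (g' z)"
      using g'(2) h'(2) by eventually_elim (auto split: if_splits)
  qed (use RB \<Phi>f g' h' in auto)
qed

lemma partial_add:
  assumes "f differentiable (at z)" "g differentiable (at z)"
  shows "partial_z (\<lambda>z. f z + g z) z = partial_z f z + partial_z g z"
    "partial_zbar (\<lambda>z. f z + g z) z = partial_zbar f z + partial_zbar g z"
  using assms by (simp_all add: partial_z_pd partial_zbar_pd pd_add algebra_simps add_divide_distrib)

section \<open>The regular part of the extension\<close>

text \<open>
  Weak derivatives are unique, by the fundamental lemma. Since \<open>deriv r\<close> need not be square-integrable up to the unit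
  circle a priori, this is applied on smaller discs.
\<close>

lemma weak_deriv_on_disc:
  assumes w: "weak_deriv G g h" and r: "r holomorphic_on ball 0 1" and Gr: "\<And>z. norm z < 1 \<Longrightarrow> G z = r z"
  shows "AE z in lborel. norm z < 1 \<longrightarrow> g z = deriv r z \<and> h z = 0"
proof -
  have by_parts: "(\<integral>z. g z * \<phi> z \<partial>lborel) = (\<integral>z. deriv r z * \<phi> z \<partial>lborel)" "(\<integral>z. h z * \<phi> z \<partial>lborel) = 0"
    "integrable lborel (\<lambda>z. deriv r z * \<phi> z)"
    if \<phi>: "test \<phi>" "s < 1" "\<And>z. norm z > s \<Longrightarrow> \<phi> z = 0" for \<phi> s
  proof -
    have K: "closed (cball (0::complex) s)" "cball (0::complex) s \<subseteq> ball 0 1" "\<And>z. z \<notin> cball 0 s \<Longrightarrow> \<phi> z = 0"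
      using \<phi> by auto
    note P0 = partial_eq_0_outside[OF K(1,3)]
    have ibp: "(\<integral>z. r z * partial_z \<phi> z \<partial>lborel) = - (\<integral>z. deriv r z * \<phi> z \<partial>lborel)"
      "(\<integral>z. r z * partial_zbar \<phi> z \<partial>lborel) = 0" "integrable lborel (\<lambda>z. deriv r z * \<phi> z)"
      by (rule holomorphic_integration_by_parts[OF r open_ball \<phi>(1) K(1,2)], erule K(3))+
    have eq: "G z * partial_z \<phi> z = r z * partial_z \<phi> z \<and> G z * partial_zbar \<phi> z = r z * partial_zbar \<phi> z" for z
    proof (cases "norm z < 1")
      case False
      then have "z \<notin> cball 0 s" using \<phi>(2) by simp
      then show ?thesis using P0 by simp
    qed (simp add: Gr)
    show "(\<integral>z. g z * \<phi> z \<partial>lborel) = (\<integral>z. deriv r z * \<phi> z \<partial>lborel)"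
      using weak_derivD(4)[OF w \<phi>(1)] ibp(1) by (simp only: eq neg_equal_iff_equal)
    show "(\<integral>z. h z * \<phi> z \<partial>lborel) = 0"
      using weak_derivD(5)[OF w \<phi>(1)] ibp(2) by (simp only: eq) simp
    show "integrable lborel (\<lambda>z. deriv r z * \<phi> z)" by (rule ibp(3))
  qed
  have h0: "AE z in lborel. norm z < 1 \<longrightarrow> h z = 0"
    by (rule fundamental_lemma[OF weak_derivD(3)[OF w]]) (use by_parts(2) in blast)
  have g0: "AE z in lborel. norm z < t \<longrightarrow> g z = deriv r z" if t: "t < 1" for t
  proof -
    have cd: "continuous_on (ball 0 1) (deriv r)"
      by (intro holomorphic_on_imp_continuous_on holomorphic_deriv r open_ball)
    define d where "d z = (if norm z < t then deriv r z else 0)" for z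
    have m: "d \<in> borel_measurable borel" unfolding d_def[abs_def]
      by (intro measurable_on_ball continuous_on_subset[OF cd]) (use t in auto)
    have "compact (deriv r ` cball 0 t)"
      by (intro compact_continuous_image continuous_on_subset[OF cd]) (use t in auto)
    then obtain b where b: "\<And>z. z \<in> cball 0 t \<Longrightarrow> norm (deriv r z) \<le> b"
      using compact_imp_bounded bounded_iff by (metis imageI)
    have Ld: "L2 d"
    proof (rule L2_bounded_support[OF m])
      show "norm (d z) \<le> \<bar>b\<bar>" for z using b[of z] by (cases "norm z < t") (auto simp: d_def)
      show "d z = 0" if "norm z > t" for z using that by (simp add: d_def)
    qed
    have "AE z in lborel. norm z < t \<longrightarrow> g z + - d z = 0"
    proof (rule fundamental_lemma)
      show "L2_loc (\<lambda>z. g z + - d z)"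
        by (intro L2_loc_add weak_derivD(2)[OF w] L2_imp_L2_loc L2_uminus Ld)
      fix \<phi> s assume \<phi>: "test \<phi>" "s < t" "\<And>z. norm z > s \<Longrightarrow> \<phi> z = 0"
      have s1: "s < 1" using \<phi>(2) t by simp
      have eq: "(\<lambda>z. d z * \<phi> z) = (\<lambda>z. deriv r z * \<phi> z)"
        using \<phi>(2,3) by (auto simp: fun_eq_iff d_def)
      have pt: "(g z + - d z) * \<phi> z = g z * \<phi> z - deriv r z * \<phi> z" for z
        using fun_cong[OF eq, of z] by (auto simp: left_diff_distrib)
      have "(\<integral>z. (g z + - d z) * \<phi> z \<partial>lborel) = (\<integral>z. g z * \<phi> z - deriv r z * \<phi> z \<partial>lborel)"
        by (simp only: pt)
      also have "\<dots> = 0"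
        using by_parts[OF \<phi>(1) s1 \<phi>(3)] L2_loc_test_integrable[OF weak_derivD(2)[OF w] \<phi>(1)] by simp
      finally show "(\<integral>z. (g z + - d z) * \<phi> z \<partial>lborel) = 0" .
    qed
    then show ?thesis by eventually_elim (simp add: d_def)
  qed
  have "AE z in lborel. \<forall>n. norm z < 1 - 1 / real (Suc n) \<longrightarrow> g z = deriv r z"
    unfolding AE_all_countable by (intro allI g0) simp
  then show ?thesis
    using h0
  proof eventually_elim
    case (elim z)
    show ?case
    proof (intro impI conjI)
      assume z: "norm z < 1"
      then obtain n where "1 / real (Suc n) < 1 - norm z" using nat_approx_posE[of "1 - norm z"] by auto
      then have "norm z < 1 - 1 / real (Suc n)" by linarith
      then show "g z = deriv r z" using elim(1) by blast
      show "h z = 0" using elim(2) z by blast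
    qed
  qed
qed

text \<open>
  The series converges at \<open>q\<close> as well, since it converges at points of larger modulus.
\<close>

lemma power_series_on_punctured_disc:
  fixes a :: "nat \<Rightarrow> complex"
  assumes q: "norm q < 1" and s: "\<And>z. z \<in> ball 0 1 - {q} \<Longrightarrow> (\<lambda>n. a n * z ^ n) sums u z"
  obtains r where "r holomorphic_on ball 0 1" "\<And>z. z \<in> ball 0 1 - {q} \<Longrightarrow> r z = u z" "deriv r 0 = a 1"
proof -
  have larger: "\<exists>w\<in>ball 0 1 - {q}. norm z < norm w" if "norm z < 1" for z :: complex
  proof -
    have "max (norm z) (norm q) < 1" using that q by simp
    then obtain \<rho> where \<rho>: "max (norm z) (norm q) < \<rho>" "\<rho> < 1" using dense by blast
    have "\<rho> \<ge> 0" using \<rho>(1) norm_ge_zero[of q] by linarith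
    then have "norm (complex_of_real \<rho>) = \<rho>" by simp
    then show ?thesis using \<rho> by (intro bexI[of _ "of_real \<rho>"]) auto
  qed
  have sm: "summable (\<lambda>n. a n * z ^ n)" if z: "norm z < 1" for z
  proof -
    obtain w where w: "w \<in> ball 0 1 - {q}" "norm z < norm w" using larger[OF z] by blast
    then show ?thesis using powser_inside[OF sums_summable[OF s[OF w(1)]] w(2)] by blast
  qed
  define r where "r z = (\<Sum>n. a n * z ^ n)" for z
  have "r holomorphic_on ball 0 1"
    by (rule power_series_holomorphic[of _ _ a]) (use sm in \<open>simp add: r_def summable_sums\<close>)
  moreover have "r z = u z" if "z \<in> ball 0 1 - {q}" for z
    unfolding r_def by (rule sums_unique[OF s[OF that], symmetric])
  moreover have "deriv r 0 = a 1"
  proof (rule DERIV_imp_deriv)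
    have "summable (\<lambda>n. a n * (1 / 2 :: complex) ^ n)" by (rule sm) (simp add: norm_divide)
    then have "((\<lambda>z. \<Sum>n. a n * z ^ n) has_field_derivative (\<Sum>n. diffs a n * 0 ^ n)) (at 0)"
      by (rule termdiffs_strong) simp
    then show "(r has_field_derivative a 1) (at 0)" by (simp add: r_def[abs_def] powser_zero diffs_def)
  qed
  ultimately show ?thesis by (rule that)
qed

text \<open>
  Subtracting \<open>1 / (z - p)\<close> from the extension removes the pole: the difference \<open>G\<close> continues the power series \<open>r\<close> and
  is bounded on the plane. The distributional derivatives of the extension are given only away from the pole, those
  of \<open>r\<close> on the disc, and a partition of unity \<open>\<beta> + \<alpha>\<close> glues them; the glued functions \<open>g1\<close> and \<open>h1\<close> are weak
  derivatives on the whole plane because every test function splits accordingly.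
\<close>

lemma weak_deriv_regular_part:
  assumes p: "0 < p" "p < 1" and f: "f \<in> Sigma_qc k p"
    and r: "r holomorphic_on ball 0 1"
    and fr: "\<And>z. z \<in> ball 0 1 - {of_real p} \<Longrightarrow> r z = f z - 1 / (z - of_real p)"
  obtains G g h B where "weak_deriv G g h" "\<And>z. norm (G z) \<le> B" "\<And>z. norm z < 1 \<Longrightarrow> G z = r z"
    "AE z in lborel. norm z > 1 \<longrightarrow> norm (h z) \<le> k * norm (g z - 1 / (z - of_real p)\<^sup>2)"
proof (rule Sigma_qc_data[OF p f])
  let ?p = "complex_of_real p"
  fix \<Phi> g h :: "complex \<Rightarrow> complex" and R B :: real
  assume \<Phi>: "continuous_on (- {?p}) \<Phi>" "\<And>z. norm z > R \<Longrightarrow> norm (\<Phi> z) \<le> B"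
      "\<And>z. z \<in> ball 0 1 - {?p} \<Longrightarrow> \<Phi> z = f z"
    and m: "g \<in> borel_measurable borel" "h \<in> borel_measurable borel"
    and loc: "\<And>K. compact K \<Longrightarrow> K \<subseteq> - {?p} \<Longrightarrow> integrable lborel (\<lambda>z. indicator K z * (norm (g z))\<^sup>2)"
      "\<And>K. compact K \<Longrightarrow> K \<subseteq> - {?p} \<Longrightarrow> integrable lborel (\<lambda>z. indicator K z * (norm (h z))\<^sup>2)"
    and dz: "\<And>\<phi> K. test \<phi> \<Longrightarrow> closed K \<Longrightarrow> K \<subseteq> - {?p} \<Longrightarrow> (\<And>z. z \<notin> K \<Longrightarrow> \<phi> z = 0) \<Longrightarrow>
       (\<integral>z. \<Phi> z * partial_z \<phi> z \<partial>lborel) = - (\<integral>z. g z * \<phi> z \<partial>lborel)"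
    and dzbar: "\<And>\<phi> K. test \<phi> \<Longrightarrow> closed K \<Longrightarrow> K \<subseteq> - {?p} \<Longrightarrow> (\<And>z. z \<notin> K \<Longrightarrow> \<phi> z = 0) \<Longrightarrow>
       (\<integral>z. \<Phi> z * partial_zbar \<phi> z \<partial>lborel) = - (\<integral>z. h z * \<phi> z \<partial>lborel)"
    and qc: "AE z in lborel. norm (h z) \<le> k * norm (g z)"
  define s where "s z = 1 / (z - ?p)" for z
  define G where "G z = (if z = ?p then r z else \<Phi> z - s z)" for z
  have Gr: "G z = r z" if "norm z < 1" for z
    using \<Phi>(3)[of z] fr[of z] that by (auto simp: G_def s_def)
  have s_hol: "s holomorphic_on - {?p}" unfolding s_def[abs_def] by (intro holomorphic_intros) auto
  have sc: "continuous_on (- {?p}) s" using s_hol by (rule holomorphic_on_imp_continuous_on)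
  have ds: "deriv s z = - 1 / (z - ?p)\<^sup>2" if "z \<noteq> ?p" for z
    unfolding s_def[abs_def]
    by (rule DERIV_imp_deriv) (use that in \<open>auto intro!: derivative_eq_intros simp: power2_eq_square\<close>)
  have op: "open (- {?p})" by (simp add: open_Compl)
  have Gc: "continuous_on UNIV G"
  proof -
    have "continuous_on (ball 0 1 \<union> - {?p}) G"
    proof (rule continuous_on_open_Un[OF open_ball op])
      show "continuous_on (ball 0 1) G"
        by (rule continuous_on_eq[OF holomorphic_on_imp_continuous_on[OF r]]) (simp add: Gr)
      have "continuous_on (- {?p}) (\<lambda>z. \<Phi> z - s z)" by (intro continuous_intros \<Phi> sc)
      then show "continuous_on (- {?p}) G" by (rule continuous_on_eq) (simp add: G_def)
    qed
    moreover have "ball 0 1 \<union> - {?p} = UNIV" using p by auto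
    ultimately show ?thesis by simp
  qed
  obtain B' where GB: "\<And>z. norm (G z) \<le> B'"
  proof -
    obtain A where A: "A \<ge> 0" "\<And>z. norm z \<le> max R 2 \<Longrightarrow> norm (G z) \<le> A"
      using continuous_bounded_cball[OF Gc] by blast
    have "norm (G z) \<le> max A (B + 1)" for z
    proof (cases "norm z \<le> max R 2")
      case False
      then have z: "norm z > R" "norm z > 2" by auto
      have "norm (z - ?p) \<ge> 1" using norm_triangle_ineq2[of z ?p] z(2) p by simp
      then have "norm (s z) \<le> 1" by (simp add: s_def norm_divide divide_le_eq)
      then have "norm (\<Phi> z - s z) \<le> B + 1"
        using norm_triangle_ineq4[of "\<Phi> z" "s z"] \<Phi>(2)[OF z(1)] by linarith
      moreover have "z \<noteq> ?p" using z(2) p by auto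
      ultimately show ?thesis by (simp add: G_def)
    qed (use A in \<open>simp add: le_max_iff_disj\<close>)
    then show ?thesis by (rule that)
  qed
  \<comment> \<open>The discs about \<open>p\<close> of radii \<open>\<epsilon>\<close> and \<open>2 \<epsilon>\<close> both lie inside the unit disc.\<close>
  define \<epsilon> where "\<epsilon> = (1 - p) / 3"
  have \<epsilon>: "\<epsilon> > 0" "p + 2 * \<epsilon> < 1" using p by (auto simp: \<epsilon>_def field_simps)
  obtain bump :: "complex \<Rightarrow> real" where b:
    "\<And>n. Ck n (\<lambda>z. of_real (bump z))" "\<And>z. 0 \<le> bump z" "\<And>z. bump z \<le> 1"
    "\<And>z. norm z \<le> 1 \<Longrightarrow> bump z = 1" "\<And>z. norm z \<ge> 2 \<Longrightarrow> bump z = 0"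
    using smooth_bump_exists by blast
  define \<beta> where "\<beta> z = complex_of_real (bump (- of_real (p / \<epsilon>) + of_real (1 / \<epsilon>) * z))" for z
  have arg: "norm (- of_real (p / \<epsilon>) + of_real (1 / \<epsilon>) * z) = norm (z - ?p) / \<epsilon>" for z :: complex
  proof -
    have "- of_real (p / \<epsilon>) + of_real (1 / \<epsilon>) * z = (z - ?p) / of_real \<epsilon>"
      by (simp add: diff_divide_distrib)
    then show ?thesis using \<epsilon> by (simp add: norm_divide)
  qed
  have \<beta>s: "smooth \<beta>"
    using b(1) smooth_affine[of "\<lambda>z. of_real (bump z)" "- of_real (p / \<epsilon>)" "1 / \<epsilon>"]
    by (simp add: smooth_def \<beta>_def[abs_def])
  have \<beta>1: "\<beta> z = 1" if "norm (z - ?p) \<le> \<epsilon>" for z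
  proof -
    have "norm (- of_real (p / \<epsilon>) + of_real (1 / \<epsilon>) * z) \<le> 1" unfolding arg using that \<epsilon> by (simp add: divide_le_eq)
    then show ?thesis using b(4) by (simp add: \<beta>_def)
  qed
  have \<beta>0: "\<beta> z = 0" if "norm (z - ?p) \<ge> 2 * \<epsilon>" for z
  proof -
    have "norm (- of_real (p / \<epsilon>) + of_real (1 / \<epsilon>) * z) \<ge> 2" unfolding arg using that \<epsilon> by (simp add: le_divide_eq)
    then show ?thesis using b(5) by (simp add: \<beta>_def)
  qed
  have \<beta>c: "continuous_on UNIV \<beta>" using \<beta>s by (rule smooth_continuous)
  define \<alpha> where "\<alpha> z = 1 - \<beta> z" for z
  have \<alpha>s: "smooth \<alpha>" unfolding \<alpha>_def[abs_def] by (intro smooth_diff smooth_const \<beta>s)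
  have \<alpha>c: "continuous_on UNIV \<alpha>" using \<alpha>s by (rule smooth_continuous)
  \<comment> \<open>Closed sets containing the supports of \<open>\<beta>\<close> and \<open>\<alpha>\<close>.\<close>
  define K1 where "K1 = cball ?p (2 * \<epsilon>)"
  define K2 where "K2 = - ball ?p \<epsilon>"
  have K1: "closed K1" "K1 \<subseteq> ball 0 1" "\<And>z. z \<notin> K1 \<Longrightarrow> \<beta> z = 0"
  proof -
    show "closed K1" by (simp add: K1_def)
    show "K1 \<subseteq> ball 0 1"
    proof
      fix z assume "z \<in> K1"
      then have "norm (z - ?p) \<le> 2 * \<epsilon>" by (simp add: K1_def dist_norm norm_minus_commute)
      then show "z \<in> ball 0 1" using norm_triangle_sub[of z ?p] \<epsilon> p by simp
    qed
    show "\<beta> z = 0" if "z \<notin> K1" for z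
      using that by (intro \<beta>0) (simp add: K1_def dist_norm norm_minus_commute)
  qed
  have K2: "closed K2" "K2 \<subseteq> - {?p}" "\<And>z. z \<notin> K2 \<Longrightarrow> \<alpha> z = 0"
  proof -
    show "closed K2" by (simp add: K2_def closed_Compl)
    show "K2 \<subseteq> - {?p}" using \<epsilon> by (auto simp: K2_def)
    show "\<alpha> z = 0" if "z \<notin> K2" for z
      using that \<beta>1[of z] by (simp add: K2_def \<alpha>_def dist_norm norm_minus_commute)
  qed
  define g1 where "g1 z = deriv r z * \<beta> z + (\<alpha> z * g z - deriv s z * \<alpha> z)" for z
  define h1 where "h1 z = \<alpha> z * h z" for z
  have \<alpha>_loc: "L2_loc (\<lambda>z. \<alpha> z * q z)"
    if q: "q \<in> borel_measurable borel" "\<And>K. compact K \<Longrightarrow> K \<subseteq> - {?p} \<Longrightarrow> integrable lborel (\<lambda>z. indicator K z * (norm (q z))\<^sup>2)"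
    for q
  proof -
    have *: "L2 (\<lambda>z. indicator (cball 0 \<rho> \<inter> K2) z * q z)" for \<rho>
    proof -
      have c: "compact (cball 0 \<rho> \<inter> K2)" using K2(1) by (simp add: compact_Int_closed)
      then have "cball 0 \<rho> \<inter> K2 \<in> sets borel" by (rule borel_compact)
      then have "(\<lambda>z. indicator (cball 0 \<rho> \<inter> K2) z * q z) \<in> borel_measurable borel" using q(1) by measurable
      moreover have "(\<lambda>z. (norm (indicator (cball 0 \<rho> \<inter> K2) z * q z))\<^sup>2) = (\<lambda>z. indicator (cball 0 \<rho> \<inter> K2) z * (norm (q z))\<^sup>2)"
        by (auto simp: fun_eq_iff indicator_def)
      ultimately show ?thesis using q(2)[OF c] K2(2) by (auto simp: L2_def)
    qed
    have "L2_loc (\<lambda>z. indicator K2 z * q z)"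
      unfolding L2_loc_def
    proof (intro conjI allI)
      show "(\<lambda>z. indicator K2 z * q z) \<in> borel_measurable borel"
        using q(1) borel_closed[OF K2(1)] by measurable
      show "L2 (\<lambda>z. indicator (cball 0 \<rho>) z * (indicator K2 z * q z))" for \<rho>
        using *[of \<rho>] by (simp add: indicator_inter_arith mult.assoc)
    qed
    then have "L2_loc (\<lambda>z. \<alpha> z * (indicator K2 z * q z))" by (rule L2_loc_mult_continuous[OF _ \<alpha>c])
    moreover have "(\<lambda>z. \<alpha> z * (indicator K2 z * q z)) = (\<lambda>z. \<alpha> z * q z)"
      using K2(3) by (auto simp: fun_eq_iff indicator_def)
    ultimately show ?thesis by simp
  qed
  have drc: "continuous_on (ball 0 1) (deriv r)" and dsc: "continuous_on (- {?p}) (deriv s)"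
    using r s_hol op by (auto intro!: holomorphic_on_imp_continuous_on holomorphic_deriv)
  have c1: "continuous_on UNIV (\<lambda>z. deriv r z * \<beta> z)"
    by (rule continuous_mult_extend[OF drc open_ball \<beta>c K1])
  have c2: "continuous_on UNIV (\<lambda>z. deriv s z * \<alpha> z)"
    by (rule continuous_mult_extend[OF dsc op \<alpha>c K2])
  have g\<alpha>: "L2_loc (\<lambda>z. \<alpha> z * g z)" and h\<alpha>: "L2_loc (\<lambda>z. \<alpha> z * h z)" using \<alpha>_loc m loc by auto
  have Lg1: "L2_loc g1"
  proof -
    have "L2_loc (\<lambda>z. (deriv r z * \<beta> z + - (deriv s z * \<alpha> z)) + \<alpha> z * g z)"
      by (intro L2_loc_add g\<alpha> L2_loc_continuous continuous_intros c1 c2)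
    then show ?thesis by (simp add: g1_def[abs_def] algebra_simps)
  qed
  have Lh1: "L2_loc h1" unfolding h1_def[abs_def] by (rule h\<alpha>)
  have wdG: "weak_deriv G g1 h1"
    unfolding weak_deriv_def
  proof (intro conjI allI impI Gc Lg1 Lh1)
    fix \<phi> assume \<phi>: "test \<phi>"
    let ?u = "\<lambda>z. \<beta> z * \<phi> z" and ?v = "\<lambda>z. \<alpha> z * \<phi> z"
    have tu: "test ?u" and tv: "test ?v" using \<phi> \<beta>s \<alpha>s by (auto intro: test_mult_smooth)
    have u0: "?u z = 0" if "z \<notin> K1" for z using K1(3)[OF that] by simp
    have v0: "?v z = 0" if "z \<notin> K2" for z using K2(3)[OF that] by simp
    note Pu = partial_eq_0_outside[OF K1(1), of ?u, OF u0] and Pv = partial_eq_0_outside[OF K2(1), of ?v, OF v0]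
    note iu = holomorphic_integration_by_parts[OF r open_ball tu K1(1,2) u0]
    note iv = holomorphic_integration_by_parts[OF s_hol op tv K2(1,2) v0]
    have "\<phi> = (\<lambda>z. ?u z + ?v z)" by (simp add: fun_eq_iff \<alpha>_def algebra_simps)
    then have split: "partial_z \<phi> z = partial_z ?u z + partial_z ?v z" "partial_zbar \<phi> z = partial_zbar ?u z + partial_zbar ?v z" for z
      using partial_add[OF test_differentiable[OF tu] test_differentiable[OF tv], of z] by simp_all
    \<comment> \<open>Near the pole \<open>G\<close> is the power series, elsewhere the extension minus its singular part.\<close>
    have Gu: "G z * partial_z ?u z = r z * partial_z ?u z" "G z * partial_zbar ?u z = r z * partial_zbar ?u z" for z
      using Pu[of z] Gr[of z] K1(2) by (cases "z \<in> K1"; force)+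
    have Gv: "G z * partial_z ?v z = \<Phi> z * partial_z ?v z - s z * partial_z ?v z"
      "G z * partial_zbar ?v z = \<Phi> z * partial_zbar ?v z - s z * partial_zbar ?v z" for z
      using Pv[of z] K2(2) by (cases "z \<in> K2"; auto simp: G_def algebra_simps)+
    obtain \<rho> where \<rho>: "\<And>z. norm z > \<rho> \<Longrightarrow> ?v z = 0" using tv by (auto simp: test_def)
    have Pv\<rho>: "partial_z ?v z = 0" "partial_zbar ?v z = 0" if "norm z > \<rho>" for z
      using partial_eq_0_outside[of "cball 0 \<rho>" ?v z] \<rho> that by auto
    have i\<Phi>: "integrable lborel (\<lambda>z. \<Phi> z * partial_z ?v z)" "integrable lborel (\<lambda>z. \<Phi> z * partial_zbar ?v z)"
      using continuous_mult_extend[OF \<Phi>(1) op test_continuous[OF test_partial(1)[OF tv]] K2(1,2) Pv(1)]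
        continuous_mult_extend[OF \<Phi>(1) op test_continuous[OF test_partial(2)[OF tv]] K2(1,2) Pv(2)] Pv\<rho>
      by (auto intro!: integrable_continuous_bounded_support[of _ \<rho>])
    have ig: "integrable lborel (\<lambda>z. g z * ?v z)" "integrable lborel (\<lambda>z. h z * ?v z)"
      using L2_loc_test_integrable[OF g\<alpha> \<phi>] L2_loc_test_integrable[OF h\<alpha> \<phi>] by (simp_all add: mult_ac)
    have "(\<integral>z. G z * partial_z \<phi> z \<partial>lborel) =
        (\<integral>z. r z * partial_z ?u z + (\<Phi> z * partial_z ?v z - s z * partial_z ?v z) \<partial>lborel)"
      unfolding split distrib_left Gu Gv ..
    also have "\<dots> = - (\<integral>z. deriv r z * ?u z \<partial>lborel) + (- (\<integral>z. g z * ?v z \<partial>lborel) + (\<integral>z. deriv s z * ?v z \<partial>lborel))"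
      using iu(1,3) iv(1,3) i\<Phi>(1) dz[OF tv K2(1,2) v0] by simp
    also have "\<dots> = - (\<integral>z. deriv r z * ?u z + (g z * ?v z - deriv s z * ?v z) \<partial>lborel)"
      using iu(4) iv(4) ig(1) by simp
    also have "(\<lambda>z. deriv r z * ?u z + (g z * ?v z - deriv s z * ?v z)) = (\<lambda>z. g1 z * \<phi> z)"
      by (simp add: fun_eq_iff g1_def algebra_simps)
    finally show "(\<integral>z. G z * partial_z \<phi> z \<partial>lborel) = - (\<integral>z. g1 z * \<phi> z \<partial>lborel)" .
    have "(\<integral>z. G z * partial_zbar \<phi> z \<partial>lborel) =
        (\<integral>z. r z * partial_zbar ?u z + (\<Phi> z * partial_zbar ?v z - s z * partial_zbar ?v z) \<partial>lborel)"
      unfolding split distrib_left Gu Gv ..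
    also have "\<dots> = - (\<integral>z. h z * ?v z \<partial>lborel)"
      using iu(2,5) iv(2,5) i\<Phi>(2) dzbar[OF tv K2(1,2) v0] by simp
    also have "(\<lambda>z. h z * ?v z) = (\<lambda>z. h1 z * \<phi> z)" by (simp add: fun_eq_iff h1_def mult_ac)
    finally show "(\<integral>z. G z * partial_zbar \<phi> z \<partial>lborel) = - (\<integral>z. h1 z * \<phi> z \<partial>lborel)" .
  qed
  have aeE: "AE z in lborel. norm z > 1 \<longrightarrow> norm (h1 z) \<le> k * norm (g1 z - 1 / (z - ?p)\<^sup>2)"
    using qc
  proof eventually_elim
    case (elim z)
    show ?case
    proof
      assume z: "norm z > 1"
      then have "z \<notin> K1" using K1(2) by auto
      then have "\<beta> z = 0" by (rule K1(3))
      moreover have "z \<noteq> ?p" using z p by auto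
      ultimately have "g1 z - 1 / (z - ?p)\<^sup>2 = g z" "h1 z = h z" by (simp_all add: g1_def h1_def \<alpha>_def ds)
      then show "norm (h1 z) \<le> k * norm (g1 z - 1 / (z - ?p)\<^sup>2)" using elim by simp
    qed
  qed
  show thesis by (rule that[OF wdG GB Gr aeE])
qed

theorem corollary1:
  fixes p k :: real and f :: "complex \<Rightarrow> complex" and a :: "nat \<Rightarrow> complex"
  assumes "0 < p" and "p < 1" and "0 < k" and "k < 1"
    and "f \<in> Sigma_qc k p"
    and "\<And>z. z \<in> ball 0 1 - {of_real p} \<Longrightarrow>
           (\<lambda>n. a n * z ^ n) sums (f z - 1 / (z - of_real p))"
  shows "norm (a 1) < k / (1 - p\<^sup>2)"
proof -
  have q: "norm (complex_of_real p) < 1" using assms(1,2) by simp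
  obtain r where r: "r holomorphic_on ball 0 1" "deriv r 0 = a 1"
    "\<And>z. z \<in> ball 0 1 - {of_real p} \<Longrightarrow> r z = f z - 1 / (z - of_real p)"
    using power_series_on_punctured_disc[OF q assms(6)] by blast
  obtain G g h B where w: "weak_deriv G g h" and B: "\<And>z. norm (G z) \<le> B"
    and Gr: "\<And>z. norm z < 1 \<Longrightarrow> G z = r z"
    and E: "AE z in lborel. norm z > 1 \<longrightarrow> norm (h z) \<le> k * norm (g z - 1 / (z - of_real p)\<^sup>2)"
    using weak_deriv_regular_part[OF assms(1,2,5) r(1,3)] by blast
  have "AE z in lborel. norm z > 1 \<longrightarrow> norm (h z) \<le> k * norm (g z + cnj (sewn_zbar p z))"
    using E by eventually_elim (simp add: sewn_zbar_def)
  then have "norm (deriv r 0) < k / (1 - p\<^sup>2)"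
    by (intro area_estimate[OF assms(1-4) w B holomorphic_deriv[OF r(1) open_ball] weak_deriv_on_disc[OF w r(1) Gr]])
  then show ?thesis by (simp add: r(2))
qed

end
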